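(* Over a field $\mathbb{K}$ of characteristic zero, the operad $pre\mathcal{P}oiss$ of prePoisson algebras is isomorphic to the Manin black product of the operad of preLie algebras with the operad of Poisson algebras: $$pre\mathcal{P}oiss\cong pre\mathcal{L}ie\bullet\mathcal{P}oiss.$$
   Context: Operads are symmetric operads over $\mathbb{K}$. Binary quadratic operad: $E$ is an $S_2$-module placed in arity 2, $\mathcal{F}(E)$ the free operad, $R\subset\mathcal{F}(E)(3)$ an $S_3$-stable subspace, $\mathcal{P}(E,R):=\mathcal{F}(E)/(R)$ with $(R)$ the operadic ideal generated by $R$. Koszul dual: for $E$ finite-dimensional, $E^\vee$ is the dual space of $E$ with the $S_2$-action such that $\langle e,f\rangle=\mathrm{sgn}(\sigma)\langle e\sigma,f\sigma\rangle$. One has $\mathcal{F}(E)(3)\cong\bigoplus_{(i,j,k)}E\otimes E\otimes(i,j,k)$, where $(i,j,k)$ runs over $(1,2,3),(3,1,2),(2,3,1)$ and $e\otimes e'\otimes(i,j,k)$ corresponds to $e(e'(x_i,x_j),x_k)$. The pairing of $\mathcal{F}(E)(3)$ and $\mathcal{F}(E^\vee)(3)$ is $\langle e\otimes e'\otimes(i,j,k),f\otimes f'\otimes(a,b,c)\rangle=\langle e,f\rangle\langle e',f'\rangle\delta_{ia}\delta_{jb}\delta_{kc}$; $R^\perp$ is the orthogonal space of $R$ and $\mathcal{P}^!:=\mathcal{F}(E^\vee)/(R^\perp)$. Manin white product: for $\mathcal{P}_i=\mathcal{P}(E_i,R_i)$, let $\Phi:\mathcal{F}(E_1\otimes E_2)\to\mathcal{F}(E_1)\otimes\mathcal{F}(E_2)$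 be the operad morphism extending the identity of $E_1\otimes E_2$. Then $\mathcal{P}_1\circ\mathcal{P}_2$ is the quotient of $\mathcal{F}(E_1\otimes E_2)$ by the ideal generated by $\Phi^{-1}\big(R_1\otimes\mathcal{F}(E_2)(3)+\mathcal{F}(E_1)(3)\otimes R_2\big)\subset\mathcal F(E_1\otimes E_2)(3)$. Manin black product: $\mathcal{P}_1\bullet\mathcal{P}_2:=(\mathcal{P}_1^!\circ\mathcal{P}_2^!)^!$. $pre\mathcal{L}ie$ is the operad of preLie algebras, the Koszul dual of the operad $\mathcal{P}erm$ of (left) permutation algebras (associative algebras with $(x*y)*z=(y*x)*z$). $\mathcal{P}oiss$ is the operad of Poisson algebras (a commutative associative product and a Lie bracket, both of degree 0, with the Leibniz rule). $pre\mathcal{P}oiss$, the operad of Aguiar's prePoisson algebras, is the Koszul dual of the operad of dual-prePoisson algebras. A dual-prePoisson algebra is a vector space with two bilinear operations $[\cdot,\cdot]$ and $*$ (no symmetry assumed) such that: $[x,[y,z]]=[[x,y],z]+[y,[x,z]]$; $*$ is associative and $(x*y)*z=(y*x)*z$; and $$[x,y*z]=[x,y]*z+y*[x,z],\quad [x*y,z]=x*[y,z]+y*[x,z],\quad [x,y]*z=-[y,x]*z.$$ *)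

theory Defs
  imports "HOL-Library.Poly_Mapping" "HOL-Combinatorics.Permutations"
begin

section \<open>Symmetric operads\<close>

text \<open>
  \<^term>\<open>sact P n x s\<close> is the right action of a permutation \<^term>\<open>s\<close> of \<open>{1..n}\<close>, and
  \<^term>\<open>pcomp P m n i x y\<close> is the partial composition
  \<open>x(x1, ..., y(xi, ..., x(i+n-1)), ..., x(m+n-1))\<close> of \<^term>\<open>x\<close> of arity \<^term>\<open>m\<close> and \<^term>\<open>y\<close> of
  arity \<^term>\<open>n\<close>. The arity is an argument of every operation because the components of a quotient
  operad are sets of cosets, whose operations depend on the arity.
\<close>

record ('k, 'a) operad_struct =
  ops :: "nat \<Rightarrow> 'a set"
  vadd :: "nat \<Rightarrow> 'a \<Rightarrow> 'a \<Rightarrow> 'a"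
  vzero :: "nat \<Rightarrow> 'a"
  vscale :: "nat \<Rightarrow> 'k \<Rightarrow> 'a \<Rightarrow> 'a"
  sact :: "nat \<Rightarrow> 'a \<Rightarrow> (nat \<Rightarrow> nat) \<Rightarrow> 'a"
  pcomp :: "nat \<Rightarrow> nat \<Rightarrow> nat \<Rightarrow> 'a \<Rightarrow> 'a \<Rightarrow> 'a"
  ounit :: 'a

text \<open>
  The position, among the inputs of a partial composition at input \<^term>\<open>i\<close> with an operation of
  arity \<^term>\<open>n\<close>, of the input \<^term>\<open>j\<close> (different from \<^term>\<open>i\<close>) of the outer operation.
\<close>

definition outer_input :: "nat \<Rightarrow> nat \<Rightarrow> nat \<Rightarrow> nat" where
  "outer_input i n j = (if j < i then j else j + n - 1)"

text \<open>
  The permutation \<open>r\<close> with \<open>(x s) \<circ>\<^sub>i (y t) = (x \<circ>\<^bsub>s(i)\<^esub> y) r\<close>.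
\<close>

definition comp_perm ::
    "nat \<Rightarrow> nat \<Rightarrow> nat \<Rightarrow> (nat \<Rightarrow> nat) \<Rightarrow> (nat \<Rightarrow> nat) \<Rightarrow> (nat \<Rightarrow> nat) \<Rightarrow> bool" where
  "comp_perm m n i s t r \<longleftrightarrow>
     r permutes {1..m + n - 1} \<and>
     (\<forall>j\<in>{1..m} - {i}. r (outer_input i n j) = outer_input (s i) n (s j)) \<and>
     (\<forall>l\<in>{1..n}. r (i - 1 + l) = s i - 1 + t l)"

locale operad =
  fixes P :: "('k::field, 'a) operad_struct"
  assumes zero_closed: "vzero P n \<in> ops P n"
    and add_closed: "\<lbrakk>x \<in> ops P n; y \<in> ops P n\<rbrakk> \<Longrightarrow> vadd P n x y \<in> ops P n"
    and scale_closed: "x \<in> ops P n \<Longrightarrow> vscale P n c x \<in> ops P n"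
    and add_assoc: "\<lbrakk>x \<in> ops P n; y \<in> ops P n; z \<in> ops P n\<rbrakk> \<Longrightarrow>
          vadd P n (vadd P n x y) z = vadd P n x (vadd P n y z)"
    and add_commute: "\<lbrakk>x \<in> ops P n; y \<in> ops P n\<rbrakk> \<Longrightarrow> vadd P n x y = vadd P n y x"
    and add_zero: "x \<in> ops P n \<Longrightarrow> vadd P n x (vzero P n) = x"
    and add_inverse: "x \<in> ops P n \<Longrightarrow> vadd P n x (vscale P n (- 1) x) = vzero P n"
    and scale_add_right: "\<lbrakk>x \<in> ops P n; y \<in> ops P n\<rbrakk> \<Longrightarrow>
          vscale P n c (vadd P n x y) = vadd P n (vscale P n c x) (vscale P n c y)"
    and scale_add_left: "x \<in> ops P n \<Longrightarrow>
          vscale P n (c + d) x = vadd P n (vscale P n c x) (vscale P n d x)"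
    and scale_scale: "x \<in> ops P n \<Longrightarrow> vscale P n c (vscale P n d x) = vscale P n (c * d) x"
    and scale_one: "x \<in> ops P n \<Longrightarrow> vscale P n 1 x = x"
    and act_closed: "\<lbrakk>x \<in> ops P n; s permutes {1..n}\<rbrakk> \<Longrightarrow> sact P n x s \<in> ops P n"
    and act_id: "x \<in> ops P n \<Longrightarrow> sact P n x id = x"
    and act_act: "\<lbrakk>x \<in> ops P n; s permutes {1..n}; t permutes {1..n}\<rbrakk> \<Longrightarrow>
          sact P n (sact P n x s) t = sact P n x (s \<circ> t)"
    and act_add: "\<lbrakk>x \<in> ops P n; y \<in> ops P n; s permutes {1..n}\<rbrakk> \<Longrightarrow>
          sact P n (vadd P n x y) s = vadd P n (sact P n x s) (sact P n y s)"
    and act_scale: "\<lbrakk>x \<in> ops P n; s permutes {1..n}\<rbrakk> \<Longrightarrow>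
          sact P n (vscale P n c x) s = vscale P n c (sact P n x s)"
    and unit_closed: "ounit P \<in> ops P 1"
    and comp_closed: "\<lbrakk>x \<in> ops P m; y \<in> ops P n; i \<in> {1..m}\<rbrakk> \<Longrightarrow>
          pcomp P m n i x y \<in> ops P (m + n - 1)"
    and comp_add_left: "\<lbrakk>x \<in> ops P m; x' \<in> ops P m; y \<in> ops P n; i \<in> {1..m}\<rbrakk> \<Longrightarrow>
          pcomp P m n i (vadd P m x x') y =
            vadd P (m + n - 1) (pcomp P m n i x y) (pcomp P m n i x' y)"
    and comp_add_right: "\<lbrakk>x \<in> ops P m; y \<in> ops P n; y' \<in> ops P n; i \<in> {1..m}\<rbrakk> \<Longrightarrow>
          pcomp P m n i x (vadd P n y y') =
            vadd P (m + n - 1) (pcomp P m n i x y) (pcomp P m n i x y')"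
    and comp_scale_left: "\<lbrakk>x \<in> ops P m; y \<in> ops P n; i \<in> {1..m}\<rbrakk> \<Longrightarrow>
          pcomp P m n i (vscale P m c x) y = vscale P (m + n - 1) c (pcomp P m n i x y)"
    and comp_scale_right: "\<lbrakk>x \<in> ops P m; y \<in> ops P n; i \<in> {1..m}\<rbrakk> \<Longrightarrow>
          pcomp P m n i x (vscale P n c y) = vscale P (m + n - 1) c (pcomp P m n i x y)"
    and comp_unit_left: "x \<in> ops P n \<Longrightarrow> pcomp P 1 n 1 (ounit P) x = x"
    and comp_unit_right: "\<lbrakk>x \<in> ops P m; i \<in> {1..m}\<rbrakk> \<Longrightarrow> pcomp P m 1 i x (ounit P) = x"
    and comp_sequential: "\<lbrakk>x \<in> ops P l; y \<in> ops P m; z \<in> ops P n; i \<in> {1..l}; j \<in> {1..m}\<rbrakk> \<Longrightarrow>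
          pcomp P (l + m - 1) n (i - 1 + j) (pcomp P l m i x y) z =
            pcomp P l (m + n - 1) i x (pcomp P m n j y z)"
    and comp_parallel: "\<lbrakk>x \<in> ops P l; y \<in> ops P m; z \<in> ops P n; i \<in> {1..l}; k \<in> {1..l}; i < k\<rbrakk> \<Longrightarrow>
          pcomp P (l + m - 1) n (k + m - 1) (pcomp P l m i x y) z =
            pcomp P (l + n - 1) m i (pcomp P l n k x z) y"
    and comp_act: "\<lbrakk>x \<in> ops P m; y \<in> ops P n; i \<in> {1..m}; s permutes {1..m}; t permutes {1..n};
          comp_perm m n i s t r\<rbrakk> \<Longrightarrow>
          pcomp P m n i (sact P m x s) (sact P n y t) =
            sact P (m + n - 1) (pcomp P m n (s i) x y) r"

definition operad_morphism ::
    "('k, 'a) operad_struct \<Rightarrow> ('k, 'b) operad_struct \<Rightarrow> (nat \<Rightarrow> 'a \<Rightarrow> 'b) \<Rightarrow> bool" where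
  "operad_morphism P Q f \<longleftrightarrow>
     (\<forall>n. \<forall>x\<in>ops P n. f n x \<in> ops Q n) \<and>
     (\<forall>n. \<forall>x\<in>ops P n. \<forall>y\<in>ops P n. f n (vadd P n x y) = vadd Q n (f n x) (f n y)) \<and>
     (\<forall>n c. \<forall>x\<in>ops P n. f n (vscale P n c x) = vscale Q n c (f n x)) \<and>
     (\<forall>n s. \<forall>x\<in>ops P n. s permutes {1..n} \<longrightarrow> f n (sact P n x s) = sact Q n (f n x) s) \<and>
     (\<forall>m n. \<forall>i\<in>{1..m}. \<forall>x\<in>ops P m. \<forall>y\<in>ops P n.
        f (m + n - 1) (pcomp P m n i x y) = pcomp Q m n i (f m x) (f n y)) \<and>
     f 1 (ounit P) = ounit Q"

definition operad_isomorphic ::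
    "('k::field, 'a) operad_struct \<Rightarrow> ('k, 'b) operad_struct \<Rightarrow> bool" where
  "operad_isomorphic P Q \<longleftrightarrow>
     operad P \<and> operad Q \<and>
     (\<exists>f. operad_morphism P Q f \<and> (\<forall>n. bij_betw (f n) (ops P n) (ops Q n)))"


section \<open>Subspaces, ideals and quotients\<close>

definition subspace_of :: "('k, 'a) operad_struct \<Rightarrow> nat \<Rightarrow> 'a set \<Rightarrow> bool" where
  "subspace_of P n S \<longleftrightarrow>
     S \<subseteq> ops P n \<and> vzero P n \<in> S \<and>
     (\<forall>x\<in>S. \<forall>y\<in>S. vadd P n x y \<in> S) \<and>
     (\<forall>c. \<forall>x\<in>S. vscale P n c x \<in> S)"

definition span_of :: "('k, 'a) operad_struct \<Rightarrow> nat \<Rightarrow> 'a set \<Rightarrow> 'a set" where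
  "span_of P n G = \<Inter> {S. subspace_of P n S \<and> G \<subseteq> S}"

definition stable_span_of :: "('k, 'a) operad_struct \<Rightarrow> nat \<Rightarrow> 'a set \<Rightarrow> 'a set" where
  "stable_span_of P n G =
     \<Inter> {S. subspace_of P n S \<and> (\<forall>x\<in>S. \<forall>s. s permutes {1..n} \<longrightarrow> sact P n x s \<in> S) \<and> G \<subseteq> S}"

definition operad_ideal :: "('k, 'a) operad_struct \<Rightarrow> (nat \<Rightarrow> 'a set) \<Rightarrow> bool" where
  "operad_ideal P I \<longleftrightarrow>
     (\<forall>n. subspace_of P n (I n)) \<and>
     (\<forall>n s. \<forall>x\<in>I n. s permutes {1..n} \<longrightarrow> sact P n x s \<in> I n) \<and>
     (\<forall>m n. \<forall>i\<in>{1..m}. \<forall>x\<in>ops P m. \<forall>y\<in>ops P n.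
        x \<in> I m \<or> y \<in> I n \<longrightarrow> pcomp P m n i x y \<in> I (m + n - 1))"

definition ideal_gen :: "('k, 'a) operad_struct \<Rightarrow> (nat \<Rightarrow> 'a set) \<Rightarrow> nat \<Rightarrow> 'a set" where
  "ideal_gen P G n = \<Inter> {I n | I. operad_ideal P I \<and> (\<forall>m. G m \<subseteq> I m)}"

definition in_arity :: "nat \<Rightarrow> 'a set \<Rightarrow> nat \<Rightarrow> 'a set" where
  "in_arity k S n = (if n = k then S else {})"

definition coset :: "('k, 'a) operad_struct \<Rightarrow> (nat \<Rightarrow> 'a set) \<Rightarrow> nat \<Rightarrow> 'a \<Rightarrow> 'a set" where
  "coset P I n x = {vadd P n x y | y. y \<in> I n}"

definition quot_operad ::
    "('k, 'a) operad_struct \<Rightarrow> (nat \<Rightarrow> 'a set) \<Rightarrow> ('k, 'a set) operad_struct" where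
  "quot_operad P I =
     \<lparr>ops = \<lambda>n. coset P I n ` ops P n,
      vadd = \<lambda>n A B. \<Union>x\<in>A. \<Union>y\<in>B. coset P I n (vadd P n x y),
      vzero = \<lambda>n. coset P I n (vzero P n),
      vscale = \<lambda>n c A. \<Union>x\<in>A. coset P I n (vscale P n c x),
      sact = \<lambda>n A s. \<Union>x\<in>A. coset P I n (sact P n x s),
      pcomp = \<lambda>m n i A B. \<Union>x\<in>A. \<Union>y\<in>B. coset P I (m + n - 1) (pcomp P m n i x y),
      ounit = coset P I 1 (ounit P)\<rparr>"


section \<open>Linearisation of operads in sets\<close>

record 'a set_operad_struct =
  set_ops :: "nat \<Rightarrow> 'a set"
  set_sact :: "nat \<Rightarrow> 'a \<Rightarrow> (nat \<Rightarrow> nat) \<Rightarrow> 'a"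
  set_pcomp :: "nat \<Rightarrow> nat \<Rightarrow> nat \<Rightarrow> 'a \<Rightarrow> 'a \<Rightarrow> 'a"
  set_unit :: 'a

definition pm_scale :: "'k::field \<Rightarrow> ('a \<Rightarrow>\<^sub>0 'k) \<Rightarrow> ('a \<Rightarrow>\<^sub>0 'k)" where
  "pm_scale c = Poly_Mapping.map ((*) c)"

definition lin_map :: "('a \<Rightarrow> 'b) \<Rightarrow> ('a \<Rightarrow>\<^sub>0 'k::field) \<Rightarrow> ('b \<Rightarrow>\<^sub>0 'k)" where
  "lin_map f x = (\<Sum>a\<in>Poly_Mapping.keys x. Poly_Mapping.single (f a) (Poly_Mapping.lookup x a))"

definition lin_map2 ::
    "('a \<Rightarrow> 'b \<Rightarrow> 'c) \<Rightarrow> ('a \<Rightarrow>\<^sub>0 'k::field) \<Rightarrow> ('b \<Rightarrow>\<^sub>0 'k) \<Rightarrow> ('c \<Rightarrow>\<^sub>0 'k)" where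
  "lin_map2 f x y = (\<Sum>a\<in>Poly_Mapping.keys x. \<Sum>b\<in>Poly_Mapping.keys y.
     Poly_Mapping.single (f a b) (Poly_Mapping.lookup x a * Poly_Mapping.lookup y b))"

definition linearisation :: "'a set_operad_struct \<Rightarrow> ('k::field, 'a \<Rightarrow>\<^sub>0 'k) operad_struct" where
  "linearisation S =
     \<lparr>ops = \<lambda>n. {x. Poly_Mapping.keys x \<subseteq> set_ops S n},
      vadd = \<lambda>_. (+),
      vzero = \<lambda>_. 0,
      vscale = \<lambda>_. pm_scale,
      sact = \<lambda>n x s. lin_map (\<lambda>a. set_sact S n a s) x,
      pcomp = \<lambda>m n i. lin_map2 (set_pcomp S m n i),
      ounit = Poly_Mapping.single (set_unit S) 1\<rparr>"


section \<open>The free operad on a binary \<open>S\<^sub>2\<close>-module\<close>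

text \<open>
  A finite-dimensional \<open>S\<^sub>2\<close>-module \<open>E\<close> is given by the matrix, in a basis indexed by a finite type,
  of the action of the transposition \<open>\<tau>\<close>: \<open>e\<^sub>i \<tau> = (\<Sum>j. T i j e\<^sub>j)\<close>.
\<close>

type_synonym ('i, 'k) S2_module = "'i \<Rightarrow> 'i \<Rightarrow> 'k"

datatype 'i tree = Leaf nat | Node 'i "'i tree" "'i tree"

primrec leaves :: "'i tree \<Rightarrow> nat list" where
  "leaves (Leaf l) = [l]"
| "leaves (Node i s t) = leaves s @ leaves t"

primrec graft :: "(nat \<Rightarrow> 'i tree) \<Rightarrow> 'i tree \<Rightarrow> 'i tree" where
  "graft f (Leaf l) = f l"
| "graft f (Node i s t) = Node i (graft f s) (graft f t)"

definition relabel :: "(nat \<Rightarrow> nat) \<Rightarrow> 'i tree \<Rightarrow> 'i tree" where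
  "relabel g = graft (\<lambda>l. Leaf (g l))"

text \<open>
  A tree with leaves \<open>1, ..., n\<close> is an operation of the variables \<open>x1, ..., xn\<close>; the right action is
  \<open>(a s)(x1, ..., xn) = a(x\<^bsub>s\<inverse>(1)\<^esub>, ..., x\<^bsub>s\<inverse>(n)\<^esub>)\<close>.
\<close>

definition tree_operad :: "'i tree set_operad_struct" where
  "tree_operad =
     \<lparr>set_ops = \<lambda>n. {t. distinct (leaves t) \<and> set (leaves t) = {1..n}},
      set_sact = \<lambda>n t s. relabel (inv s) t,
      set_pcomp = \<lambda>m n i s t.
        graft (\<lambda>j. if j = i then relabel (\<lambda>l. i - 1 + l) t else Leaf (outer_input i n j)) s,
      set_unit = Leaf 1\<rparr>"

abbreviation mono :: "'i tree \<Rightarrow> ('i tree \<Rightarrow>\<^sub>0 'k::field)" where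
  "mono t \<equiv> Poly_Mapping.single t 1"

text \<open>
  The operad of all trees is free on the free \<open>S\<^sub>2\<close>-module with basis \<^typ>\<open>'i\<close>. The free operad on \<open>E\<close>
  is its quotient by the relations \<open>e\<^sub>i \<tau> = (\<Sum>j. T i j e\<^sub>j)\<close>, where \<open>(e\<^sub>i \<tau>)(x1, x2) = e\<^sub>i(x2, x1)\<close>.
\<close>

definition sym_relators :: "('i::finite, 'k::field) S2_module \<Rightarrow> ('i tree \<Rightarrow>\<^sub>0 'k) set" where
  "sym_relators T =
     {mono (Node i (Leaf 2) (Leaf 1)) -
        (\<Sum>j\<in>UNIV. Poly_Mapping.single (Node j (Leaf 1) (Leaf 2)) (T i j)) | i. True}"

definition sym_ideal :: "('i::finite, 'k::field) S2_module \<Rightarrow> nat \<Rightarrow> ('i tree \<Rightarrow>\<^sub>0 'k) set" where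
  "sym_ideal T = ideal_gen (linearisation tree_operad) (in_arity 2 (sym_relators T))"

definition free_operad ::
    "('i::finite, 'k::field) S2_module \<Rightarrow> ('k, ('i tree \<Rightarrow>\<^sub>0 'k) set) operad_struct" where
  "free_operad T = quot_operad (linearisation tree_operad) (sym_ideal T)"

definition free_class ::
    "('i::finite, 'k::field) S2_module \<Rightarrow> nat \<Rightarrow> ('i tree \<Rightarrow>\<^sub>0 'k) \<Rightarrow> ('i tree \<Rightarrow>\<^sub>0 'k) set" where
  "free_class T n x = coset (linearisation tree_operad) (sym_ideal T) n x"

definition free_gen :: "('i::finite, 'k::field) S2_module \<Rightarrow> 'i \<Rightarrow> ('i tree \<Rightarrow>\<^sub>0 'k) set" where
  "free_gen T i = free_class T 2 (mono (Node i (Leaf 1) (Leaf 2)))"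


section \<open>Binary quadratic operads and Koszul duality\<close>

record (overloaded) ('i, 'k) quadratic_data =
  gens :: "('i, 'k) S2_module"
  rels :: "('i tree \<Rightarrow>\<^sub>0 'k) set set"

definition quadratic_data_of_relators ::
    "('i::finite, 'k::field) S2_module \<Rightarrow> ('i tree \<Rightarrow>\<^sub>0 'k) set \<Rightarrow> ('i, 'k) quadratic_data" where
  "quadratic_data_of_relators T G =
     \<lparr>gens = T, rels = stable_span_of (free_operad T) 3 (free_class T 3 ` G)\<rparr>"

definition quadratic_operad ::
    "('i::finite, 'k::field) quadratic_data \<Rightarrow> ('k, ('i tree \<Rightarrow>\<^sub>0 'k) set set) operad_struct" where
  "quadratic_operad Q =
     quot_operad (free_operad (gens Q)) (ideal_gen (free_operad (gens Q)) (in_arity 3 (rels Q)))"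

text \<open>
  In the dual basis, \<open>\<langle>e\<^sub>j, f\<^sub>i \<tau>\<rangle> = sgn(\<tau>) \<langle>e\<^sub>j \<tau>, f\<^sub>i\<rangle> = - T j i\<close>.
\<close>

definition dual_module :: "('i, 'k::field) S2_module \<Rightarrow> ('i, 'k) S2_module" where
  "dual_module T = (\<lambda>i j. - T j i)"

definition cyclic_triples :: "(nat \<times> nat \<times> nat) set" where
  "cyclic_triples = {(1, 2, 3), (3, 1, 2), (2, 3, 1)}"

text \<open>
  The isomorphism from the direct sum of the \<open>E \<otimes> E \<otimes> (a, b, c)\<close> onto the component of arity 3 of
  the free operad; \<open>u (i, j, (a, b, c))\<close> is the coefficient of \<open>e\<^sub>i \<otimes> e\<^sub>j \<otimes> (a, b, c)\<close>.
\<close>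

definition arity3_element ::
    "('i::finite, 'k::field) S2_module \<Rightarrow> ('i \<times> 'i \<times> (nat \<times> nat \<times> nat) \<Rightarrow> 'k) \<Rightarrow>
      ('i tree \<Rightarrow>\<^sub>0 'k) set" where
  "arity3_element T u = free_class T 3
     (\<Sum>(i, j, (a, b, c)) \<in> UNIV \<times> UNIV \<times> cyclic_triples.
        Poly_Mapping.single (Node i (Node j (Leaf a) (Leaf b)) (Leaf c)) (u (i, j, (a, b, c))))"

definition arity3_pairing ::
    "('i::finite \<times> 'i \<times> (nat \<times> nat \<times> nat) \<Rightarrow> 'k::field) \<Rightarrow>
     ('i \<times> 'i \<times> (nat \<times> nat \<times> nat) \<Rightarrow> 'k) \<Rightarrow> 'k" where
  "arity3_pairing u v = (\<Sum>p \<in> UNIV \<times> UNIV \<times> cyclic_triples. u p * v p)"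

definition koszul_dual :: "('i::finite, 'k::field) quadratic_data \<Rightarrow> ('i, 'k) quadratic_data" where
  "koszul_dual Q =
     \<lparr>gens = dual_module (gens Q),
      rels = {arity3_element (dual_module (gens Q)) v | v.
                \<forall>u. arity3_element (gens Q) u \<in> rels Q \<longrightarrow> arity3_pairing u v = 0}\<rparr>"


section \<open>Manin products\<close>

definition pair_operad ::
    "('k, 'a) operad_struct \<Rightarrow> ('k, 'b) operad_struct \<Rightarrow> ('a \<times> 'b) set_operad_struct" where
  "pair_operad P Q =
     \<lparr>set_ops = \<lambda>n. ops P n \<times> ops Q n,
      set_sact = \<lambda>n (x, y) s. (sact P n x s, sact Q n y s),
      set_pcomp = \<lambda>m n i (x, y) (x', y'). (pcomp P m n i x x', pcomp Q m n i y y'),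
      set_unit = (ounit P, ounit Q)\<rparr>"

definition bilinearity_relators ::
    "('k::field, 'a) operad_struct \<Rightarrow> ('k, 'b) operad_struct \<Rightarrow> nat \<Rightarrow> ('a \<times> 'b \<Rightarrow>\<^sub>0 'k) set" where
  "bilinearity_relators P Q n =
     {Poly_Mapping.single (vadd P n x x', y) 1 - Poly_Mapping.single (x, y) 1
        - Poly_Mapping.single (x', y) 1
        | x x' y. x \<in> ops P n \<and> x' \<in> ops P n \<and> y \<in> ops Q n} \<union>
     {Poly_Mapping.single (x, vadd Q n y y') 1 - Poly_Mapping.single (x, y) 1
        - Poly_Mapping.single (x, y') 1
        | x y y'. x \<in> ops P n \<and> y \<in> ops Q n \<and> y' \<in> ops Q n} \<union>
     {Poly_Mapping.single (vscale P n c x, y) 1 - Poly_Mapping.single (x, y) c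
        | c x y. x \<in> ops P n \<and> y \<in> ops Q n} \<union>
     {Poly_Mapping.single (x, vscale Q n c y) 1 - Poly_Mapping.single (x, y) c
        | c x y. x \<in> ops P n \<and> y \<in> ops Q n}"

definition bilinearity_ideal ::
    "('k::field, 'a) operad_struct \<Rightarrow> ('k, 'b) operad_struct \<Rightarrow> nat \<Rightarrow> ('a \<times> 'b \<Rightarrow>\<^sub>0 'k) set" where
  "bilinearity_ideal P Q n =
     span_of (linearisation (pair_operad P Q)) n (bilinearity_relators P Q n)"

text \<open>The arity-wise tensor product of two operads.\<close>

definition tensor_operad ::
    "('k::field, 'a) operad_struct \<Rightarrow> ('k, 'b) operad_struct \<Rightarrow>
      ('k, ('a \<times> 'b \<Rightarrow>\<^sub>0 'k) set) operad_struct" where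
  "tensor_operad P Q = quot_operad (linearisation (pair_operad P Q)) (bilinearity_ideal P Q)"

definition pure_tensor ::
    "('k::field, 'a) operad_struct \<Rightarrow> ('k, 'b) operad_struct \<Rightarrow> nat \<Rightarrow> 'a \<Rightarrow> 'b \<Rightarrow>
      ('a \<times> 'b \<Rightarrow>\<^sub>0 'k) set" where
  "pure_tensor P Q n x y =
     coset (linearisation (pair_operad P Q)) (bilinearity_ideal P Q) n (Poly_Mapping.single (x, y) 1)"

text \<open>\<open>E\<^sub>1 \<otimes> E\<^sub>2\<close> with the basis \<open>e\<^sub>i \<otimes> e\<^sub>j\<close> and the diagonal action.\<close>

definition tensor_module ::
    "('i, 'k::field) S2_module \<Rightarrow> ('j, 'k) S2_module \<Rightarrow> ('i \<times> 'j, 'k) S2_module" where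
  "tensor_module T1 T2 = (\<lambda>(i, j) (k, l). T1 i k * T2 j l)"

text \<open>
  The operad morphism extending the identity of \<open>E\<^sub>1 \<otimes> E\<^sub>2\<close>. It is determined on the components only,
  so it is chosen among the functions that agree there.
\<close>

definition manin_morphism ::
    "('i::finite, 'k::field) S2_module \<Rightarrow> ('j::finite, 'k) S2_module \<Rightarrow> nat \<Rightarrow>
      (('i \<times> 'j) tree \<Rightarrow>\<^sub>0 'k) set \<Rightarrow> (('i tree \<Rightarrow>\<^sub>0 'k) set \<times> ('j tree \<Rightarrow>\<^sub>0 'k) set \<Rightarrow>\<^sub>0 'k) set" where
  "manin_morphism T1 T2 = (SOME f.
     operad_morphism (free_operad (tensor_module T1 T2))
       (tensor_operad (free_operad T1) (free_operad T2)) f \<and>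
     (\<forall>i j. f 2 (free_gen (tensor_module T1 T2) (i, j)) =
        pure_tensor (free_operad T1) (free_operad T2) 2 (free_gen T1 i) (free_gen T2 j)))"

definition white_product ::
    "('i::finite, 'k::field) quadratic_data \<Rightarrow> ('j::finite, 'k) quadratic_data \<Rightarrow>
      ('i \<times> 'j, 'k) quadratic_data" where
  "white_product Q1 Q2 =
     (let F1 = free_operad (gens Q1); F2 = free_operad (gens Q2);
          T = tensor_module (gens Q1) (gens Q2)
      in \<lparr>gens = T,
          rels = {x \<in> ops (free_operad T) 3.
            manin_morphism (gens Q1) (gens Q2) 3 x \<in>
              span_of (tensor_operad F1 F2) 3
                ({pure_tensor F1 F2 3 r y | r y. r \<in> rels Q1 \<and> y \<in> ops F2 3} \<union>
                 {pure_tensor F1 F2 3 x r | x r. x \<in> ops F1 3 \<and> r \<in> rels Q2})}\<rparr>)"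

definition black_product ::
    "('i::finite, 'k::field) quadratic_data \<Rightarrow> ('j::finite, 'k) quadratic_data \<Rightarrow>
      ('i \<times> 'j, 'k) quadratic_data" where
  "black_product Q1 Q2 = koszul_dual (white_product (koszul_dual Q1) (koszul_dual Q2))"


section \<open>The operads of the statement\<close>

text \<open>
  A binary operation \<open>p\<close> without symmetry spans the regular representation, with basis
  \<open>(p, False)\<close>, which is \<open>p(x1, x2)\<close>, and \<open>(p, True)\<close>, which is \<open>p(x2, x1)\<close>.
\<close>

definition regular_module :: "('p \<times> bool, 'k::field) S2_module" where
  "regular_module = (\<lambda>(p, b) (q, c). if p = q \<and> b \<noteq> c then 1 else 0)"

definition perm_data :: "(unit \<times> bool, 'k::field) quadratic_data" where
  "perm_data =
     (let m = Node ((), False); x = Leaf 1; y = Leaf 2; z = Leaf 3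
      in quadratic_data_of_relators regular_module
        {mono (m (m x y) z) - mono (m x (m y z)),
         mono (m (m x y) z) - mono (m (m y x) z)})"

definition preLie_data :: "(unit \<times> bool, 'k::field) quadratic_data" where
  "preLie_data = koszul_dual perm_data"

datatype poisson_op = Com | Lie

instance poisson_op :: finite
proof
  have "(UNIV :: poisson_op set) = {Com, Lie}"
    using poisson_op.exhaust by auto
  then show "finite (UNIV :: poisson_op set)"
    by (metis finite.emptyI finite.insertI)
qed

definition poisson_module :: "(poisson_op, 'k::field) S2_module" where
  "poisson_module = (\<lambda>p q. if p \<noteq> q then 0 else case p of Com \<Rightarrow> 1 | Lie \<Rightarrow> - 1)"

definition poisson_data :: "(poisson_op, 'k::field) quadratic_data" where
  "poisson_data =
     (let c = Node Com; l = Node Lie; x = Leaf 1; y = Leaf 2; z = Leaf 3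
      in quadratic_data_of_relators poisson_module
        {mono (c (c x y) z) - mono (c x (c y z)),
         mono (l (l x y) z) + mono (l (l y z) x) + mono (l (l z x) y),
         mono (l x (c y z)) - mono (c (l x y) z) - mono (c y (l x z))})"

datatype dual_prepoisson_op = Bracket | Star

instance dual_prepoisson_op :: finite
proof
  have "(UNIV :: dual_prepoisson_op set) = {Bracket, Star}"
    using dual_prepoisson_op.exhaust by auto
  then show "finite (UNIV :: dual_prepoisson_op set)"
    by (metis finite.emptyI finite.insertI)
qed

definition dual_prePoisson_data :: "(dual_prepoisson_op \<times> bool, 'k::field) quadratic_data" where
  "dual_prePoisson_data =
     (let b = Node (Bracket, False); m = Node (Star, False); x = Leaf 1; y = Leaf 2; z = Leaf 3
      in quadratic_data_of_relators regular_module
        {mono (b x (b y z)) - mono (b (b x y) z) - mono (b y (b x z)),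
         mono (m (m x y) z) - mono (m x (m y z)),
         mono (m (m x y) z) - mono (m (m y x) z),
         mono (b x (m y z)) - mono (m (b x y) z) - mono (m y (b x z)),
         mono (b (m x y) z) - mono (m x (b y z)) - mono (m y (b x z)),
         mono (m (b x y) z) + mono (m (b y x) z)})"

definition prePoisson_data :: "(dual_prepoisson_op \<times> bool, 'k::field) quadratic_data" where
  "prePoisson_data = koszul_dual dual_prePoisson_data"


section \<open>The constructions are operads\<close>

subsection \<open>Linearisation\<close>

lemma pm_expand: "x = (\<Sum>a\<in>Poly_Mapping.keys x. Poly_Mapping.single a (Poly_Mapping.lookup x a))"
  by (rule poly_mapping_eqI)
     (auto simp: lookup_sum lookup_single when_def not_in_keys_iff_lookup_eq_zero)

lemma pm_induct [consumes 1, case_names zero single add]: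
  assumes "Poly_Mapping.keys x \<subseteq> S"
    and "P 0" and "\<And>a c. a \<in> S \<Longrightarrow> P (Poly_Mapping.single a c)"
    and "\<And>x y. \<lbrakk>P x; P y\<rbrakk> \<Longrightarrow> P (x + y)"
  shows "P (x :: 'a \<Rightarrow>\<^sub>0 'b::comm_monoid_add)"
proof -
  have "P (\<Sum>a\<in>A. Poly_Mapping.single a (f a))" if "finite A" "A \<subseteq> S" for A and f :: "'a \<Rightarrow> 'b"
    using that by (induction A) (auto intro: assms)
  from this[OF finite_keys assms(1)] show ?thesis
    using pm_expand[of x] by metis
qed

lemma lookup_pm_scale [simp]: "Poly_Mapping.lookup (pm_scale c x) a = c * Poly_Mapping.lookup x a"
  unfolding pm_scale_def by (transfer) (auto simp: when_def)

lemma pm_scale_zero [simp]: "pm_scale c 0 = 0"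
  by (rule poly_mapping_eqI) simp

lemma pm_scale_single [simp]: "pm_scale c (Poly_Mapping.single a d) = Poly_Mapping.single a (c * d)"
  by (rule poly_mapping_eqI) (simp add: lookup_single when_def)

lemma pm_scale_add: "pm_scale c (x + y) = pm_scale c x + pm_scale c y"
  by (rule poly_mapping_eqI) (simp add: lookup_add algebra_simps)

lemma pm_scale_add_left: "pm_scale (c + d) x = pm_scale c x + pm_scale d x"
  by (rule poly_mapping_eqI) (simp add: lookup_add algebra_simps)

lemma pm_scale_scale: "pm_scale c (pm_scale d x) = pm_scale (c * d) x"
  by (rule poly_mapping_eqI) (simp add: algebra_simps)

lemma pm_scale_one [simp]: "pm_scale 1 x = x"
  by (rule poly_mapping_eqI) simp

lemma pm_scale_minus_one: "pm_scale (- 1) x = - x"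
  by (rule poly_mapping_eqI) simp

lemma keys_pm_scale: "Poly_Mapping.keys (pm_scale c x) \<subseteq> Poly_Mapping.keys x"
  by (auto simp: in_keys_iff)

lemma lin_map_superset:
  assumes "finite A" "Poly_Mapping.keys x \<subseteq> A"
  shows "lin_map f x = (\<Sum>a\<in>A. Poly_Mapping.single (f a) (Poly_Mapping.lookup x a))"
  unfolding lin_map_def
  by (rule sum.mono_neutral_left) (use assms in \<open>auto simp: not_in_keys_iff_lookup_eq_zero\<close>)

lemma lin_map_zero [simp]: "lin_map f 0 = 0"
  by (simp add: lin_map_def)

lemma lin_map_single [simp]: "lin_map f (Poly_Mapping.single a c) = Poly_Mapping.single (f a) c"
  by (cases "c = 0") (simp_all add: lin_map_def)

lemma lin_map_add: "lin_map f (x + y) = lin_map f x + lin_map f y"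
proof -
  let ?A = "Poly_Mapping.keys x \<union> Poly_Mapping.keys y"
  have "Poly_Mapping.keys (x + y) \<subseteq> ?A" by (rule keys_add)
  then show ?thesis
    by (subst (1 2 3) lin_map_superset[of ?A])
       (auto simp: lookup_add single_add sum.distrib)
qed

lemma lin_map_scale: "lin_map f (pm_scale c x) = pm_scale c (lin_map f x)"
  by (induction x rule: pm_induct[OF subset_UNIV]) (auto simp: lin_map_add pm_scale_add)

lemma keys_lin_map:
  fixes f :: "'a \<Rightarrow> 'b" and x :: "'a \<Rightarrow>\<^sub>0 'k::field"
  shows "Poly_Mapping.keys (lin_map f x) \<subseteq> f ` Poly_Mapping.keys x"
proof -
  have "Poly_Mapping.keys (\<Sum>a\<in>A. Poly_Mapping.single (f a) (g a)) \<subseteq> f ` A" if "finite A" for A and g :: "'a \<Rightarrow> 'k"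
    using that by (induction A) (auto dest!: set_mp[OF keys_add] split: if_splits)
  then show ?thesis by (simp add: lin_map_def)
qed

lemma lin_map2_alt:
  fixes f :: "'a \<Rightarrow> 'b \<Rightarrow> 'c" and x :: "'a \<Rightarrow>\<^sub>0 'k::field"
  shows "lin_map2 f x y =
   (\<Sum>a\<in>Poly_Mapping.keys x. pm_scale (Poly_Mapping.lookup x a) (lin_map (f a) y))"
proof -
  have s: "pm_scale c (sum g A) = (\<Sum>a\<in>A. pm_scale c (g a))" for c and g :: "'b \<Rightarrow> ('c \<Rightarrow>\<^sub>0 'k)" and A
    by (induction A rule: infinite_finite_induct) (auto simp: pm_scale_add)
  show ?thesis unfolding lin_map2_def lin_map_def s by simp
qed

lemma lin_map2_superset:
  fixes f :: "'a \<Rightarrow> 'b \<Rightarrow> 'c" and x :: "'a \<Rightarrow>\<^sub>0 'k::field"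
  assumes "finite A" "Poly_Mapping.keys x \<subseteq> A"
  shows "lin_map2 f x y = (\<Sum>a\<in>A. pm_scale (Poly_Mapping.lookup x a) (lin_map (f a) y))"
proof -
  have z: "pm_scale 0 z = 0" for z :: "'c \<Rightarrow>\<^sub>0 'k" by (rule poly_mapping_eqI) simp
  show ?thesis
  unfolding lin_map2_alt
  by (rule sum.mono_neutral_left) (use assms in \<open>auto simp: not_in_keys_iff_lookup_eq_zero z\<close>)
qed

lemma lin_map2_add_left: "lin_map2 f (x + x') y = lin_map2 f x y + lin_map2 f x' y"
proof -
  let ?A = "Poly_Mapping.keys x \<union> Poly_Mapping.keys x'"
  have "Poly_Mapping.keys (x + x') \<subseteq> ?A" by (rule keys_add)
  then show ?thesis
    by (subst (1 2 3) lin_map2_superset[of ?A])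
       (auto simp: lookup_add pm_scale_add_left sum.distrib)
qed

lemma lin_map2_add_right: "lin_map2 f x (y + y') = lin_map2 f x y + lin_map2 f x y'"
  by (simp add: lin_map2_alt lin_map_add pm_scale_add sum.distrib)

lemma lin_map2_zero [simp]: "lin_map2 f 0 y = 0" "lin_map2 f x 0 = 0"
  by (simp_all add: lin_map2_def)

lemma lin_map2_single [simp]:
  "lin_map2 f (Poly_Mapping.single a c) (Poly_Mapping.single b d) = Poly_Mapping.single (f a b) (c * d)"
  by (cases "c = 0"; cases "d = 0") (simp_all add: lin_map2_def)

lemma lin_map2_scale_left: "lin_map2 f (pm_scale c x) y = pm_scale c (lin_map2 f x y)"
proof (induction x rule: pm_induct[OF subset_UNIV])
  case (2 a d)
  show ?case
    by (induction y rule: pm_induct[OF subset_UNIV])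
       (use 2 in \<open>auto simp: lin_map2_add_right pm_scale_add mult.assoc\<close>)
qed (auto simp: lin_map2_add_left pm_scale_add)

lemma lin_map2_scale_right: "lin_map2 f x (pm_scale c y) = pm_scale c (lin_map2 f x y)"
proof (induction x rule: pm_induct[OF subset_UNIV])
  case (2 a d)
  show ?case
    by (induction y rule: pm_induct[OF subset_UNIV])
       (use 2 in \<open>auto simp: lin_map2_add_right pm_scale_add mult.left_commute\<close>)
qed (auto simp: lin_map2_add_left pm_scale_add)

lemma keys_lin_map2:
  fixes f :: "'a \<Rightarrow> 'b \<Rightarrow> 'c" and x :: "'a \<Rightarrow>\<^sub>0 'k::field"
  shows "Poly_Mapping.keys (lin_map2 f x y) \<subseteq>
   (\<lambda>(a, b). f a b) ` (Poly_Mapping.keys x \<times> Poly_Mapping.keys y)"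
proof -
  have "Poly_Mapping.keys (\<Sum>a\<in>A. pm_scale (g a) (lin_map (f a) y)) \<subseteq>
     (\<lambda>(a, b). f a b) ` (A \<times> Poly_Mapping.keys y)" if "finite A" for A and g :: "'a \<Rightarrow> 'k"
    using that 
  proof (induction A)
    case (insert a A)
    have "Poly_Mapping.keys (pm_scale (g a) (lin_map (f a) y)) \<subseteq> f a ` Poly_Mapping.keys y"
      using keys_pm_scale keys_lin_map by fast
    then show ?case
      using insert keys_add[of "pm_scale (g a) (lin_map (f a) y)"
         "\<Sum>a\<in>A. pm_scale (g a) (lin_map (f a) y)"]
      by (simp add: image_iff subset_iff) blast
  qed simp
  then show ?thesis by (simp add: lin_map2_alt)
qed

locale set_operad =
  fixes S :: "'a set_operad_struct"
  assumes s_act_closed: "\<lbrakk>x \<in> set_ops S n; s permutes {1..n}\<rbrakk> \<Longrightarrow> set_sact S n x s \<in> set_ops S n"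
    and s_act_id: "x \<in> set_ops S n \<Longrightarrow> set_sact S n x id = x"
    and s_act_act: "\<lbrakk>x \<in> set_ops S n; s permutes {1..n}; t permutes {1..n}\<rbrakk> \<Longrightarrow>
          set_sact S n (set_sact S n x s) t = set_sact S n x (s \<circ> t)"
    and s_unit_closed: "set_unit S \<in> set_ops S 1"
    and s_comp_closed: "\<lbrakk>x \<in> set_ops S m; y \<in> set_ops S n; i \<in> {1..m}\<rbrakk> \<Longrightarrow>
          set_pcomp S m n i x y \<in> set_ops S (m + n - 1)"
    and s_comp_unit_left: "x \<in> set_ops S n \<Longrightarrow> set_pcomp S 1 n 1 (set_unit S) x = x"
    and s_comp_unit_right: "\<lbrakk>x \<in> set_ops S m; i \<in> {1..m}\<rbrakk> \<Longrightarrow> set_pcomp S m 1 i x (set_unit S) = x"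
    and s_comp_sequential: "\<lbrakk>x \<in> set_ops S l; y \<in> set_ops S m; z \<in> set_ops S n; i \<in> {1..l}; j \<in> {1..m}\<rbrakk> \<Longrightarrow>
          set_pcomp S (l + m - 1) n (i - 1 + j) (set_pcomp S l m i x y) z =
            set_pcomp S l (m + n - 1) i x (set_pcomp S m n j y z)"
    and s_comp_parallel: "\<lbrakk>x \<in> set_ops S l; y \<in> set_ops S m; z \<in> set_ops S n; i \<in> {1..l}; k \<in> {1..l}; i < k\<rbrakk> \<Longrightarrow>
          set_pcomp S (l + m - 1) n (k + m - 1) (set_pcomp S l m i x y) z =
            set_pcomp S (l + n - 1) m i (set_pcomp S l n k x z) y"
    and s_comp_act: "\<lbrakk>x \<in> set_ops S m; y \<in> set_ops S n; i \<in> {1..m}; s permutes {1..m}; t permutes {1..n};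
          comp_perm m n i s t r\<rbrakk> \<Longrightarrow>
          set_pcomp S m n i (set_sact S m x s) (set_sact S n y t) =
            set_sact S (m + n - 1) (set_pcomp S m n (s i) x y) r"

lemma linearisation_simps:
  "ops (linearisation S) n = {x. Poly_Mapping.keys x \<subseteq> set_ops S n}"
  "vadd (linearisation S) n = (+)"
  "vzero (linearisation S) n = 0"
  "vscale (linearisation S) n = pm_scale"
  "sact (linearisation S) n x s = lin_map (\<lambda>a. set_sact S n a s) x"
  "pcomp (linearisation S) m n i = lin_map2 (set_pcomp S m n i)"
  "ounit (linearisation S) = Poly_Mapping.single (set_unit S) 1"
  by (simp_all add: linearisation_def)

lemma operad_linearisation:
  assumes "set_operad S"
  shows "operad (linearisation S :: ('k::field, 'a \<Rightarrow>\<^sub>0 'k) operad_struct)"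
proof -
  interpret set_operad S by fact
  have comp_act2: "lin_map2 (set_pcomp S m n i) (lin_map (\<lambda>a. set_sact S m a s) x) (lin_map (\<lambda>a. set_sact S n a t) y)
      = lin_map (\<lambda>a. set_sact S (m + n - 1) a r) (lin_map2 (set_pcomp S m n (s i)) x y)"
    if "Poly_Mapping.keys x \<subseteq> set_ops S m" "Poly_Mapping.keys y \<subseteq> set_ops S n" "i \<in> {1..m}" "s permutes {1..m}"
      "t permutes {1..n}" "comp_perm m n i s t r"
    for m n i s t r and x y :: "'a \<Rightarrow>\<^sub>0 'k"
    using that(1)
  proof (induction x rule: pm_induct)
    case (single a c)
    show ?case using that(2)
    proof (induction y rule: pm_induct)
      case (single b d)
      with \<open>a \<in> _\<close> that(3-) show ?case
        using s_comp_act[of a m b n i s t r] by simp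
    qed (auto simp: lin_map_add lin_map2_add_right)
  qed (auto simp: lin_map_add lin_map2_add_left)
  have seq: "lin_map2 (set_pcomp S (l + m - 1) n (i - 1 + j)) (lin_map2 (set_pcomp S l m i) x y) z
      = lin_map2 (set_pcomp S l (m + n - 1) i) x (lin_map2 (set_pcomp S m n j) y z)"
    if "Poly_Mapping.keys x \<subseteq> set_ops S l" "Poly_Mapping.keys y \<subseteq> set_ops S m" "Poly_Mapping.keys z \<subseteq> set_ops S n" "i \<in> {1..l}" "j \<in> {1..m}"
    for l m n i j and x y z :: "'a \<Rightarrow>\<^sub>0 'k"
    using that(1)
  proof (induction x rule: pm_induct)
    case (single a c)
    show ?case using that(2)
    proof (induction y rule: pm_induct)
      case (single b d)
      show ?case using that(3)
      proof (induction z rule: pm_induct)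
        case (single e f)
        with \<open>a \<in> _\<close> \<open>b \<in> _\<close> that(4-) show ?case
          using s_comp_sequential[of a l b m e n i j] by (simp add: mult.assoc)
      qed (auto simp: lin_map2_add_right)
    qed (auto simp: lin_map2_add_left lin_map2_add_right)
  qed (auto simp: lin_map2_add_left)
  have par: "lin_map2 (set_pcomp S (l + m - 1) n (k + m - 1)) (lin_map2 (set_pcomp S l m i) x y) z
      = lin_map2 (set_pcomp S (l + n - 1) m i) (lin_map2 (set_pcomp S l n k) x z) y"
    if "Poly_Mapping.keys x \<subseteq> set_ops S l" "Poly_Mapping.keys y \<subseteq> set_ops S m" "Poly_Mapping.keys z \<subseteq> set_ops S n" "i \<in> {1..l}" "k \<in> {1..l}" "i < k"
    for l m n i k and x y z :: "'a \<Rightarrow>\<^sub>0 'k"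
    using that(1)
  proof (induction x rule: pm_induct)
    case (single a c)
    show ?case using that(2)
    proof (induction y rule: pm_induct)
      case (single b d)
      show ?case using that(3)
      proof (induction z rule: pm_induct)
        case (single e f)
        with \<open>a \<in> _\<close> \<open>b \<in> _\<close> that(4-) show ?case
          using s_comp_parallel[of a l b m e n i k] by (simp add: ac_simps)
      qed (auto simp: lin_map2_add_right lin_map2_add_left)
    qed (auto simp: lin_map2_add_left lin_map2_add_right)
  qed (auto simp: lin_map2_add_left)
  show ?thesis
  proof (unfold_locales, unfold linearisation_simps mem_Collect_eq)
    fix n s and x :: "'a \<Rightarrow>\<^sub>0 'k"
    assume "Poly_Mapping.keys x \<subseteq> set_ops S n" "s permutes {1..n}"
    then show "Poly_Mapping.keys (lin_map (\<lambda>a. set_sact S n a s) x) \<subseteq> set_ops S n"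
      using keys_lin_map[of "\<lambda>a. set_sact S n a s" x] s_act_closed by fast
  next
    fix n and x :: "'a \<Rightarrow>\<^sub>0 'k"
    assume "Poly_Mapping.keys x \<subseteq> set_ops S n"
    then show "lin_map (\<lambda>a. set_sact S n a id) x = x"
      by (induction x rule: pm_induct) (auto simp: lin_map_add s_act_id[unfolded id_def])
  next
    fix n s t and x :: "'a \<Rightarrow>\<^sub>0 'k"
    assume "Poly_Mapping.keys x \<subseteq> set_ops S n" "s permutes {1..n}" "t permutes {1..n}"
    then show "lin_map (\<lambda>a. set_sact S n a t) (lin_map (\<lambda>a. set_sact S n a s) x) =
       lin_map (\<lambda>a. set_sact S n a (s \<circ> t)) x"
      by (induction x rule: pm_induct) (auto simp: lin_map_add s_act_act)
  next
    fix m n i and x y :: "'a \<Rightarrow>\<^sub>0 'k"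
    assume "Poly_Mapping.keys x \<subseteq> set_ops S m" "Poly_Mapping.keys y \<subseteq> set_ops S n" "i \<in> {1..m}"
    then show "Poly_Mapping.keys (lin_map2 (set_pcomp S m n i) x y) \<subseteq> set_ops S (m + n - 1)"
      using keys_lin_map2[of "set_pcomp S m n i" x y] s_comp_closed by fast
  next
    fix n and x :: "'a \<Rightarrow>\<^sub>0 'k"
    assume "Poly_Mapping.keys x \<subseteq> set_ops S n"
    then show "lin_map2 (set_pcomp S 1 n 1) (Poly_Mapping.single (set_unit S) 1) x = x"
      by (induction x rule: pm_induct) (auto simp: lin_map2_add_right s_comp_unit_left simp del: One_nat_def)
  next
    fix m i and x :: "'a \<Rightarrow>\<^sub>0 'k"
    assume "Poly_Mapping.keys x \<subseteq> set_ops S m" "i \<in> {1..m}"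
    then show "lin_map2 (set_pcomp S m 1 i) x (Poly_Mapping.single (set_unit S) 1) = x"
      by (induction x rule: pm_induct) (auto simp: lin_map2_add_left s_comp_unit_right simp del: One_nat_def)
  next
    fix n and x y :: "'a \<Rightarrow>\<^sub>0 'k"
    assume "Poly_Mapping.keys x \<subseteq> set_ops S n" "Poly_Mapping.keys y \<subseteq> set_ops S n"
    then show "Poly_Mapping.keys (x + y) \<subseteq> set_ops S n"
      using keys_add[of x y] by blast
  next
    fix n c and x :: "'a \<Rightarrow>\<^sub>0 'k"
    assume "Poly_Mapping.keys x \<subseteq> set_ops S n"
    then show "Poly_Mapping.keys (pm_scale c x) \<subseteq> set_ops S n"
      using keys_pm_scale[of c x] by blast
  next
    show "Poly_Mapping.keys (Poly_Mapping.single (set_unit S) (1 :: 'k)) \<subseteq> set_ops S 1"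
      using s_unit_closed by simp
  qed ((rule comp_act2 seq par; assumption)
      | simp add: lin_map_add lin_map_scale lin_map2_add_left lin_map2_add_right
          lin_map2_scale_left lin_map2_scale_right pm_scale_add pm_scale_add_left pm_scale_scale
          pm_scale_minus_one add.assoc
      | simp add: add.commute)+
qed


subsection \<open>Quotients\<close>

locale operad_with_ideal = operad P for P :: "('k::field, 'a) operad_struct" +
  fixes I :: "nat \<Rightarrow> 'a set"
  assumes ideal: "operad_ideal P I"
begin

lemma I_closed: "x \<in> I n \<Longrightarrow> x \<in> ops P n"
  and I_zero: "vzero P n \<in> I n"
  and I_add: "\<lbrakk>x \<in> I n; y \<in> I n\<rbrakk> \<Longrightarrow> vadd P n x y \<in> I n"
  and I_scale: "x \<in> I n \<Longrightarrow> vscale P n c x \<in> I n"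
  and I_act: "\<lbrakk>x \<in> I n; s permutes {1..n}\<rbrakk> \<Longrightarrow> sact P n x s \<in> I n"
  and I_comp_left: "\<lbrakk>x \<in> I m; y \<in> ops P n; i \<in> {1..m}\<rbrakk> \<Longrightarrow> pcomp P m n i x y \<in> I (m + n - 1)"
  and I_comp_right: "\<lbrakk>x \<in> ops P m; y \<in> I n; i \<in> {1..m}\<rbrakk> \<Longrightarrow> pcomp P m n i x y \<in> I (m + n - 1)"
  using ideal unfolding operad_ideal_def subspace_of_def by blast+

lemma coset_self: "x \<in> ops P n \<Longrightarrow> x \<in> coset P I n x"
  unfolding coset_def using I_zero add_zero by force

lemma coset_add_ideal:
  assumes "x \<in> ops P n" "d \<in> I n"
  shows "coset P I n (vadd P n x d) = coset P I n x"
proof -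
  have "\<exists>k\<in>I n. vadd P n (vadd P n x d) e = vadd P n x k" if "e \<in> I n" for e
    using that assms add_assoc I_closed I_add by metis
  moreover have "\<exists>k\<in>I n. vadd P n x e = vadd P n (vadd P n x d) k" if "e \<in> I n" for e
  proof
    let ?k = "vadd P n (vscale P n (-1) d) e"
    show "?k \<in> I n" using that assms I_add I_scale by blast
    have "vadd P n (vadd P n x d) ?k = vadd P n x (vadd P n (vadd P n d (vscale P n (-1) d)) e)"
      using that assms I_closed scale_closed add_closed by (simp add: add_assoc)
    also have "\<dots> = vadd P n x e"
      using that assms I_closed add_inverse add_zero add_commute zero_closed by metis
    finally show "vadd P n x e = vadd P n (vadd P n x d) ?k" ..
  qed
  ultimately show ?thesis unfolding coset_def by blast
qed

lemma coset_member: "\<lbrakk>a \<in> coset P I n x; x \<in> ops P n\<rbrakk> \<Longrightarrow> \<exists>d\<in>I n. a = vadd P n x d"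
  unfolding coset_def by blast

lemma UN_coset1:
  assumes "x \<in> ops P n"
    and "\<And>d. d \<in> I n \<Longrightarrow> coset P I m (g (vadd P n x d)) = coset P I m (g x)"
  shows "(\<Union>a\<in>coset P I n x. coset P I m (g a)) = coset P I m (g x)"
  using coset_self[OF assms(1)] assms(2) coset_member[OF _ assms(1)] by blast

lemma UN_coset2:
  assumes "x \<in> ops P k" "y \<in> ops P n"
    and "\<And>d e. \<lbrakk>d \<in> I k; e \<in> I n\<rbrakk> \<Longrightarrow>
      coset P I m (g (vadd P k x d) (vadd P n y e)) = coset P I m (g x y)"
  shows "(\<Union>a\<in>coset P I k x. \<Union>b\<in>coset P I n y. coset P I m (g a b)) = coset P I m (g x y)"
proof -
  have "coset P I m (g a b) = coset P I m (g x y)" if "a \<in> coset P I k x" "b \<in> coset P I n y" for a b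
    using assms that coset_member by metis
  then show ?thesis using coset_self[OF assms(1)] coset_self[OF assms(2)] by blast
qed

lemma quot_simps:
  "ops (quot_operad P I) n = coset P I n ` ops P n"
  "vzero (quot_operad P I) n = coset P I n (vzero P n)"
  "ounit (quot_operad P I) = coset P I 1 (ounit P)"
  by (simp_all add: quot_operad_def)

lemma quot_add: "\<lbrakk>x \<in> ops P n; y \<in> ops P n\<rbrakk> \<Longrightarrow>
  vadd (quot_operad P I) n (coset P I n x) (coset P I n y) = coset P I n (vadd P n x y)"
  unfolding quot_operad_def operad_struct.simps
proof (rule UN_coset2)
  fix d e assume a: "x \<in> ops P n" "y \<in> ops P n" "d \<in> I n" "e \<in> I n"
  then have o: "d \<in> ops P n" "e \<in> ops P n" by (auto intro: I_closed)
  have "vadd P n (vadd P n x d) (vadd P n y e) = vadd P n x (vadd P n (vadd P n d y) e)"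
    using a o by (simp add: add_assoc add_closed)
  also have "\<dots> = vadd P n x (vadd P n (vadd P n y d) e)"
    using a o by (simp add: add_commute[of d])
  also have "\<dots> = vadd P n (vadd P n x y) (vadd P n d e)"
    using a o by (simp add: add_assoc add_closed)
  finally show "coset P I n (vadd P n (vadd P n x d) (vadd P n y e)) = coset P I n (vadd P n x y)"
    using a I_add add_closed coset_add_ideal by simp
qed

lemma quot_scale: "x \<in> ops P n \<Longrightarrow>
  vscale (quot_operad P I) n c (coset P I n x) = coset P I n (vscale P n c x)"
  unfolding quot_operad_def operad_struct.simps
  by (rule UN_coset1) (auto simp: scale_add_right I_closed I_scale scale_closed coset_add_ideal)

lemma quot_act: "\<lbrakk>x \<in> ops P n; s permutes {1..n}\<rbrakk> \<Longrightarrow>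
  sact (quot_operad P I) n (coset P I n x) s = coset P I n (sact P n x s)"
  unfolding quot_operad_def operad_struct.simps
  by (rule UN_coset1) (auto simp: act_add I_closed I_act act_closed coset_add_ideal)

lemma quot_comp: "\<lbrakk>x \<in> ops P m; y \<in> ops P n; i \<in> {1..m}\<rbrakk> \<Longrightarrow>
  pcomp (quot_operad P I) m n i (coset P I m x) (coset P I n y) = coset P I (m + n - 1) (pcomp P m n i x y)"
  unfolding quot_operad_def operad_struct.simps
proof (rule UN_coset2)
  fix d e assume a: "x \<in> ops P m" "y \<in> ops P n" "i \<in> {1..m}" "d \<in> I m" "e \<in> I n"
  then have o: "d \<in> ops P m" "e \<in> ops P n" by (auto intro: I_closed)
  let ?N = "m + n - 1"
  have "pcomp P m n i (vadd P m x d) (vadd P n y e) = 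
    vadd P ?N (vadd P ?N (pcomp P m n i x y) (pcomp P m n i x e)) (pcomp P m n i d (vadd P n y e))"
    using comp_add_left[OF a(1) o(1) add_closed[OF a(2) o(2)] a(3)] comp_add_right[OF a(1,2) o(2) a(3)] by simp
  then show "coset P I ?N (pcomp P m n i (vadd P m x d) (vadd P n y e)) = coset P I ?N (pcomp P m n i x y)"
    using a o by (simp add: coset_add_ideal I_comp_left I_comp_right comp_closed add_closed
        del: atLeastAtMost_iff One_nat_def)
qed

lemma operad_quot: "operad (quot_operad P I)"
proof
  fix x y z l m n i k assume "x \<in> ops (quot_operad P I) l" "y \<in> ops (quot_operad P I) m" 
    "z \<in> ops (quot_operad P I) n" and ik: "i \<in> {1..l}" "k \<in> {1..l}" "i < k"
  then obtain x' y' z' where e: "x = coset P I l x'" "y = coset P I m y'" "z = coset P I n z'"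
    and o: "x' \<in> ops P l" "y' \<in> ops P m" "z' \<in> ops P n" by (auto simp: quot_simps)
  have "k + m - 1 \<in> {1..l+m-1}" "i \<in> {1..l+n-1}" using ik by auto
  moreover have "l + m - 1 + n - 1 = l + n - 1 + m - 1" using ik by auto
  ultimately
  show "pcomp (quot_operad P I) (l + m - 1) n (k + m - 1) (pcomp (quot_operad P I) l m i x y) z =
       pcomp (quot_operad P I) (l + n - 1) m i (pcomp (quot_operad P I) l n k x z) y"
    using comp_parallel[OF o ik] o ik(1,2) unfolding e
    by (simp add: quot_comp comp_closed del: atLeastAtMost_iff One_nat_def)
next
  fix x y z l m n i j assume "x \<in> ops (quot_operad P I) l" "y \<in> ops (quot_operad P I) m" 
    "z \<in> ops (quot_operad P I) n" and ij: "i \<in> {1..l}" "j \<in> {1..m}"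
  then obtain x' y' z' where e: "x = coset P I l x'" "y = coset P I m y'" "z = coset P I n z'"
    and o: "x' \<in> ops P l" "y' \<in> ops P m" "z' \<in> ops P n" by (auto simp: quot_simps)
  have "i - 1 + j \<in> {1..l+m-1}" using ij by auto
  moreover have "l + m - 1 + n - 1 = l + (m + n - 1) - 1" using ij by auto
  ultimately
  show "pcomp (quot_operad P I) (l + m - 1) n (i - 1 + j) (pcomp (quot_operad P I) l m i x y) z =
       pcomp (quot_operad P I) l (m + n - 1) i x (pcomp (quot_operad P I) m n j y z)"
    using comp_sequential[OF o ij] o ij unfolding e
    by (simp add: quot_comp comp_closed del: atLeastAtMost_iff One_nat_def)
next
  fix x y m n i s t r assume "x \<in> ops (quot_operad P I) m" "y \<in> ops (quot_operad P I) n" and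
    a: "i \<in> {1..m}" "s permutes {1..m}" "t permutes {1..n}" "comp_perm m n i s t r"
  then obtain x' y' where e: "x = coset P I m x'" "y = coset P I n y'"
    and o: "x' \<in> ops P m" "y' \<in> ops P n" by (auto simp: quot_simps)
  have "r permutes {1..m+n-1}" using a by (simp add: comp_perm_def)
  moreover have "s i \<in> {1..m}" using a permutes_in_image by metis
  ultimately
  show "pcomp (quot_operad P I) m n i (sact (quot_operad P I) m x s) (sact (quot_operad P I) n y t) =
       sact (quot_operad P I) (m + n - 1) (pcomp (quot_operad P I) m n (s i) x y) r"
    using comp_act[OF o a] o a unfolding e by (simp add: quot_comp comp_closed quot_act act_closed
        del: atLeastAtMost_iff One_nat_def)
next
  fix x m i assume "x \<in> ops (quot_operad P I) m" "i \<in> {1..m}"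
  then show "pcomp (quot_operad P I) m 1 i x (ounit (quot_operad P I)) = x"
    using comp_unit_right unit_closed quot_comp[of _ m _ 1 i] by (auto simp: quot_simps simp del: One_nat_def)
next
  fix x n assume "x \<in> ops (quot_operad P I) n"
  then show "pcomp (quot_operad P I) 1 n 1 (ounit (quot_operad P I)) x = x"
    using comp_unit_left unit_closed quot_comp[of _ 1 _ n 1] by (auto simp: quot_simps simp del: One_nat_def)
next
  fix x n s t assume "x \<in> ops (quot_operad P I) n" and st: "s permutes {1..n}" "t permutes {1..n}"
  then show "sact (quot_operad P I) n (sact (quot_operad P I) n x s) t = sact (quot_operad P I) n x (s \<circ> t)"
    using permutes_compose[OF st(2,1)] by (auto simp: quot_simps quot_act act_closed act_act)
next
  fix x n assume "x \<in> ops (quot_operad P I) n"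
  then show "sact (quot_operad P I) n x id = x"
    by (auto simp: quot_simps quot_act act_id permutes_id simp del: id_def)
qed (auto simp: quot_simps quot_add quot_scale add_assoc quot_act quot_comp zero_closed add_closed scale_closed
    act_closed unit_closed comp_closed add_zero add_inverse scale_add_right scale_add_left scale_scale
    scale_one act_add act_scale comp_add_left comp_add_right comp_scale_left comp_scale_right
    simp del: One_nat_def, (metis add_assoc add_commute)+)

end


subsection \<open>Trees, tensor products, free and quadratic operads\<close>

lemma leaves_graft: "leaves (graft f t) = concat (map (\<lambda>l. leaves (f l)) (leaves t))"
  by (induction t) auto

lemma graft_cong: "(\<And>l. l \<in> set (leaves t) \<Longrightarrow> f l = g l) \<Longrightarrow> graft f t = graft g t"
  by (induction t) auto

lemma graft_graft: "graft f (graft g t) = graft (\<lambda>l. graft f (g l)) t"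
  by (induction t) auto

lemma graft_Leaf: "graft Leaf t = t"
  by (induction t) auto

lemma leaves_relabel: "leaves (relabel g t) = map g (leaves t)"
  by (induction t) (auto simp: relabel_def)

lemma graft_relabel: "graft f (relabel g t) = graft (\<lambda>l. f (g l)) t"
  by (simp add: relabel_def graft_graft)

lemma relabel_graft: "relabel g (graft f t) = graft (\<lambda>l. relabel g (f l)) t"
  by (simp add: relabel_def graft_graft)

lemma relabel_relabel: "relabel f (relabel g t) = relabel (\<lambda>l. f (g l)) t"
  by (simp add: relabel_def graft_graft)

lemma relabel_cong: "(\<And>l. l \<in> set (leaves t) \<Longrightarrow> f l = g l) \<Longrightarrow> relabel f t = relabel g t"
  unfolding relabel_def by (rule graft_cong) simp

lemma relabel_ident: "(\<And>l. l \<in> set (leaves t) \<Longrightarrow> f l = l) \<Longrightarrow> relabel f t = t"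
  using relabel_cong[of t f "\<lambda>l. l"] by (simp add: relabel_def graft_Leaf)

lemma relabel_Leaf [simp]: "relabel f (Leaf l) = Leaf (f l)"
  by (simp add: relabel_def)

lemma distinct_concat_map:
  assumes "distinct xs" "\<And>x. x \<in> set xs \<Longrightarrow> distinct (h x)"
    "\<And>x y. \<lbrakk>x \<in> set xs; y \<in> set xs; x \<noteq> y\<rbrakk> \<Longrightarrow> set (h x) \<inter> set (h y) = {}"
  shows "distinct (concat (map h xs))"
  using assms
proof (induction xs)
  case (Cons a xs)
  have "set (h a) \<inter> set (h y) = {}" if "y \<in> set xs" for y
    by (rule Cons.prems(3)) (use that Cons.prems(1) in auto)
  moreover have "distinct (concat (map h xs))"
    by (rule Cons.IH) (use Cons.prems(1,2) in \<open>simp_all add: Cons.prems(3)\<close>)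
  moreover have "distinct (h a)"
    by (rule Cons.prems(2)) simp
  ultimately show ?case by auto
qed simp

lemma tree_operad_simps:
  "set_ops tree_operad n = {t. distinct (leaves t) \<and> set (leaves t) = {1..n}}"
  "set_sact tree_operad n t s = relabel (inv s) t"
  "set_pcomp tree_operad m n i u t =
     graft (\<lambda>j. if j = i then relabel (\<lambda>l. i - 1 + l) t else Leaf (outer_input i n j)) u"
  "set_unit tree_operad = Leaf 1"
  by (simp_all add: tree_operad_def)

lemma set_operad_tree_operad: "set_operad tree_operad"
proof (unfold_locales, unfold tree_operad_simps mem_Collect_eq)
  fix x :: "'a tree" and n s assume a: "distinct (leaves x) \<and> set (leaves x) = {1..n}" and s: "s permutes {1..n}"
  show "distinct (leaves (relabel (inv s) x)) \<and> set (leaves (relabel (inv s) x)) = {1..n}"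
    using a permutes_image[OF permutes_inv[OF s]] permutes_inj_on[OF permutes_inv[OF s], of "{1..n}"]
    by (simp add: leaves_relabel distinct_map)
next
  fix x :: "'a tree" and n
  show "relabel (inv id) x = x" by (rule relabel_ident) (simp add: inv_id)
next
  fix x :: "'a tree" and n and s t :: "nat \<Rightarrow> nat" assume st: "s permutes {1..n}" "t permutes {1..n}"
  show "relabel (inv t) (relabel (inv s) x) = relabel (inv (s \<circ> t)) x"
    unfolding o_inv_distrib[OF permutes_bij[OF st(1)] permutes_bij[OF st(2)]]
    by (simp add: relabel_relabel comp_def)
next
  show "distinct (leaves (Leaf 1)) \<and> set (leaves (Leaf 1)) = {1..1::nat}" by simp
next
  fix x y :: "'a tree" and m n i
  assume x: "distinct (leaves x) \<and> set (leaves x) = {1..m}"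
    and y: "distinct (leaves y) \<and> set (leaves y) = {1..n}" and i: "i \<in> {1..m}"
  define h where "h j = (if j = i then map (\<lambda>l. i - 1 + l) (leaves y) else [outer_input i n j])" for j
  have L: "leaves (graft (\<lambda>j. if j = i then relabel (\<lambda>l. i - 1 + l) y else Leaf (outer_input i n j)) x)
     = concat (map h (leaves x))"
    by (auto simp: leaves_graft h_def leaves_relabel intro!: arg_cong[of _ _ concat])
  have "distinct (concat (map h (leaves x)))"
  proof (rule distinct_concat_map)
    fix a b assume "a \<in> set (leaves x)" "b \<in> set (leaves x)" "a \<noteq> b"
    then show "set (h a) \<inter> set (h b) = {}"
      using x y i by (auto simp: h_def outer_input_def split: if_splits)
  qed (use x y in \<open>auto simp: h_def distinct_map inj_on_def\<close>)
  moreover have "set (concat (map h (leaves x))) = {1..m + n - 1}" (is "?S = _")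
  proof -
    have "?S = (\<Union>j\<in>{1..m}. set (h j))" using x by simp
    also have "\<dots> = {1..m + n - 1}"
    proof (intro subset_antisym subsetI)
      fix k assume "k \<in> (\<Union>j\<in>{1..m}. set (h j))"
      then show "k \<in> {1..m + n - 1}"
        using y i by (auto simp: h_def outer_input_def split: if_splits)
    next
      fix k assume k: "k \<in> {1..m + n - 1}"
      consider "k < i" | "i \<le> k" "k < i + n" | "i + n \<le> k" by linarith
      then show "k \<in> (\<Union>j\<in>{1..m}. set (h j))"
      proof cases
        case 1
        then show ?thesis using k i by (intro UN_I[of k]) (auto simp: h_def outer_input_def)
      next
        case 2
        then have "k = i - 1 + (k - i + 1)" "k - i + 1 \<in> set (leaves y)" using i y by auto
        then have "k \<in> (\<lambda>l. i - 1 + l) ` set (leaves y)" by (rule image_eqI)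
        then have "k \<in> set (h i)" by (simp add: h_def)
        then show ?thesis using i by blast
      next
        case 3
        then show ?thesis using k i by (intro UN_I[of "k + 1 - n"]) (auto simp: h_def outer_input_def)
      qed
    qed
    finally show ?thesis .
  qed
  ultimately show "distinct (leaves (graft (\<lambda>j. if j = i then relabel (\<lambda>l. i - 1 + l) y else Leaf (outer_input i n j)) x)) \<and>
       set (leaves (graft (\<lambda>j. if j = i then relabel (\<lambda>l. i - 1 + l) y else Leaf (outer_input i n j)) x)) = {1..m + n - 1}"
    unfolding L by blast
next
  fix x :: "'a tree" and n
  show "graft (\<lambda>j. if j = 1 then relabel (\<lambda>l. 1 - 1 + l) x else Leaf (outer_input 1 n j)) (Leaf 1) = x"
    by (simp add: relabel_ident)
next
  fix x :: "'a tree" and m i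
  have "graft (\<lambda>j. if j = i then relabel (\<lambda>l. i - 1 + l) (Leaf 1) else Leaf (outer_input i 1 j)) x = graft Leaf x"
    if "i \<in> {1..m}" using that by (intro graft_cong) (auto simp: outer_input_def)
  then show "graft (\<lambda>j. if j = i then relabel (\<lambda>l. i - 1 + l) (Leaf 1) else Leaf (outer_input i 1 j)) x = x"
    if "i \<in> {1..m}" using that by (simp add: graft_Leaf)
next
  fix x y z :: "'a tree" and l m n i j
  assume x: "distinct (leaves x) \<and> set (leaves x) = {1..l}"
    and y: "distinct (leaves y) \<and> set (leaves y) = {1..m}" and i: "i \<in> {1..l}" and j: "j \<in> {1..m}"
  show "graft (\<lambda>ja. if ja = i - 1 + j then relabel (\<lambda>l. i - 1 + j - 1 + l) z else Leaf (outer_input (i - 1 + j) n ja))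
        (graft (\<lambda>j. if j = i then relabel (\<lambda>l. i - 1 + l) y else Leaf (outer_input i m j)) x) =
       graft (\<lambda>ja. if ja = i
              then relabel (\<lambda>l. i - 1 + l)
                    (graft (\<lambda>ja. if ja = j then relabel (\<lambda>l. j - 1 + l) z else Leaf (outer_input j n ja)) y)
              else Leaf (outer_input i (m + n - 1) ja)) x"
    unfolding graft_graft
  proof (rule graft_cong)
    fix k assume k: "k \<in> set (leaves x)"
    show "graft (\<lambda>ja. if ja = i - 1 + j then relabel (\<lambda>l. i - 1 + j - 1 + l) z else Leaf (outer_input (i - 1 + j) n ja))
          (if k = i then relabel (\<lambda>l. i - 1 + l) y else Leaf (outer_input i m k)) =
         (if k = i then relabel (\<lambda>l. i - 1 + l)
               (graft (\<lambda>ja. if ja = j then relabel (\<lambda>l. j - 1 + l) z else Leaf (outer_input j n ja)) y)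
          else Leaf (outer_input i (m + n - 1) k))"
    proof (cases "k = i")
      case True
      show ?thesis unfolding True if_P[OF refl] graft_relabel relabel_graft
      proof (rule graft_cong)
        fix a assume a: "a \<in> set (leaves y)"
        show "(if i - 1 + a = i - 1 + j then relabel (\<lambda>l. i - 1 + j - 1 + l) z
               else Leaf (outer_input (i - 1 + j) n (i - 1 + a))) =
              relabel (\<lambda>l. i - 1 + l) (if a = j then relabel (\<lambda>l. j - 1 + l) z else Leaf (outer_input j n a))"
        proof (cases "a = j")
          case True
          have "i - 1 + j - 1 + b = i - 1 + (j - 1 + b)" for b using i j by simp
          then show ?thesis unfolding True if_P[OF refl] relabel_relabel by (rule relabel_cong)
        next
          case False
          then have c: "i - 1 + a \<noteq> i - 1 + j"
              "outer_input (i - 1 + j) n (i - 1 + a) = i - 1 + outer_input j n a"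
            using i j a y by (auto simp: outer_input_def)
          show ?thesis unfolding if_not_P[OF c(1)] if_not_P[OF False] relabel_Leaf c(2) ..
        qed
      qed
    next
      case False
      then have c: "outer_input i m k \<noteq> i - 1 + j"
          "outer_input (i - 1 + j) n (outer_input i m k) = outer_input i (m + n - 1) k"
        using i j x k by (auto simp: outer_input_def)
      show ?thesis
        unfolding if_not_P[OF False] graft.simps if_not_P[OF c(1)] c(2) ..
    qed
  qed
next
  fix x y z :: "'a tree" and l m n i k
  assume x: "distinct (leaves x) \<and> set (leaves x) = {1..l}"
    and y: "distinct (leaves y) \<and> set (leaves y) = {1..m}"
    and z: "distinct (leaves z) \<and> set (leaves z) = {1..n}" and ik: "i \<in> {1..l}" "k \<in> {1..l}" "i < k"
  show "graft (\<lambda>j. if j = k + m - 1 then relabel (\<lambda>l. k + m - 1 - 1 + l) z else Leaf (outer_input (k + m - 1) n j))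
        (graft (\<lambda>j. if j = i then relabel (\<lambda>l. i - 1 + l) y else Leaf (outer_input i m j)) x) =
       graft (\<lambda>j. if j = i then relabel (\<lambda>l. i - 1 + l) y else Leaf (outer_input i m j))
        (graft (\<lambda>j. if j = k then relabel (\<lambda>l. k - 1 + l) z else Leaf (outer_input k n j)) x)"
    unfolding graft_graft
  proof (rule graft_cong)
    fix j assume j: "j \<in> set (leaves x)"
    consider "j = i" | "j = k" | "j \<noteq> i" "j \<noteq> k" by blast
    then show "graft (\<lambda>j. if j = k + m - 1 then relabel (\<lambda>l. k + m - 1 - 1 + l) z else Leaf (outer_input (k + m - 1) n j))
            (if j = i then relabel (\<lambda>l. i - 1 + l) y else Leaf (outer_input i m j)) =
           graft (\<lambda>j. if j = i then relabel (\<lambda>l. i - 1 + l) y else Leaf (outer_input i m j))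
            (if j = k then relabel (\<lambda>l. k - 1 + l) z else Leaf (outer_input k n j))"
    proof cases
      case 1
      have h: "graft (\<lambda>j. if j = k + m - 1 then relabel (\<lambda>l. k + m - 1 - 1 + l) z else Leaf (outer_input (k + m - 1) n j))
              (relabel (\<lambda>l. i - 1 + l) y) = relabel (\<lambda>l. i - 1 + l) y"
        unfolding graft_relabel unfolding relabel_def
        by (rule graft_cong) (use ik y in \<open>simp add: outer_input_def; linarith\<close>)
      have c: "i \<noteq> k" "outer_input k n i = i" using ik by (auto simp: outer_input_def)
      show ?thesis
        unfolding 1 if_P[OF refl] if_not_P[OF c(1)] c(2) graft.simps by (rule h)
    next
      case 2
      have h: "graft (\<lambda>j. if j = i then relabel (\<lambda>l. i - 1 + l) y else Leaf (outer_input i m j))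
              (relabel (\<lambda>l. k - 1 + l) z) = relabel (\<lambda>l. k + m - 1 - 1 + l) z"
        unfolding graft_relabel unfolding relabel_def
        by (rule graft_cong) (use ik z in \<open>simp add: outer_input_def; linarith\<close>)
      have c: "k \<noteq> i" "outer_input i m k = k + m - 1" using ik by (auto simp: outer_input_def)
      show ?thesis
        unfolding 2 if_P[OF refl] if_not_P[OF c(1)] c(2) graft.simps by (rule h[symmetric])
    next
      case 3
      then have c: "outer_input i m j \<noteq> k + m - 1" "outer_input k n j \<noteq> i"
          "outer_input (k + m - 1) n (outer_input i m j) = outer_input i m (outer_input k n j)"
        using ik x j by (auto simp: outer_input_def)
      show ?thesis
        unfolding if_not_P[OF 3(1)] if_not_P[OF 3(2)] graft.simps if_not_P[OF c(1)] if_not_P[OF c(2)] c(3) ..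
    qed
  qed
next
  fix x y :: "'a tree" and m n i s t r
  assume x: "distinct (leaves x) \<and> set (leaves x) = {1..m}"
    and y: "distinct (leaves y) \<and> set (leaves y) = {1..n}"
    and i: "i \<in> {1..m}" and s: "s permutes {1..m}" and t: "t permutes {1..n}" and r: "comp_perm m n i s t r"
  have rp: "r permutes {1..m+n-1}" using r by (simp add: comp_perm_def)
  show "graft (\<lambda>j. if j = i then relabel (\<lambda>l. i - 1 + l) (relabel (inv t) y) else Leaf (outer_input i n j))
          (relabel (inv s) x) =
        relabel (inv r) (graft (\<lambda>j. if j = s i then relabel (\<lambda>l. s i - 1 + l) y else Leaf (outer_input (s i) n j)) x)"
    unfolding graft_relabel relabel_graft
  proof (rule graft_cong)
    fix k assume k: "k \<in> set (leaves x)"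
    define j where "j = inv s k"
    have kj: "k = s j" unfolding j_def by (rule permutes_inverses(1)[OF s, symmetric])
    have j: "j \<in> {1..m}" using k x permutes_in_image[OF permutes_inv[OF s], of k] unfolding j_def by blast
    have inv_r: "inv r b = a" if "r a = b" for a b
      unfolding that[symmetric] by (rule permutes_inverses(2)[OF rp])
    show "(if inv s k = i then relabel (\<lambda>l. i - 1 + l) (relabel (inv t) y) else Leaf (outer_input i n (inv s k))) =
         relabel (inv r) (if k = s i then relabel (\<lambda>l. s i - 1 + l) y else Leaf (outer_input (s i) n k))"
    proof (cases "j = i")
      case True
      have "i - 1 + inv t a = inv r (s i - 1 + a)" if "a \<in> set (leaves y)" for a
      proof -
        have "inv t a \<in> {1..n}" using that y permutes_in_image[OF permutes_inv[OF t], of a] by blast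
        then have "r (i - 1 + inv t a) = s i - 1 + t (inv t a)"
          using r unfolding comp_perm_def by blast
        then have "r (i - 1 + inv t a) = s i - 1 + a" unfolding permutes_inverses(1)[OF t] .
        then show ?thesis by (rule inv_r[symmetric])
      qed
      then have h: "relabel (\<lambda>l. i - 1 + inv t l) y = relabel (\<lambda>l. inv r (s i - 1 + l)) y"
        by (rule relabel_cong)
      have c: "inv s k = i" using True unfolding j_def .
      have d: "k = s i" using kj unfolding True .
      show ?thesis unfolding if_P[OF c] if_P[OF d] relabel_relabel by (rule h)
    next
      case False
      then have "r (outer_input i n j) = outer_input (s i) n (s j)"
        using r j unfolding comp_perm_def by blast
      moreover have "s j \<noteq> s i" using False permutes_inj[OF s] by (metis injD)
      ultimately have "inv r (outer_input (s i) n k) = outer_input i n (inv s k)" "inv s k \<noteq> i" "k \<noteq> s i"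
        using False inv_r unfolding j_def[symmetric] kj[symmetric] by blast+
      then show ?thesis by simp
    qed
  qed
qed

lemma subspace_of_Inter:
  assumes "\<And>S. S \<in> \<S> \<Longrightarrow> subspace_of P n S" "\<S> \<noteq> {}"
  shows "subspace_of P n (\<Inter>\<S>)"
  using assms unfolding subspace_of_def by blast

context operad begin

lemma subspace_of_ops: "subspace_of P n (ops P n)"
  by (auto simp: subspace_of_def zero_closed add_closed scale_closed)

lemma subspace_of_span_of:
  assumes "G \<subseteq> ops P n" shows "subspace_of P n (span_of P n G)"
  unfolding span_of_def using assms subspace_of_ops by (intro subspace_of_Inter) auto

lemma operad_ideal_ideal_gen:
  assumes "\<And>n. G n \<subseteq> ops P n"
  shows "operad_ideal P (ideal_gen P G)"
proof -
  have top: "operad_ideal P (ops P)"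
    unfolding operad_ideal_def by (auto simp: subspace_of_ops act_closed comp_closed simp del: One_nat_def)
  have sub: "subspace_of P n (ideal_gen P G n)" for n
    unfolding ideal_gen_def
  proof (rule subspace_of_Inter)
    show "{I n |I. operad_ideal P I \<and> (\<forall>m. G m \<subseteq> I m)} \<noteq> {}" using top assms by blast
  qed (auto simp: operad_ideal_def)
  have mem: "x \<in> ideal_gen P G n \<longleftrightarrow> (\<forall>I. operad_ideal P I \<and> (\<forall>m. G m \<subseteq> I m) \<longrightarrow> x \<in> I n)" for x n
    unfolding ideal_gen_def by blast
  have act: "sact P n x s \<in> ideal_gen P G n" if "x \<in> ideal_gen P G n" "s permutes {1..n}" for n x s
    unfolding mem using that(1)[unfolded mem] that(2) by (simp add: operad_ideal_def)
  have comp: "pcomp P m n i x y \<in> ideal_gen P G (m + n - 1)"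
    if "i \<in> {1..m}" "x \<in> ops P m" "y \<in> ops P n" "x \<in> ideal_gen P G m \<or> y \<in> ideal_gen P G n" for m n i x y
    unfolding mem
  proof (intro allI impI)
    fix I assume I: "operad_ideal P I \<and> (\<forall>m. G m \<subseteq> I m)"
    then have "x \<in> I m \<or> y \<in> I n" using that(4) unfolding mem by blast
    then show "pcomp P m n i x y \<in> I (m + n - 1)"
      using I that(1-3) unfolding operad_ideal_def by blast
  qed
  show ?thesis
    unfolding operad_ideal_def using sub act comp by blast
qed

end

lemma span_of_superset: "G \<subseteq> span_of P n G"
  unfolding span_of_def by blast

lemma span_of_minimal: "\<lbrakk>subspace_of P n S; G \<subseteq> S\<rbrakk> \<Longrightarrow> span_of P n G \<subseteq> S"
  unfolding span_of_def by blast

lemma pair_operad_simps: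
  "set_ops (pair_operad P Q) n = ops P n \<times> ops Q n"
  "set_sact (pair_operad P Q) n p s = (sact P n (fst p) s, sact Q n (snd p) s)"
  "set_pcomp (pair_operad P Q) m n i p q = (pcomp P m n i (fst p) (fst q), pcomp Q m n i (snd p) (snd q))"
  "set_unit (pair_operad P Q) = (ounit P, ounit Q)"
  by (simp_all add: pair_operad_def case_prod_beta)

lemma set_operad_pair_operad:
  assumes "operad P" "operad Q"
  shows "set_operad (pair_operad P Q)"
proof -
  interpret P: operad P by fact
  interpret Q: operad Q by fact
  show ?thesis
  proof (unfold_locales, unfold pair_operad_simps mem_Times_iff fst_conv snd_conv prod.inject)
    fix x n assume "fst x \<in> ops P n \<and> snd x \<in> ops Q n"
    then show "(sact P n (fst x) id, sact Q n (snd x) id) = x"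
      using P.act_id Q.act_id by (metis prod.collapse)
  next
    fix x n assume "fst x \<in> ops P n \<and> snd x \<in> ops Q n"
    then show "(pcomp P 1 n 1 (ounit P) (fst x), pcomp Q 1 n 1 (ounit Q) (snd x)) = x"
      using P.comp_unit_left Q.comp_unit_left by (metis prod.collapse)
  next
    fix x m i assume "fst x \<in> ops P m \<and> snd x \<in> ops Q m" "i \<in> {1..m}"
    then show "(pcomp P m 1 i (fst x) (ounit P), pcomp Q m 1 i (snd x) (ounit Q)) = x"
      using P.comp_unit_right Q.comp_unit_right by (metis prod.collapse)
  qed (blast intro: P.act_closed Q.act_closed P.act_act Q.act_act P.unit_closed Q.unit_closed
        P.comp_closed Q.comp_closed P.comp_sequential Q.comp_sequential P.comp_parallel Q.comp_parallel
        P.comp_act Q.comp_act)+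
qed

lemma operad_ideal_bilinearity_ideal:
  fixes P :: "('k::field, 'a) operad_struct" and Q :: "('k, 'b) operad_struct"
  assumes "operad P" "operad Q"
  shows "operad_ideal (linearisation (pair_operad P Q)) (bilinearity_ideal P Q)"
proof -
  interpret P: operad P by fact
  interpret Q: operad Q by fact
  define L :: "('k, 'a \<times> 'b \<Rightarrow>\<^sub>0 'k) operad_struct" where "L = linearisation (pair_operad P Q)"
  define B where "B = bilinearity_ideal P Q"
  interpret L: operad L unfolding L_def by (intro operad_linearisation set_operad_pair_operad assms)
  let ?s = "Poly_Mapping.single :: 'a \<times> 'b \<Rightarrow> 'k \<Rightarrow> _"
  have ops_L: "x \<in> ops L n \<longleftrightarrow> Poly_Mapping.keys x \<subseteq> ops P n \<times> ops Q n" for x n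
    by (simp add: L_def linearisation_simps pair_operad_simps)
  have ops_diff: "x - y \<in> ops L n" if "x \<in> ops L n" "y \<in> ops L n" for x y n
    using that keys_diff[of x y] unfolding ops_L by blast
  have ops_single: "?s (a, b) c \<in> ops L n" if "a \<in> ops P n" "b \<in> ops Q n" for a b c n
    using that unfolding ops_L by simp
  have rel: "bilinearity_relators P Q n \<subseteq> ops L n" for n
    unfolding bilinearity_relators_def
    by (auto simp: P.add_closed Q.add_closed P.scale_closed Q.scale_closed intro!: ops_diff ops_single)
  have sub: "subspace_of L n (B n)" for n
    unfolding B_def bilinearity_ideal_def L_def[symmetric] by (rule L.subspace_of_span_of[OF rel])
  have gen: "bilinearity_relators P Q n \<subseteq> B n" for n
    unfolding B_def bilinearity_ideal_def by (rule span_of_superset)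
  have min: "B n \<subseteq> S" if "subspace_of L n S" "bilinearity_relators P Q n \<subseteq> S" for n S
    unfolding B_def bilinearity_ideal_def L_def[symmetric] by (rule span_of_minimal[OF that])
  have B_ops: "B n \<subseteq> ops L n" for n using sub by (auto simp: subspace_of_def)
  have lin: "f x \<in> B m"
    if x: "x \<in> B n" and f0: "f 0 = 0" and fa: "\<And>x y. f (x + y) = f x + f y"
      and fs: "\<And>c x. f (pm_scale c x) = pm_scale c (f x)"
      and fr: "\<And>x. x \<in> bilinearity_relators P Q n \<Longrightarrow> f x \<in> B m"
    for f x m n
  proof -
    have "B n \<subseteq> {x \<in> ops L n. f x \<in> B m}"
    proof (rule min)
      show "subspace_of L n {x \<in> ops L n. f x \<in> B m}"
        using sub[of m] L.subspace_of_ops[of n] f0 fa fs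
        by (auto simp: subspace_of_def L_def linearisation_simps)
    qed (use rel fr in blast)
    then show ?thesis using x by blast
  qed
  have diff: "f (x - y) = f x - f y" if "\<And>x y. f (x + y) = f x + f y"
    for f :: "('a \<times> 'b \<Rightarrow>\<^sub>0 'k) \<Rightarrow> ('a \<times> 'b \<Rightarrow>\<^sub>0 'k)" and x y
    by (metis add_diff_cancel diff_add_cancel that)
  have relI: "?s (vadd P n x x', y) 1 - ?s (x, y) 1 - ?s (x', y) 1 \<in> B n"
     if "x \<in> ops P n" "x' \<in> ops P n" "y \<in> ops Q n" for n x x' y
    using that by (intro subsetD[OF gen]) (auto simp: bilinearity_relators_def)
  have relII: "?s (x, vadd Q n y y') 1 - ?s (x, y) 1 - ?s (x, y') 1 \<in> B n"
     if "x \<in> ops P n" "y \<in> ops Q n" "y' \<in> ops Q n" for n x y y'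
    using that by (intro subsetD[OF gen]) (auto simp: bilinearity_relators_def)
  have relIII: "?s (vscale P n c x, y) 1 - ?s (x, y) c \<in> B n"
     if "x \<in> ops P n" "y \<in> ops Q n" for n x y c
    using that by (intro subsetD[OF gen]) (auto simp: bilinearity_relators_def)
  have relIV: "?s (x, vscale Q n c y) 1 - ?s (x, y) c \<in> B n"
     if "x \<in> ops P n" "y \<in> ops Q n" for n x y c
    using that by (intro subsetD[OF gen]) (auto simp: bilinearity_relators_def)
  have scB: "pm_scale c x \<in> B n" if "x \<in> B n" for c x n
    using sub[of n] that by (auto simp: subspace_of_def L_def linearisation_simps)
  have addB: "x + y \<in> B n" if "x \<in> B n" "y \<in> B n" for x y n
    using sub[of n] that by (auto simp: subspace_of_def L_def linearisation_simps)
  have zeroB: "0 \<in> B n" for n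
    using sub[of n] by (auto simp: subspace_of_def L_def linearisation_simps)
  have act: "sact L n x s \<in> B n" if "x \<in> B n" and s: "s permutes {1..n}" for n x s
  proof -
    have "lin_map (\<lambda>p. (sact P n (fst p) s, sact Q n (snd p) s)) x \<in> B n" (is "?f x \<in> _")
    proof (rule lin[OF that(1)])
      fix r assume "r \<in> bilinearity_relators P Q n"
      then show "?f r \<in> B n"
        unfolding bilinearity_relators_def
        by (auto simp: diff[of ?f, OF lin_map_add] P.act_add Q.act_add P.act_scale Q.act_scale
            s P.act_closed Q.act_closed intro!: relI relII relIII relIV simp del: One_nat_def)
    qed (auto simp: lin_map_add lin_map_scale)
    then show ?thesis by (simp add: L_def linearisation_simps pair_operad_simps)
  qed
  let ?c = "\<lambda>m n i. lin_map2 (\<lambda>p q. (pcomp P m n i (fst p) (fst q), pcomp Q m n i (snd p) (snd q)))"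
  have single_scale: "?s p c = pm_scale c (?s p 1)" for p c by simp
  have comp_l1: "?c m n i x (?s (a, b) 1) \<in> B (m + n - 1)"
    if "x \<in> B m" and a: "a \<in> ops P n" "b \<in> ops Q n" and i: "i \<in> {1..m}" for m n i x a b
  proof (rule lin[OF that(1), where f = "\<lambda>x. ?c m n i x (?s (a, b) 1)"])
    fix r assume "r \<in> bilinearity_relators P Q m"
    then show "?c m n i r (?s (a, b) 1) \<in> B (m + n - 1)"
      unfolding bilinearity_relators_def
      by (auto simp: diff[of "\<lambda>x. ?c m n i x (?s (a, b) 1)", OF lin_map2_add_left]
          P.comp_add_left Q.comp_add_left P.comp_scale_left Q.comp_scale_left
          a i P.comp_closed Q.comp_closed intro!: relI relII relIII relIV simp del: One_nat_def atLeastAtMost_iff)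
  qed (auto simp: lin_map2_add_left lin_map2_scale_left)
  have comp_r1: "?c m n i (?s (a, b) 1) x \<in> B (m + n - 1)"
    if "x \<in> B n" and a: "a \<in> ops P m" "b \<in> ops Q m" and i: "i \<in> {1..m}" for m n i x a b
  proof (rule lin[OF that(1)])
    fix r assume "r \<in> bilinearity_relators P Q n"
    then show "?c m n i (?s (a, b) 1) r \<in> B (m + n - 1)"
      unfolding bilinearity_relators_def
      by (auto simp: diff[of "?c m n i (?s (a, b) 1)", OF lin_map2_add_right]
          P.comp_add_right Q.comp_add_right P.comp_scale_right Q.comp_scale_right
          a i P.comp_closed Q.comp_closed intro!: relI relII relIII relIV simp del: One_nat_def atLeastAtMost_iff)
  qed (auto simp: lin_map2_add_right lin_map2_scale_right)
  have comp: "pcomp L m n i x y \<in> B (m + n - 1)"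
    if "i \<in> {1..m}" "x \<in> ops L m" "y \<in> ops L n" "x \<in> B m \<or> y \<in> B n" for m n i x y
  proof -
    have "?c m n i x y \<in> B (m + n - 1)"
      using that(4)
    proof
      assume x: "x \<in> B m"
      show ?thesis using that(3)[unfolded ops_L]
      proof (induction y rule: pm_induct)
        case (single p c)
        then have "?c m n i x (pm_scale c (?s p 1)) \<in> B (m + n - 1)"
          using comp_l1[OF x _ _ that(1), of "fst p" n "snd p"] unfolding lin_map2_scale_right
          by (intro scB) auto
        then show ?case by simp
      qed (auto simp: zeroB addB lin_map2_add_right)
    next
      assume y: "y \<in> B n"
      show ?thesis using that(2)[unfolded ops_L]
      proof (induction x rule: pm_induct)
        case (single p c)
        then have "?c m n i (pm_scale c (?s p 1)) y \<in> B (m + n - 1)"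
          using comp_r1[OF y _ _ that(1), of "fst p" "snd p"] unfolding lin_map2_scale_left
          by (intro scB) auto
        then show ?case by simp
      qed (auto simp: zeroB addB lin_map2_add_left)
    qed
    moreover have "set_pcomp (pair_operad P Q) m n i =
        (\<lambda>p q. (pcomp P m n i (fst p) (fst q), pcomp Q m n i (snd p) (snd q)))"
      by (intro ext) (simp add: pair_operad_simps)
    ultimately show ?thesis by (simp add: L_def linearisation_simps)
  qed
  show ?thesis
    unfolding L_def[symmetric] B_def[symmetric] operad_ideal_def using sub act comp by blast
qed

lemma operad_quot_operad: "\<lbrakk>operad P; operad_ideal P I\<rbrakk> \<Longrightarrow> operad (quot_operad P I)"
  by (intro operad_with_ideal.operad_quot operad_with_ideal.intro operad_with_ideal_axioms.intro)

lemma operad_tensor_operad: "\<lbrakk>operad P; operad Q\<rbrakk> \<Longrightarrow> operad (tensor_operad P Q)"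
  unfolding tensor_operad_def
  by (intro operad_quot_operad operad_linearisation set_operad_pair_operad operad_ideal_bilinearity_ideal)

lemma operad_trees: "operad (linearisation tree_operad)"
  by (intro operad_linearisation set_operad_tree_operad)

lemma operad_ideal_sym_ideal:
  fixes T :: "('i::finite, 'k::field) S2_module"
  shows "operad_ideal (linearisation tree_operad) (sym_ideal T)"
proof -
  have sum: "Poly_Mapping.keys (\<Sum>j\<in>A. Poly_Mapping.single (g j) (h j)) \<subseteq> S"
    if "finite A" "\<And>j. g j \<in> S" for A S and g :: "'i \<Rightarrow> 'i tree" and h :: "'i \<Rightarrow> 'k"
    using that by (induction A) (auto dest!: set_mp[OF keys_add] split: if_splits)
  have "sym_relators T \<subseteq> {x. Poly_Mapping.keys x \<subseteq> set_ops tree_operad 2}"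
    unfolding sym_relators_def
  proof (rule subsetI, elim CollectE exE conjE)
    fix x i assume x: "x = mono (Node i (Leaf 2) (Leaf 1)) -
        (\<Sum>j\<in>UNIV. Poly_Mapping.single (Node j (Leaf 1) (Leaf 2)) (T i j))"
    have two: "{1..2} = {1, 2::nat}" by auto
    have "Poly_Mapping.keys (\<Sum>j\<in>UNIV. Poly_Mapping.single (Node j (Leaf 1) (Leaf 2)) (T i j)) \<subseteq> set_ops tree_operad 2"
      by (rule sum) (auto simp: tree_operad_simps two)
    then show "x \<in> {x. Poly_Mapping.keys x \<subseteq> set_ops tree_operad 2}"
      unfolding x using keys_diff by (auto simp: tree_operad_simps two dest!: set_mp[OF keys_diff])
  qed
  then show ?thesis
    unfolding sym_ideal_def
    by (intro operad.operad_ideal_ideal_gen operad_trees) (auto simp: in_arity_def linearisation_simps)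
qed

lemma operad_free_operad: "operad (free_operad T)"
  unfolding free_operad_def by (intro operad_quot_operad operad_trees operad_ideal_sym_ideal)

lemma operad_quadratic_operad:
  assumes "rels Q \<subseteq> ops (free_operad (gens Q)) 3"
  shows "operad (quadratic_operad Q)"
  unfolding quadratic_operad_def
  by (intro operad_quot_operad operad_free_operad operad.operad_ideal_ideal_gen)
     (use assms in \<open>auto simp: in_arity_def\<close>)

end

theory Submission
  imports Defs "HOL.Vector_Spaces"
begin

text \<open>
  In arity 3 everything is linear algebra in the coordinates of \<open>E \<otimes> E \<otimes> (a, b, c)\<close>. Koszul duality
  takes the space of relations to its orthogonal, and since every subspace is the kernel of a
  projection, the relations of a white product \<open>P \<circ> Q\<close> are the orthogonal of the tensors \<open>h \<otimes> g\<close>, with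
  \<open>h\<close> and \<open>g\<close> orthogonal to the relations of \<open>P\<close> and of \<open>Q\<close>. For preLie \<open>\<bullet>\<close> Poiss, the tensors have \<open>h\<close>
  orthogonal to the relations of Perm and \<open>g\<close> a relation of Poiss. A product in Perm depends only on
  its last factor, so the \<open>h\<close> are the functions of the last variable \<open>x\<^sub>k\<close>. Hence a combination of
  such tensors is a triple of relations of Poiss, indexed by \<open>k\<close>. Up to signs, these triples are also
  the orthogonal of the relations of dual-prePoisson algebras, and the signs come from a signed
  bijection between the bases of the generators.
\<close>

section \<open>Linear functionals on formal linear combinations\<close>

text \<open>Several definitions have to be unlocked before the linear algebra applies.
  \<open>koszul_dual\<close> quantifies over coordinate functions, so its meaning depends on their
  being determined by their classes in a quotient by a generated ideal.
  \<open>manin_morphism\<close> is a choice, so it says nothing until a morphism with the required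
  values on generators is exhibited, and until these values are seen to fix it in arity 3. The
  relations of a white product are a preimage of a span inside a quotient of formal pairs, where
  nothing is bilinear on the nose.

  The operad preLie is itself a dual, so the black product contains the double dual of Perm. Only
  the orthogonal of its relations enters, and three successive orthogonals equal one, so the
  comparison can be made with Perm directly.

  The ideals above arity 3 are never described: a signed bijection of generators whose extension and
  its inverse both carry relations to relations induces inverse morphisms of the quotients. One of
  these two inclusions comes from an explicit decomposition into tensors, the other from the
  adjointness of transport and pullback.\<close>

definition pm_eval :: "('a \<Rightarrow> 'k::field) \<Rightarrow> ('a \<Rightarrow>\<^sub>0 'k) \<Rightarrow> 'k" where
  "pm_eval f x = (\<Sum>a\<in>Poly_Mapping.keys x. Poly_Mapping.lookup x a * f a)"

lemma pm_eval_superset: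
  assumes "finite A" "Poly_Mapping.keys x \<subseteq> A"
  shows "pm_eval f x = (\<Sum>a\<in>A. Poly_Mapping.lookup x a * f a)"
  unfolding pm_eval_def
  by (rule sum.mono_neutral_left) (use assms in \<open>auto simp: not_in_keys_iff_lookup_eq_zero\<close>)

lemma pm_eval_zero [simp]: "pm_eval f 0 = 0"
  by (simp add: pm_eval_def)

lemma pm_eval_single [simp]: "pm_eval f (Poly_Mapping.single a c) = c * f a"
  by (cases "c = 0") (simp_all add: pm_eval_def)

lemma pm_eval_add [simp]: "pm_eval f (x + y) = pm_eval f x + pm_eval f y"
proof -
  let ?A = "Poly_Mapping.keys x \<union> Poly_Mapping.keys y"
  have "Poly_Mapping.keys (x + y) \<subseteq> ?A" by (rule keys_add)
  then show ?thesis
    by (subst (1 2 3) pm_eval_superset[of ?A]) (auto simp: lookup_add sum.distrib algebra_simps)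
qed

lemma pm_eval_scale [simp]: "pm_eval f (pm_scale c x) = c * pm_eval f x"
  by (induction x rule: pm_induct[OF subset_UNIV]) (auto simp: pm_scale_add algebra_simps)

lemma pm_eval_minus [simp]: "pm_eval f (- x) = - pm_eval f x"
  by (simp flip: pm_scale_minus_one)

lemma pm_eval_diff [simp]: "pm_eval f (x - y) = pm_eval f x - pm_eval f y"
  using pm_eval_add[of f x "- y"] by simp

lemma pm_eval_sum: "pm_eval f (\<Sum>a\<in>A. g a) = (\<Sum>a\<in>A. pm_eval f (g a))"
  by (induction A rule: infinite_finite_induct) auto

lemma pm_eval_lin_map: "pm_eval f (lin_map g x) = pm_eval (\<lambda>a. f (g a)) x"
  by (induction x rule: pm_induct[OF subset_UNIV]) (auto simp: lin_map_add)

lemma pm_eval_lin_map2: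
  "pm_eval f (lin_map2 g x y) = pm_eval (\<lambda>a. pm_eval (\<lambda>b. f (g a b)) y) x"
proof (induction x rule: pm_induct[OF subset_UNIV])
  case (2 a c)
  show ?case
    by (induction y rule: pm_induct[OF subset_UNIV]) (auto simp: lin_map2_add_right algebra_simps)
qed (auto simp: lin_map2_add_left)

lemma pm_eval_eq_0:
  "(\<And>a. a \<in> Poly_Mapping.keys x \<Longrightarrow> f a = 0) \<Longrightarrow> pm_eval f x = 0"
  by (simp add: pm_eval_def)

lemma pm_eval_add_fun: "pm_eval (\<lambda>a. f a + g a) x = pm_eval f x + pm_eval g x"
  by (simp add: pm_eval_def sum.distrib algebra_simps)

lemma pm_eval_mult_left: "pm_eval (\<lambda>a. c * f a) x = c * pm_eval f x"
  by (simp add: pm_eval_def sum_distrib_left algebra_simps)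

lemma pm_eval_mult_right: "pm_eval (\<lambda>a. f a * c) x = pm_eval f x * c"
  by (simp add: pm_eval_def sum_distrib_right mult.assoc)

lemma pm_eval_sum_fun: "pm_eval (\<lambda>a. \<Sum>p\<in>S. f p a) x = (\<Sum>p\<in>S. pm_eval (f p) x)"
  by (induction S rule: infinite_finite_induct) (auto simp: pm_eval_add_fun pm_eval_eq_0)

lemma pm_eval_swap: "pm_eval (\<lambda>a. pm_eval (\<lambda>b. f a b) y) x = pm_eval (\<lambda>b. pm_eval (\<lambda>a. f a b) x) y"
  unfolding pm_eval_def sum_distrib_left by (subst sum.swap) (simp add: ac_simps)


section \<open>Injectivity of the coordinates in arity 3\<close>

text \<open>
  For an involutive \<open>T\<close>, the functions on trees are an algebra over the free operad: the product of
  \<open>f\<close> and \<open>g\<close> at a node pairs both subtrees with \<open>f\<close> and \<open>g\<close> in both orders. Its identities form an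
  ideal which contains \<^const>\<open>sym_ideal\<close>, so that evaluation at delta functions separates elements of
  the free operad; no normal forms of trees are needed.
\<close>

definition involutive_module :: "('i::finite, 'k::field) S2_module \<Rightarrow> bool" where
  "involutive_module T \<longleftrightarrow> (\<forall>i k. (\<Sum>j\<in>UNIV. T i j * T j k) = (if i = k then 1 else 0))"

text \<open>This is the symmetrisation of e_i \<otimes> f \<otimes> g over S_2, namely e_i \<otimes>
  f \<otimes> g + e_i \<tau> \<otimes> g \<otimes> f, written in coordinates. For an involutive
  \<open>T\<close> it takes the same value on e_i \<otimes> g \<otimes> f as on e_i \<tau> \<otimes>
  f \<otimes> g, which is the symmetry relation of the free operad.\<close>

definition tree_mult ::
    "('i, 'k::field) S2_module \<Rightarrow> 'i \<Rightarrow> ('i tree \<Rightarrow> 'k) \<Rightarrow> ('i tree \<Rightarrow> 'k) \<Rightarrow> 'i tree \<Rightarrow> 'k" where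
  "tree_mult T i f g u = (case u of Leaf _ \<Rightarrow> 0
     | Node j l r \<Rightarrow> (if i = j then f l * g r else 0) + T i j * (f r * g l))"

primrec tree_eval ::
    "('i, 'k::field) S2_module \<Rightarrow> (nat \<Rightarrow> 'i tree \<Rightarrow> 'k) \<Rightarrow> 'i tree \<Rightarrow> 'i tree \<Rightarrow> 'k" where
  "tree_eval T \<rho> (Leaf l) = \<rho> l"
| "tree_eval T \<rho> (Node i s t) = tree_mult T i (tree_eval T \<rho> s) (tree_eval T \<rho> t)"

lemma tree_eval_graft: "tree_eval T \<rho> (graft f t) = tree_eval T (\<lambda>l. tree_eval T \<rho> (f l)) t"
  by (induction t) auto

lemma tree_eval_relabel: "tree_eval T \<rho> (relabel g t) = tree_eval T (\<lambda>l. \<rho> (g l)) t"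
  by (simp add: relabel_def tree_eval_graft)

lemma tree_eval_cong:
  "(\<And>l. l \<in> set (leaves t) \<Longrightarrow> \<rho> l = \<rho>' l) \<Longrightarrow> tree_eval T \<rho> t = tree_eval T \<rho>' t"
  by (induction t) auto

lemma tree_mult_swap:
  fixes T :: "('i::finite, 'k::field) S2_module"
  assumes "involutive_module T"
  shows "tree_mult T i g f u = (\<Sum>j\<in>UNIV. T i j * tree_mult T j f g u)"
proof (cases u)
  case (Node k l r)
  have "(\<Sum>j\<in>UNIV. T i j * ((if j = k then f l * g r else 0) + T j k * (f r * g l))) =
      (\<Sum>j\<in>UNIV. if j = k then T i j * (f l * g r) else 0) + (\<Sum>j\<in>UNIV. T i j * T j k) * (f r * g l)"
    by (subst sum_distrib_right, subst sum.distrib[symmetric], rule sum.cong) (auto simp: algebra_simps)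
  also have "\<dots> = T i k * (f l * g r) + (if i = k then f r * g l else 0)"
    using assms by (simp add: involutive_module_def)
  finally show ?thesis by (simp add: tree_mult_def Node algebra_simps)
qed (simp add: tree_mult_def)

lemma pm_eval_tree_mult_left:
  "pm_eval (\<lambda>b. tree_mult T i (f b) g u) y = tree_mult T i (\<lambda>v. pm_eval (\<lambda>b. f b v) y) g u"
  by (cases u)
     (auto simp: tree_mult_def pm_eval_add_fun pm_eval_mult_left pm_eval_mult_right pm_eval_eq_0)

lemma pm_eval_tree_mult_right:
  "pm_eval (\<lambda>b. tree_mult T i g (f b) u) y = tree_mult T i g (\<lambda>v. pm_eval (\<lambda>b. f b v) y) u"
  by (cases u)
     (auto simp: tree_mult_def pm_eval_add_fun pm_eval_mult_left pm_eval_mult_right pm_eval_eq_0)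

text \<open>A tree whose leaves are distinct is linear in the value of each of its variables, so the
  combination over \<open>b\<close> can be pushed down to the only leaf labelled \<open>i\<close>,
  where it vanishes. A repeated leaf would give products in which \<open>F b\<close> occurs
  twice.\<close>

lemma pm_eval_tree_eval_slot:
  assumes "\<And>v. pm_eval (\<lambda>b. F b v) y = 0" "i \<in> set (leaves t)" "distinct (leaves t)"
  shows "pm_eval (\<lambda>b. tree_eval T (\<rho>(i := F b)) t u) y = 0"
  using assms(2,3)
proof (induction t arbitrary: u)
  case (Leaf l)
  then show ?case using assms(1) by simp
next
  case (Node j l r)
  have zero: "tree_mult T j (\<lambda>_. 0) g u = 0" "tree_mult T j g (\<lambda>_. 0) u = 0" for g
    by (auto simp: tree_mult_def split: tree.split)
  show ?case
  proof (cases "i \<in> set (leaves l)")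
    case True
    then have "tree_eval T (\<rho>(i := F b)) r = tree_eval T \<rho> r" for b
      using Node.prems by (intro tree_eval_cong) auto
    then show ?thesis
      using Node.IH(1)[OF True] Node.prems by (simp add: pm_eval_tree_mult_left zero del: fun_upd_apply)
  next
    case False
    then have "tree_eval T (\<rho>(i := F b)) l = tree_eval T \<rho> l" for b
      by (intro tree_eval_cong) auto
    then show ?thesis
      using Node.IH(2) False Node.prems by (simp add: pm_eval_tree_mult_right zero del: fun_upd_apply)
  qed
qed

definition tree_identities ::
    "('i, 'k::field) S2_module \<Rightarrow> nat \<Rightarrow> ('i tree \<Rightarrow>\<^sub>0 'k) set" where
  "tree_identities T n = {x \<in> ops (linearisation tree_operad) n.
     \<forall>\<rho> u. pm_eval (\<lambda>t. tree_eval T \<rho> t u) x = 0}"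

text \<open>Evaluating a partial composite means evaluating the outer tree with its
  \<open>i\<close>-th variable set to the value of the inner one. An identity in the outer factor
  vanishes for each fixed inner tree; an identity in the inner factor makes a variable zero, in
  which the outer tree is linear.\<close>

lemma operad_ideal_tree_identities:
  fixes T :: "('i, 'k::field) S2_module"
  shows "operad_ideal (linearisation tree_operad) (tree_identities T)"
proof -
  let ?L = "linearisation tree_operad :: ('k, 'i tree \<Rightarrow>\<^sub>0 'k) operad_struct"
  interpret L: operad ?L by (rule operad_trees)
  have sub: "subspace_of ?L n (tree_identities T n)" for n
    using L.subspace_of_ops[of n]
    by (auto simp: subspace_of_def tree_identities_def linearisation_simps)
  have act: "sact ?L n x s \<in> tree_identities T n"
    if "x \<in> tree_identities T n" "s permutes {1..n}" for n s x
    using that L.act_closed[of x n s]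
    by (simp add: tree_identities_def linearisation_simps pm_eval_lin_map tree_operad_simps tree_eval_relabel)
  have comp: "pcomp ?L m n i x y \<in> tree_identities T (m + n - 1)"
    if i: "i \<in> {1..m}" and x: "x \<in> ops ?L m" and y: "y \<in> ops ?L n"
      and or: "x \<in> tree_identities T m \<or> y \<in> tree_identities T n" for m n i x y
  proof -
    let ?\<rho> = "\<lambda>\<rho> b. (\<lambda>j. \<rho> (outer_input i n j))(i := tree_eval T \<rho> (relabel (\<lambda>l. i - 1 + l) b))"
    have e: "tree_eval T \<rho> (set_pcomp tree_operad m n i a b) = tree_eval T (?\<rho> \<rho> b) a" for \<rho> a b
      unfolding tree_operad_simps tree_eval_graft
      by (intro arg_cong[where f = "\<lambda>r. tree_eval T r a"] ext) (simp add: fun_upd_def)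
    have "pm_eval (\<lambda>a. pm_eval (\<lambda>b. tree_eval T (?\<rho> \<rho> b) a u) y) x = 0" for \<rho> u
      using or
    proof
      assume "x \<in> tree_identities T m"
      then show ?thesis
        by (subst pm_eval_swap) (simp add: tree_identities_def pm_eval_eq_0)
    next
      assume y': "y \<in> tree_identities T n"
      show ?thesis
      proof (rule pm_eval_eq_0, rule pm_eval_tree_eval_slot)
        fix v show "pm_eval (\<lambda>b. tree_eval T \<rho> (relabel (\<lambda>l. i - 1 + l) b) v) y = 0"
          using y' by (simp add: tree_identities_def tree_eval_relabel)
      qed (use x i in \<open>auto simp: linearisation_simps tree_operad_simps\<close>)
    qed
    then show ?thesis
      using L.comp_closed[OF x y i]
      by (simp add: tree_identities_def linearisation_simps pm_eval_lin_map2 e)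
  qed
  show ?thesis
    unfolding operad_ideal_def using sub act comp by blast
qed

lemma ideal_gen_superset: "G n \<subseteq> ideal_gen P G n"
  unfolding ideal_gen_def by blast

lemma ideal_gen_minimal: "\<lbrakk>operad_ideal P I; \<And>m. G m \<subseteq> I m\<rbrakk> \<Longrightarrow> ideal_gen P G n \<subseteq> I n"
  unfolding ideal_gen_def by blast

lemma linearisation_ops_diff:
  "\<lbrakk>x \<in> ops (linearisation S) n; y \<in> ops (linearisation S) n\<rbrakk> \<Longrightarrow> x - y \<in> ops (linearisation S) n"
  using keys_diff[of x y] by (auto simp: linearisation_simps)

lemma linearisation_ops_add:
  "\<lbrakk>x \<in> ops (linearisation S) n; y \<in> ops (linearisation S) n\<rbrakk> \<Longrightarrow> x + y \<in> ops (linearisation S) n"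
  using keys_add[of x y] by (auto simp: linearisation_simps)

lemma linearisation_ops_sum:
  "(\<And>a. a \<in> A \<Longrightarrow> g a \<in> ops (linearisation S) n) \<Longrightarrow> (\<Sum>a\<in>A. g a) \<in> ops (linearisation S) n"
  by (induction A rule: infinite_finite_induct) (simp_all add: linearisation_ops_add, simp_all add: linearisation_simps)

lemma linearisation_ops_single:
  "a \<in> set_ops S n \<Longrightarrow> Poly_Mapping.single a c \<in> ops (linearisation S) n"
  by (simp add: linearisation_simps)

lemma sym_relators_subset_ops: "sym_relators T \<subseteq> ops (linearisation tree_operad) 2"
proof -
  have two: "{1..2} = {1, 2::nat}" by auto
  show ?thesis
    unfolding sym_relators_def
    by (auto intro!: linearisation_ops_diff linearisation_ops_sum linearisation_ops_single
        simp: tree_operad_simps two)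
qed

lemma sym_ideal_subset_tree_identities:
  assumes "involutive_module T"
  shows "sym_ideal T n \<subseteq> tree_identities T n"
  unfolding sym_ideal_def
proof (rule ideal_gen_minimal[OF operad_ideal_tree_identities])
  fix m
  have "x \<in> tree_identities T 2" if x: "x \<in> sym_relators T" for x
  proof -
    obtain i where i: "x = mono (Node i (Leaf 2) (Leaf 1)) -
        (\<Sum>j\<in>UNIV. Poly_Mapping.single (Node j (Leaf 1) (Leaf 2)) (T i j))"
      using x by (auto simp: sym_relators_def)
    have "pm_eval (\<lambda>t. tree_eval T \<rho> t u) x = 0" for \<rho> u
      unfolding i pm_eval_diff pm_eval_sum pm_eval_single tree_eval.simps
      using tree_mult_swap[OF assms, of i "\<rho> 2" "\<rho> 1" u] by (simp only: mult_1 right_minus_eq)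
    then show ?thesis
      using x sym_relators_subset_ops[of T] by (auto simp: tree_identities_def)
  qed
  then have "sym_relators T \<subseteq> tree_identities T 2" by blast
  then show "in_arity 2 (sym_relators T) m \<subseteq> tree_identities T m"
    by (simp add: in_arity_def)
qed


section \<open>The free operad in arity 3\<close>

lemma lin_map_sum: "lin_map f (\<Sum>a\<in>A. g a) = (\<Sum>a\<in>A. lin_map f (g a))"
  by (induction A rule: infinite_finite_induct) (auto simp: lin_map_add)

lemma lin_map_diff: "lin_map f (x - y) = lin_map f x - lin_map f y"
  using lin_map_add[of f "x - y" y] by (simp add: algebra_simps)

lemma lin_map2_sum_left: "lin_map2 f (\<Sum>a\<in>A. g a) y = (\<Sum>a\<in>A. lin_map2 f (g a) y)"
  by (induction A rule: infinite_finite_induct) (auto simp: lin_map2_add_left)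

lemma lin_map2_sum_right: "lin_map2 f x (\<Sum>a\<in>A. g a) = (\<Sum>a\<in>A. lin_map2 f x (g a))"
  by (induction A rule: infinite_finite_induct) (auto simp: lin_map2_add_right)

lemma lin_map2_diff_left: "lin_map2 f (x - x') y = lin_map2 f x y - lin_map2 f x' y"
  using lin_map2_add_left[of f "x - x'" x' y] by (simp add: algebra_simps)

lemma lin_map2_diff_right: "lin_map2 f x (y - y') = lin_map2 f x y - lin_map2 f x y'"
  using lin_map2_add_right[of f x "y - y'" y'] by (simp add: algebra_simps)

lemma pm_scale_sum: "pm_scale c (\<Sum>a\<in>A. g a) = (\<Sum>a\<in>A. pm_scale c (g a))"
  by (induction A rule: infinite_finite_induct) (auto simp: pm_scale_add)

lemma linearisation_ops_scale:
  "x \<in> ops (linearisation S) n \<Longrightarrow> pm_scale c x \<in> ops (linearisation S) n"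
  using keys_pm_scale[of c x] by (auto simp: linearisation_simps)

lemma linearisation_coset_eq_iff:
  assumes "operad_with_ideal (linearisation S) I"
    and "x \<in> ops (linearisation S) n" "y \<in> ops (linearisation S) n"
  shows "coset (linearisation S) I n x = coset (linearisation S) I n y \<longleftrightarrow> x - y \<in> I n"
proof -
  interpret operad_with_ideal "linearisation S" I by fact
  show ?thesis
  proof
    assume "coset (linearisation S) I n x = coset (linearisation S) I n y"
    then have "x \<in> coset (linearisation S) I n y"
      using coset_self[OF assms(2)] by simp
    then show "x - y \<in> I n" by (auto simp: coset_def linearisation_simps)
  next
    assume "x - y \<in> I n"
    then show "coset (linearisation S) I n x = coset (linearisation S) I n y"
      using coset_add_ideal[OF assms(3), of "x - y"] by (simp add: linearisation_simps)
  qed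
qed

lemma linearisation_ideal_closed:
  assumes "operad_ideal (linearisation S) I"
  shows "0 \<in> I n" "\<lbrakk>x \<in> I n; y \<in> I n\<rbrakk> \<Longrightarrow> x + y \<in> I n" "x \<in> I n \<Longrightarrow> pm_scale c x \<in> I n"
    "\<lbrakk>x \<in> I n; y \<in> I n\<rbrakk> \<Longrightarrow> x - y \<in> I n" "x \<in> I n \<Longrightarrow> x \<in> ops (linearisation S) n"
proof -
  show add: "\<lbrakk>x \<in> I n; y \<in> I n\<rbrakk> \<Longrightarrow> x + y \<in> I n" and scale: "x \<in> I n \<Longrightarrow> pm_scale c x \<in> I n" for x y c
    using assms by (auto simp: operad_ideal_def subspace_of_def linearisation_simps)
  show "\<lbrakk>x \<in> I n; y \<in> I n\<rbrakk> \<Longrightarrow> x - y \<in> I n"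
    using add[of x "pm_scale (- 1) y"] scale[of y "- 1"] by (simp add: pm_scale_minus_one)
qed (use assms in \<open>unfold operad_ideal_def subspace_of_def linearisation_simps, blast+\<close>)

lemma operad_with_ideal_free: "operad_with_ideal (linearisation tree_operad) (sym_ideal T)"
  by (intro operad_with_ideal.intro operad_with_ideal_axioms.intro operad_trees operad_ideal_sym_ideal)

lemmas sym_ideal_closed = linearisation_ideal_closed[OF operad_ideal_sym_ideal]

lemma free_class_eq_iff:
  assumes "x \<in> ops (linearisation tree_operad) n" "y \<in> ops (linearisation tree_operad) n"
  shows "free_class T n x = free_class T n y \<longleftrightarrow> x - y \<in> sym_ideal T n"
  unfolding free_class_def by (rule linearisation_coset_eq_iff[OF operad_with_ideal_free assms])

lemma ops_free_operad: "ops (free_operad T) n = free_class T n ` ops (linearisation tree_operad) n"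
  by (simp add: free_operad_def quot_operad_def free_class_def[abs_def])

lemma vzero_free_operad: "vzero (free_operad T) n = free_class T n 0"
  by (simp add: free_operad_def quot_operad_def free_class_def linearisation_simps)

lemma vadd_free_class:
  "\<lbrakk>x \<in> ops (linearisation tree_operad) n; y \<in> ops (linearisation tree_operad) n\<rbrakk> \<Longrightarrow>
    vadd (free_operad T) n (free_class T n x) (free_class T n y) = free_class T n (x + y)"
  unfolding free_operad_def free_class_def
  by (subst operad_with_ideal.quot_add[OF operad_with_ideal_free]) (simp_all add: linearisation_simps)

lemma vscale_free_class:
  "x \<in> ops (linearisation tree_operad) n \<Longrightarrow>
    vscale (free_operad T) n c (free_class T n x) = free_class T n (pm_scale c x)"
  unfolding free_operad_def free_class_def
  by (subst operad_with_ideal.quot_scale[OF operad_with_ideal_free]) (simp_all add: linearisation_simps)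

lemma sact_free_class:
  "\<lbrakk>x \<in> ops (linearisation tree_operad) n; s permutes {1..n}\<rbrakk> \<Longrightarrow>
    sact (free_operad T) n (free_class T n x) s = free_class T n (lin_map (relabel (inv s)) x)"
  unfolding free_operad_def free_class_def
  by (subst operad_with_ideal.quot_act[OF operad_with_ideal_free])
     (simp_all add: linearisation_simps tree_operad_simps)

lemma pcomp_free_class:
  "\<lbrakk>x \<in> ops (linearisation tree_operad) m; y \<in> ops (linearisation tree_operad) n; i \<in> {1..m}\<rbrakk> \<Longrightarrow>
    pcomp (free_operad T) m n i (free_class T m x) (free_class T n y) =
      free_class T (m + n - 1) (lin_map2 (set_pcomp tree_operad m n i) x y)"
  unfolding free_operad_def free_class_def
  by (subst operad_with_ideal.quot_comp[OF operad_with_ideal_free])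
     (simp_all add: linearisation_simps del: atLeastAtMost_iff)

section \<open>Coordinates in arity 3: independence and spanning of the cyclic basis\<close>

definition arity3_index :: "('i::finite \<times> 'i \<times> nat \<times> nat \<times> nat) set" where
  "arity3_index = UNIV \<times> UNIV \<times> cyclic_triples"

definition tri :: "'i \<times> 'i \<times> nat \<times> nat \<times> nat \<Rightarrow> 'i tree" where
  "tri = (\<lambda>(i, j, a, b, c). Node i (Node j (Leaf a) (Leaf b)) (Leaf c))"

definition arity3_sum :: "('i::finite \<times> 'i \<times> nat \<times> nat \<times> nat \<Rightarrow> 'k::field) \<Rightarrow> ('i tree \<Rightarrow>\<^sub>0 'k)" where
  "arity3_sum u = (\<Sum>p\<in>arity3_index. Poly_Mapping.single (tri p) (u p))"

lemma finite_arity3_index [simp]: "finite arity3_index"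
  by (simp add: arity3_index_def cyclic_triples_def)

lemma sum_arity3_index:
  "(\<Sum>p\<in>arity3_index. f p) =
    (\<Sum>i\<in>UNIV. \<Sum>j\<in>UNIV. f (i, j, 1, 2, 3) + f (i, j, 3, 1, 2) + f (i, j, 2, 3, 1))"
  unfolding arity3_index_def sum.cartesian_product'
  by (simp add: cyclic_triples_def add.assoc)

lemma mem_arity3_index: "(i, j, t) \<in> arity3_index \<longleftrightarrow> t \<in> cyclic_triples"
  by (simp add: arity3_index_def)

lemma arity3_element_eq: "arity3_element T u = free_class T 3 (arity3_sum u)"
  unfolding arity3_element_def arity3_sum_def arity3_index_def
  by (intro arg_cong[where f = "free_class T 3"] sum.cong) (auto simp: tri_def)

lemma arity3_pairing_eq: "arity3_pairing u v = (\<Sum>p\<in>arity3_index. u p * v p)"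
  by (simp add: arity3_pairing_def arity3_index_def)

lemma tri_ops: "p \<in> arity3_index \<Longrightarrow> tri p \<in> set_ops tree_operad 3"
proof -
  have three: "{1..3} = {1, 2, 3::nat}" by auto
  show "p \<in> arity3_index \<Longrightarrow> tri p \<in> set_ops tree_operad 3"
    unfolding tree_operad_simps three by (auto simp: arity3_index_def cyclic_triples_def tri_def)
qed

lemma arity3_sum_ops: "arity3_sum u \<in> ops (linearisation tree_operad) 3"
  unfolding arity3_sum_def by (intro linearisation_ops_sum linearisation_ops_single tri_ops)

lemma arity3_sum_add: "arity3_sum u + arity3_sum v = arity3_sum (\<lambda>p. u p + v p)"
  by (simp add: arity3_sum_def single_add sum.distrib)

lemma arity3_sum_scale: "pm_scale c (arity3_sum u) = arity3_sum (\<lambda>p. c * u p)"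
  by (simp add: arity3_sum_def pm_scale_sum)

lemma arity3_sum_zero: "arity3_sum (\<lambda>p. 0) = 0"
  by (simp add: arity3_sum_def)

text \<open>The functional on trees of arity 3 which extends \<open>v\<close> from the basis \<^const>\<open>tri\<close>.\<close>

definition arity3_dual ::
    "('i::finite, 'k::field) S2_module \<Rightarrow> ('i \<times> 'i \<times> nat \<times> nat \<times> nat \<Rightarrow> 'k) \<Rightarrow> 'i tree \<Rightarrow> 'k" where
  "arity3_dual T v t =
     (\<Sum>p\<in>arity3_index. v p * tree_eval T (\<lambda>l u. if u = Leaf l then 1 else 0) t (tri p))"

text \<open>Evaluated at delta functions, \<open>tri p\<close> becomes the indicator of
  \<open>p\<close> on the basis. The twisted term of \<open>tree_mult\<close> at the root pairs a
  leaf with a node and vanishes; at the inner node it would need both \<open>(a, b, c)\<close> and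
  \<open>(b, a, c)\<close> to be cyclic.\<close>

lemma arity3_dual_tri:
  assumes "p \<in> arity3_index"
  shows "arity3_dual T v (tri p) = v p"
proof -
  let ?e = "tree_eval T (\<lambda>l u. if u = Leaf l then 1 else 0)"
  have "?e (tri p) (tri q) = (if p = q then 1 else 0)" if "q \<in> arity3_index" for q
  proof -
    obtain i j t i' j' t' where pq: "p = (i, j, t)" "q = (i', j', t')"
      by (metis prod.collapse)
    have "t \<in> {(1, 2, 3), (3, 1, 2), (2, 3, 1)}" "t' \<in> {(1, 2, 3), (3, 1, 2), (2, 3, 1)}"
      using that assms by (simp_all add: pq mem_arity3_index cyclic_triples_def)
    then show ?thesis
      unfolding pq insert_iff empty_iff
      by (elim disjE) (simp_all add: tri_def tree_mult_def)
  qed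
  then have "arity3_dual T v (tri p) = (\<Sum>q\<in>arity3_index. if p = q then v q else 0)"
    unfolding arity3_dual_def by (intro sum.cong) simp_all
  also have "\<dots> = v p"
    using assms by (subst sum.delta') simp_all
  finally show ?thesis .
qed

text \<open>Together with the rule for the inner node, this computes the functional on the trees
  that occur in relators, which are not all of the form \<open>tri p\<close>.\<close>

lemma arity3_dual_swap_outer:
  assumes "involutive_module T"
  shows "arity3_dual T v (Node i r s) = (\<Sum>k\<in>UNIV. T i k * arity3_dual T v (Node k s r))"
proof -
  let ?e = "tree_eval T (\<lambda>l u. if u = Leaf l then 1 else 0)"
  have "?e (Node i r s) w = (\<Sum>k\<in>UNIV. T i k * ?e (Node k s r) w)" for w
    unfolding tree_eval.simps by (rule tree_mult_swap[OF assms])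
  then have "arity3_dual T v (Node i r s) = (\<Sum>p\<in>arity3_index. \<Sum>k\<in>UNIV. T i k *
      (v p * ?e (Node k s r) (tri p)))"
    unfolding arity3_dual_def by (simp only: sum_distrib_left mult.left_commute)
  then show ?thesis
    unfolding arity3_dual_def by (subst (asm) sum.swap) (simp only: sum_distrib_left)
qed

lemma arity3_dual_swap_inner:
  assumes "involutive_module T"
  shows "arity3_dual T v (Node i (Node j r s) t) =
    (\<Sum>k\<in>UNIV. T j k * arity3_dual T v (Node i (Node k s r) t))"
proof -
  let ?e = "tree_eval T (\<lambda>l u. if u = Leaf l then 1 else 0)"
  have lin: "tree_mult T i (\<lambda>u. \<Sum>k\<in>UNIV. T j k * f k u) g w = (\<Sum>k\<in>UNIV. T j k * tree_mult T i (f k) g w)"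
    for f g w
    by (cases w) (auto simp: tree_mult_def sum_distrib_left sum_distrib_right sum.distrib algebra_simps)
  have "?e (Node j r s) = (\<lambda>u. \<Sum>k\<in>UNIV. T j k * ?e (Node k s r) u)"
    unfolding tree_eval.simps by (rule ext) (rule tree_mult_swap[OF assms])
  then have "?e (Node i (Node j r s) t) w = (\<Sum>k\<in>UNIV. T j k * ?e (Node i (Node k s r) t) w)" for w
    using lin by (simp only: tree_eval.simps)
  then have "arity3_dual T v (Node i (Node j r s) t) = (\<Sum>p\<in>arity3_index. \<Sum>k\<in>UNIV. T j k *
      (v p * ?e (Node i (Node k s r) t) (tri p)))"
    unfolding arity3_dual_def by (simp only: sum_distrib_left mult.left_commute)
  then show ?thesis
    unfolding arity3_dual_def by (subst (asm) sum.swap) (simp only: sum_distrib_left)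
qed

lemma arity3_dual_sym_ideal:
  assumes "involutive_module T" "x \<in> sym_ideal T 3"
  shows "pm_eval (arity3_dual T v) x = 0"
  using sym_ideal_subset_tree_identities[OF assms(1)] assms(2)
  unfolding arity3_dual_def[abs_def] pm_eval_sum_fun pm_eval_mult_left
  by (intro sum.neutral ballI) (auto simp: tree_identities_def)

lemma arity3_dual_arity3_sum: "pm_eval (arity3_dual T v) (arity3_sum u) = arity3_pairing u v"
  by (simp add: arity3_sum_def arity3_pairing_eq pm_eval_sum arity3_dual_tri)

lemma arity3_dual_free_class:
  assumes "involutive_module T" "arity3_element T u = free_class T 3 x"
    and "x \<in> ops (linearisation tree_operad) 3"
  shows "pm_eval (arity3_dual T v) x = arity3_pairing u v"
proof -
  have "arity3_sum u - x \<in> sym_ideal T 3"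
    using assms(2) unfolding arity3_element_eq free_class_eq_iff[OF arity3_sum_ops assms(3)] .
  then show ?thesis
    using arity3_dual_sym_ideal[OF assms(1)] by (fastforce simp: arity3_dual_arity3_sum)
qed

text \<open>The functional dual to \<open>p\<close> descends to classes and reads off the
  coefficient at \<open>p\<close>.\<close>

lemma arity3_element_inj:
  assumes "involutive_module T" "arity3_element T u = arity3_element T u'" "p \<in> arity3_index"
  shows "u p = u' p"
proof -
  have "arity3_pairing u (\<lambda>q. if q = p then 1 else 0) = arity3_pairing u' (\<lambda>q. if q = p then 1 else 0)"
    using arity3_dual_free_class[OF assms(1) _ arity3_sum_ops] arity3_dual_arity3_sum assms(2)
    unfolding arity3_element_eq by metis
  then show ?thesis using assms(3) by (simp add: arity3_pairing_eq if_distrib cong: if_cong)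
qed

lemma permutes_3:
  assumes "distinct [a, b, c]" "{a, b, c} = {1, 2, 3::nat}"
  obtains r where "r permutes {1..3}" "r 1 = a" "r 2 = b" "r 3 = c"
proof
  define r where "r = (\<lambda>x. if x = 1 then a else if x = 2 then b else if x = 3 then c else x)"
  have three: "{1..3} = {1, 2, 3::nat}" by auto
  have "inj_on r {1, 2, 3}" using assms(1) by (auto simp: r_def inj_on_def)
  moreover have "r ` {1, 2, 3} = {1, 2, 3}" using assms(2) by (auto simp: r_def)
  ultimately show "r permutes {1..3}"
    unfolding three by (intro bij_imp_permutes) (auto simp: bij_betw_def r_def)
qed simp_all

lemma sym_ideal_relabel:
  assumes "x \<in> sym_ideal T n" "r permutes {1..n}"
  shows "lin_map (relabel r) x \<in> sym_ideal T n"
proof -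
  have "sact (linearisation tree_operad) n x (inv r) \<in> sym_ideal T n"
    using operad_ideal_sym_ideal[of T] assms permutes_inv[OF assms(2)]
    by (auto simp: operad_ideal_def)
  then show ?thesis
    using assms(2) by (simp add: linearisation_simps tree_operad_simps permutes_bij inv_inv_eq)
qed

text \<open>Both elements are composites of a symmetry relator with a generator, relabelled by the
  permutation that sends 1, 2, 3 to \<open>a\<close>, \<open>b\<close>, \<open>c\<close>: the
  relator is inserted into the generator for the inner swap, the generator into the relator for the
  outer one.\<close>

lemma
  fixes T :: "('i::finite, 'k::field) S2_module"
  assumes "distinct [a, b, c]" "{a, b, c} = {1, 2, 3::nat}"
  shows sym_ideal_swap_inner: "mono (Node i (Node j (Leaf b) (Leaf a)) (Leaf c)) -
      (\<Sum>k\<in>UNIV. Poly_Mapping.single (Node i (Node k (Leaf a) (Leaf b)) (Leaf c)) (T j k)) \<in> sym_ideal T 3"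
    and sym_ideal_swap_outer: "mono (Node i (Leaf c) (Node j (Leaf a) (Leaf b))) -
      (\<Sum>k\<in>UNIV. Poly_Mapping.single (Node k (Node j (Leaf a) (Leaf b)) (Leaf c)) (T i k)) \<in> sym_ideal T 3"
proof -
  let ?L = "linearisation tree_operad :: ('k, 'i tree \<Rightarrow>\<^sub>0 'k) operad_struct"
  define rel where "rel j = (mono (Node j (Leaf 2) (Leaf 1)) -
     (\<Sum>k\<in>UNIV. Poly_Mapping.single (Node k (Leaf 1) (Leaf 2)) (T j k)) :: 'i tree \<Rightarrow>\<^sub>0 'k)" for j
  obtain r where r: "r permutes {1..3}" "r 1 = a" "r 2 = b" "r 3 = c"
    by (rule permutes_3[OF assms])
  have two: "{1..2} = {1, 2::nat}" by auto
  have rel: "rel j \<in> sym_ideal T 2" for j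
    using ideal_gen_superset[of "in_arity 2 (sym_relators T)" 2 ?L]
    by (auto simp: sym_ideal_def rel_def in_arity_def sym_relators_def)
  have gen: "mono (Node i (Leaf 1) (Leaf 2)) \<in> ops ?L 2" for i
    by (rule linearisation_ops_single) (unfold tree_operad_simps two, simp)
  have comp: "pcomp ?L m n i x y \<in> sym_ideal T (m + n - 1)"
    if "x \<in> ops ?L m" "y \<in> ops ?L n" "i \<in> {1..m}" "x \<in> sym_ideal T m \<or> y \<in> sym_ideal T n" for m n i x y
    using operad_ideal_sym_ideal[of T] that unfolding operad_ideal_def by blast
  have "lin_map (relabel r) (pcomp ?L 2 2 1 (mono (Node i (Leaf 1) (Leaf 2))) (rel j)) \<in> sym_ideal T 3"
    by (rule sym_ideal_relabel[OF _ r(1)])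
       (use comp[OF gen sym_ideal_closed(5)[OF rel], of 1] rel in simp)
  then show "mono (Node i (Node j (Leaf b) (Leaf a)) (Leaf c)) -
      (\<Sum>k\<in>UNIV. Poly_Mapping.single (Node i (Node k (Leaf a) (Leaf b)) (Leaf c)) (T j k)) \<in> sym_ideal T 3"
    by (simp add: linearisation_simps rel_def lin_map2_diff_right lin_map2_sum_right lin_map_diff
        lin_map_sum tree_operad_simps relabel_def outer_input_def r[simplified])
  have "lin_map (relabel r) (pcomp ?L 2 2 1 (rel i) (mono (Node j (Leaf 1) (Leaf 2)))) \<in> sym_ideal T 3"
    by (rule sym_ideal_relabel[OF _ r(1)])
       (use comp[OF sym_ideal_closed(5)[OF rel] gen, of 1] rel in simp)
  then show "mono (Node i (Leaf c) (Node j (Leaf a) (Leaf b))) -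
      (\<Sum>k\<in>UNIV. Poly_Mapping.single (Node k (Node j (Leaf a) (Leaf b)) (Leaf c)) (T i k)) \<in> sym_ideal T 3"
    by (simp add: linearisation_simps rel_def lin_map2_diff_left lin_map2_sum_left lin_map_diff
        lin_map_sum tree_operad_simps relabel_def outer_input_def r[simplified])
qed


lemma leaves_length_1: "length (leaves t) = 1 \<Longrightarrow> \<exists>a. t = Leaf a"
proof (cases t)
  case (Node i l r)
  have "0 < length (leaves s)" for s :: "'a tree" by (induction s) auto
  from this[of l] this[of r] show "length (leaves t) = 1 \<Longrightarrow> \<exists>a. t = Leaf a"
    by (simp add: Node)
qed simp

lemma leaves_length_2:
  assumes "length (leaves t) = 2"
  shows "\<exists>j a b. t = Node j (Leaf a) (Leaf b)"
proof (cases t)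
  case (Node i l r)
  have "0 < length (leaves s)" for s :: "'a tree" by (induction s) auto
  from this[of l] this[of r] have "length (leaves l) = 1 \<and> length (leaves r) = 1"
    using assms unfolding Node leaves.simps length_append by linarith
  then show ?thesis using Node leaves_length_1 by blast
qed (use assms in simp)

lemma arity3_tree_cases:
  assumes "t \<in> set_ops tree_operad 3"
  obtains i j a b c where "distinct [a, b, c]" "{a, b, c} = {1, 2, 3::nat}"
      "t = Node i (Node j (Leaf a) (Leaf b)) (Leaf c)"
    | i j a b c where "distinct [a, b, c]" "{a, b, c} = {1, 2, 3::nat}"
      "t = Node i (Leaf c) (Node j (Leaf a) (Leaf b))"
proof -
  have three: "{1..3} = {1, 2, 3::nat}" by auto
  have t: "distinct (leaves t)" "set (leaves t) = {1, 2, 3}"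
    using assms by (simp_all only: tree_operad_simps three mem_Collect_eq)
  then have len: "length (leaves t) = 3" using distinct_card by fastforce
  have pos: "0 < length (leaves s)" for s :: "'a tree" by (induction s) auto
  obtain i l r where lr: "t = Node i l r"
    using len by (cases t) auto
  have "length (leaves l) + length (leaves r) = 3" using len by (simp add: lr)
  then consider "length (leaves l) = 2" "length (leaves r) = 1" | "length (leaves l) = 1" "length (leaves r) = 2"
    using pos[of l] pos[of r] by linarith
  then show ?thesis
  proof cases
    case 1
    then obtain j a b c where "l = Node j (Leaf a) (Leaf b)" "r = Leaf c"
      using leaves_length_1 leaves_length_2 by blast
    with t that(1)[of a b c i j] show ?thesis by (simp add: lr)
  next
    case 2
    then obtain j a b c where "l = Leaf c" "r = Node j (Leaf a) (Leaf b)"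
      using leaves_length_1 leaves_length_2 by blast
    with t that(2)[of a b c i j] show ?thesis by (simp add: lr insert_commute)
  qed
qed

lemma cyclic_or_swapped:
  assumes "distinct [a, b, c]" "{a, b, c} = {1, 2, 3::nat}"
  shows "(a, b, c) \<in> cyclic_triples \<or> (b, a, c) \<in> cyclic_triples"
proof -
  have "a \<in> {1, 2, 3}" "b \<in> {1, 2, 3}" "c \<in> {1, 2, 3}" using assms(2) by blast+
  then show ?thesis using assms(1) by (auto simp: cyclic_triples_def)
qed

text \<open>Two rewritings suffice: the outer swap moves the composite subtree to the left, and the
  inner swap makes the order of the leaves cyclic.\<close>

lemma arity3_reduction:
  fixes T :: "('i::finite, 'k::field) S2_module"
  assumes "x \<in> ops (linearisation tree_operad) 3"
  shows "\<exists>u. x - arity3_sum u \<in> sym_ideal T 3"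
proof -
  let ?R = "\<lambda>x. \<exists>u. x - arity3_sum u \<in> sym_ideal T 3"
  have zero: "?R 0"
    by (rule exI[of _ "\<lambda>p. 0"]) (simp add: arity3_sum_zero sym_ideal_closed)
  have add: "?R (x + y)" if xy: "?R x" "?R y" for x y
  proof -
    from xy obtain u v where "x - arity3_sum u \<in> sym_ideal T 3" "y - arity3_sum v \<in> sym_ideal T 3" by blast
    from sym_ideal_closed(2)[OF this] have "x + y - arity3_sum (\<lambda>p. u p + v p) \<in> sym_ideal T 3"
      by (simp add: arity3_sum_add[symmetric] algebra_simps)
    then show ?thesis by blast
  qed
  have scale: "?R (pm_scale c x)" if R: "?R x" for x c
  proof -
    from R obtain u where "x - arity3_sum u \<in> sym_ideal T 3" by blast
    then have "pm_scale c (x - arity3_sum u) \<in> sym_ideal T 3" by (rule sym_ideal_closed)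
    moreover have "pm_scale c (x - arity3_sum u) = pm_scale c x - arity3_sum (\<lambda>p. c * u p)"
      unfolding arity3_sum_scale[symmetric] by (rule poly_mapping_eqI) (simp add: lookup_minus algebra_simps)
    ultimately show ?thesis by auto
  qed
  have sum: "?R (\<Sum>k\<in>A. Poly_Mapping.single (s k) (f k))" if "\<And>k. ?R (mono (s k))"
    for A :: "'i set" and s f
  proof (induction A rule: infinite_finite_induct)
    case (insert k A)
    have "?R (pm_scale (f k) (mono (s k)))" by (rule scale) (rule that)
    then have "?R (Poly_Mapping.single (s k) (f k))" by simp
    from add[OF this insert(3)] show ?case unfolding sum.insert[OF insert(1,2)] .
  qed (use zero in auto)
  have swap: "?R x" if "x - y \<in> sym_ideal T 3" "?R y" for x y
    using that sym_ideal_closed(2)[of "x - y" T 3] by fastforce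
  have tri: "?R (mono (tri p))" if "p \<in> arity3_index" for p
  proof
    have "(arity3_sum (\<lambda>q. if q = p then 1 else 0) :: 'i tree \<Rightarrow>\<^sub>0 'k) =
        (\<Sum>q\<in>arity3_index. if q = p then mono (tri q) else 0)"
      unfolding arity3_sum_def by (intro sum.cong) simp_all
    also have "\<dots> = mono (tri p)" using that by simp
    finally show "mono (tri p) - arity3_sum (\<lambda>q. if q = p then 1 else 0) \<in> sym_ideal T 3"
      by (simp add: sym_ideal_closed)
  qed
  have left: "?R (mono (Node i (Node j (Leaf a) (Leaf b)) (Leaf c)))"
    if abc: "distinct [a, b, c]" "{a, b, c} = {1, 2, 3}" for i j a b c
  proof (cases "(a, b, c) \<in> cyclic_triples")
    case True
    then show ?thesis using tri[of "(i, j, a, b, c)"] by (simp add: mem_arity3_index tri_def)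
  next
    case False
    then have "(b, a, c) \<in> cyclic_triples" using cyclic_or_swapped[OF abc] by blast
    then have "?R (mono (Node i (Node k (Leaf b) (Leaf a)) (Leaf c)))" for k
      using tri[of "(i, k, b, a, c)"] by (simp add: mem_arity3_index tri_def)
    from swap[OF sym_ideal_swap_inner sum[OF this]] show ?thesis
      using abc by (simp add: insert_commute)
  qed
  have "?R (mono t)" if "t \<in> set_ops tree_operad 3" for t
    using that
  proof (cases rule: arity3_tree_cases)
    case (1 i j a b c)
    then show ?thesis using left by simp
  next
    case (2 i j a b c)
    from swap[OF sym_ideal_swap_outer[OF 2(1,2)] sum[OF left[OF 2(1,2)]]] show ?thesis
      unfolding 2(3) .
  qed
  then have single: "?R (Poly_Mapping.single t c)" if "t \<in> set_ops tree_operad 3" for t c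
    using scale[of "mono t" c] that by simp
  show ?thesis
    using assms[unfolded linearisation_simps mem_Collect_eq]
    by (induction x rule: pm_induct) (blast intro: zero add single)+
qed

lemma arity3_element_surj:
  assumes "x \<in> ops (linearisation tree_operad) 3"
  obtains u where "free_class T 3 x = arity3_element T u"
  using arity3_reduction[OF assms, of T] free_class_eq_iff[OF assms arity3_sum_ops]
  by (auto simp: arity3_element_eq)


section \<open>Relations in coordinates\<close>

text \<open>Coordinates are total functions, so each relation has many of them, which differ off
  \<open>arity3_index\<close>. The pairing, hence every orthogonal, is blind to the
  difference.\<close>

definition arity3_coeffs ::
    "('i::finite, 'k::field) quadratic_data \<Rightarrow> ('i \<times> 'i \<times> nat \<times> nat \<times> nat \<Rightarrow> 'k) set" where
  "arity3_coeffs Q = {u. arity3_element (gens Q) u \<in> rels Q}"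

definition arity3_perp ::
    "('i::finite \<times> 'i \<times> nat \<times> nat \<times> nat \<Rightarrow> 'k::field) set \<Rightarrow> ('i \<times> 'i \<times> nat \<times> nat \<times> nat \<Rightarrow> 'k) set" where
  "arity3_perp U = {v. \<forall>u\<in>U. arity3_pairing u v = 0}"

lemma arity3_pairing_cong:
  "(\<And>p. p \<in> arity3_index \<Longrightarrow> u p = u' p) \<Longrightarrow> (\<And>p. p \<in> arity3_index \<Longrightarrow> v p = v' p) \<Longrightarrow>
    arity3_pairing u v = arity3_pairing u' v'"
  by (simp add: arity3_pairing_eq)

lemma arity3_pairing_commute: "arity3_pairing u v = arity3_pairing v u"
  by (simp add: arity3_pairing_eq mult.commute)

lemma involutive_dual_module: "involutive_module T \<Longrightarrow> involutive_module (dual_module T)"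
  by (auto simp: involutive_module_def dual_module_def mult.commute)

lemma rels_koszul_dual:
  "rels (koszul_dual Q) = arity3_element (gens (koszul_dual Q)) ` arity3_perp (arity3_coeffs Q)"
  by (auto simp: koszul_dual_def arity3_perp_def arity3_coeffs_def)

text \<open>By injectivity, any coordinates of a relation agree on \<open>arity3_index\<close> with
  the given ones, and an orthogonal space contains with a function all functions that agree with it
  there.\<close>

lemma arity3_coeffs_of_rels:
  assumes "involutive_module (gens Q)" "rels Q = arity3_element (gens Q) ` arity3_perp U"
  shows "arity3_coeffs Q = arity3_perp U"
proof (intro subset_antisym subsetI)
  fix v assume "v \<in> arity3_coeffs Q"
  then obtain v' where v': "v' \<in> arity3_perp U" "arity3_element (gens Q) v = arity3_element (gens Q) v'"
    using assms(2) by (auto simp: arity3_coeffs_def)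
  then have "v p = v' p" if "p \<in> arity3_index" for p
    using arity3_element_inj assms(1) that by blast
  then have "arity3_pairing u v = arity3_pairing u v'" for u
    by (intro arity3_pairing_cong) auto
  then show "v \<in> arity3_perp U" using v'(1) by (simp add: arity3_perp_def)
qed (use assms(2) in \<open>auto simp: arity3_coeffs_def\<close>)

lemma arity3_coeffs_koszul_dual:
  assumes "involutive_module (gens Q)"
  shows "arity3_coeffs (koszul_dual Q) = arity3_perp (arity3_coeffs Q)"
  by (rule arity3_coeffs_of_rels[OF _ rels_koszul_dual])
     (simp add: koszul_dual_def involutive_dual_module assms)

lemma stable_span_of_properties:
  assumes "operad P" "G \<subseteq> ops P n"
  shows "subspace_of P n (stable_span_of P n G)"
    and "\<lbrakk>x \<in> stable_span_of P n G; s permutes {1..n}\<rbrakk> \<Longrightarrow> sact P n x s \<in> stable_span_of P n G"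
    and "G \<subseteq> stable_span_of P n G"
    and "\<lbrakk>subspace_of P n S; \<And>x s. \<lbrakk>x \<in> S; s permutes {1..n}\<rbrakk> \<Longrightarrow> sact P n x s \<in> S; G \<subseteq> S\<rbrakk> \<Longrightarrow>
      stable_span_of P n G \<subseteq> S"
proof -
  interpret operad P by fact
  show "subspace_of P n (stable_span_of P n G)"
    unfolding stable_span_of_def
  proof (rule subspace_of_Inter)
    have "ops P n \<in> {S. subspace_of P n S \<and> (\<forall>x\<in>S. \<forall>s. s permutes {1..n} \<longrightarrow> sact P n x s \<in> S) \<and> G \<subseteq> S}"
      using assms(2) by (simp add: subspace_of_ops act_closed)
    then show "{S. subspace_of P n S \<and> (\<forall>x\<in>S. \<forall>s. s permutes {1..n} \<longrightarrow> sact P n x s \<in> S) \<and> G \<subseteq> S} \<noteq> {}"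
      by blast
  qed blast
qed (unfold stable_span_of_def, blast+)

text \<open>A functional on classes vanishes on the stable span as soon as it vanishes on all
  relabelled generators, because the elements whose relabellings it kills form a stable subspace.
  This reduces each orthogonal to finitely many equations per relator.\<close>

lemma arity3_perp_relators:
  fixes T :: "('i::finite, 'k::field) S2_module"
  assumes T: "involutive_module T" and G: "G \<subseteq> ops (linearisation tree_operad) 3"
  shows "arity3_perp (arity3_coeffs (quadratic_data_of_relators T G)) =
    {v. \<forall>g\<in>G. \<forall>r. r permutes {1..3} \<longrightarrow> pm_eval (\<lambda>t. arity3_dual T v (relabel r t)) g = 0}"
proof -
  let ?L = "linearisation tree_operad :: ('k, 'i tree \<Rightarrow>\<^sub>0 'k) operad_struct"
  let ?R = "stable_span_of (free_operad T) 3 (free_class T 3 ` G)"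
  interpret L: operad ?L by (rule operad_trees)
  have cG: "free_class T 3 ` G \<subseteq> ops (free_operad T) 3"
    using G by (auto simp: ops_free_operad)
  note span = stable_span_of_properties[OF operad_free_operad cG]
  have coeffs: "u \<in> arity3_coeffs (quadratic_data_of_relators T G) \<longleftrightarrow> arity3_element T u \<in> ?R" for u
    by (simp add: arity3_coeffs_def quadratic_data_of_relators_def)
  have ops_relabel: "lin_map (relabel (inv s)) x \<in> ops ?L 3" if "x \<in> ops ?L 3" "s permutes {1..3}" for x s
    using L.act_closed[OF that] by (simp add: linearisation_simps tree_operad_simps)
  show ?thesis
  proof (intro subset_antisym subsetI CollectI ballI allI impI)
    fix v g and r :: "nat \<Rightarrow> nat" assume v: "v \<in> arity3_perp (arity3_coeffs (quadratic_data_of_relators T G))"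
      and g: "g \<in> G" and r: "r permutes {1..3}"
    let ?x = "lin_map (relabel r) g"
    \<comment> \<open>The action of \<open>s\<close> relabels leaves by \<open>inv s\<close>, so
      acting with \<open>inv r\<close> produces the relabelling by \<open>r\<close>.\<close>
    have ir: "inv r permutes {1..3}" "inv (inv r) = r"
      using r by (auto intro: permutes_inv simp: permutes_bij inv_inv_eq)
    have gL: "g \<in> ops ?L 3" using g G by blast
    have x: "?x \<in> ops ?L 3" using ops_relabel[OF gL ir(1)] by (simp add: ir(2))
    obtain u where u: "free_class T 3 ?x = arity3_element T u"
      using arity3_element_surj[OF x] .
    have "free_class T 3 ?x \<in> ?R"
      using span(2)[OF subsetD[OF span(3)] ir(1), of "free_class T 3 g"] g gL
      by (simp add: sact_free_class[OF gL ir(1)] ir(2))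
    then have "arity3_pairing u v = 0"
      using v by (simp add: arity3_perp_def coeffs u)
    then show "pm_eval (\<lambda>t. arity3_dual T v (relabel r t)) g = 0"
      using arity3_dual_free_class[OF T u[symmetric] x, of v] by (simp add: pm_eval_lin_map)
  next
    fix v assume v: "v \<in> {v. \<forall>g\<in>G. \<forall>r. r permutes {1..3} \<longrightarrow> pm_eval (\<lambda>t. arity3_dual T v (relabel r t)) g = 0}"
    \<comment> \<open>The condition is imposed for every \<open>r\<close> at once, so that
      \<open>X\<close> is stable under the action; at \<open>r = id\<close> it gives back the
      pairing with \<open>v\<close>.\<close>
    define X where "X = {x \<in> ops ?L 3. \<forall>r. r permutes {1..3} \<longrightarrow> pm_eval (\<lambda>t. arity3_dual T v (relabel r t)) x = 0}"
    have X: "x \<in> ops ?L 3" if "x \<in> X" for x using that by (simp add: X_def)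
    have X_closed: "0 \<in> X" "\<And>x y. x \<in> X \<Longrightarrow> y \<in> X \<Longrightarrow> x + y \<in> X" "\<And>c x. x \<in> X \<Longrightarrow> pm_scale c x \<in> X"
      by (auto simp: X_def linearisation_ops_add linearisation_ops_scale) (simp add: linearisation_simps)
    have X_act: "lin_map (relabel (inv s)) x \<in> X" if "x \<in> X" "s permutes {1..3}" for x s
      using that ops_relabel[OF X that(2)] permutes_compose[OF permutes_inv[OF that(2)]]
      by (simp add: X_def pm_eval_lin_map relabel_relabel comp_def)
    have sub: "?R \<subseteq> free_class T 3 ` X"
    proof (rule span(4))
      show "subspace_of (free_operad T) 3 (free_class T 3 ` X)"
        unfolding subspace_of_def
        using X X_closed by (auto simp: ops_free_operad vzero_free_operad vadd_free_class vscale_free_class)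
      show "sact (free_operad T) 3 x s \<in> free_class T 3 ` X"
        if "x \<in> free_class T 3 ` X" "s permutes {1..3}" for x s
        using that X X_act by (auto simp: sact_free_class)
      show "free_class T 3 ` G \<subseteq> free_class T 3 ` X"
        using v G by (auto simp: X_def)
    qed
    have "arity3_pairing u v = 0" if u: "arity3_element T u \<in> ?R" for u
    proof -
      obtain x where x: "x \<in> X" "arity3_element T u = free_class T 3 x"
        using sub u by blast
      have "pm_eval (\<lambda>t. arity3_dual T v (relabel id t)) x = 0"
        using x(1) permutes_id by (auto simp: X_def)
      then show ?thesis
        using arity3_dual_free_class[OF T x(2) X[OF x(1)]] by (simp add: relabel_ident)
    qed
    then show "v \<in> arity3_perp (arity3_coeffs (quadratic_data_of_relators T G))"
      by (simp add: arity3_perp_def coeffs)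
  qed
qed


section \<open>Morphisms of quotients\<close>

lemma operad_morphismD:
  assumes "operad_morphism P Q f"
  shows "x \<in> ops P n \<Longrightarrow> f n x \<in> ops Q n"
    and "\<lbrakk>x \<in> ops P n; y \<in> ops P n\<rbrakk> \<Longrightarrow> f n (vadd P n x y) = vadd Q n (f n x) (f n y)"
    and "x \<in> ops P n \<Longrightarrow> f n (vscale P n c x) = vscale Q n c (f n x)"
    and "\<lbrakk>x \<in> ops P n; s permutes {1..n}\<rbrakk> \<Longrightarrow> f n (sact P n x s) = sact Q n (f n x) s"
    and "\<lbrakk>i \<in> {1..m}; x \<in> ops P m; y \<in> ops P n\<rbrakk> \<Longrightarrow>
      f (m + n - 1) (pcomp P m n i x y) = pcomp Q m n i (f m x) (f n y)"
    and "f 1 (ounit P) = ounit Q"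
  using assms unfolding operad_morphism_def by blast+

lemma (in operad) scale_zero: "x \<in> ops P n \<Longrightarrow> vscale P n 0 x = vzero P n"
  using scale_add_left[of x n 1 "- 1"] add_inverse[of x n] scale_one[of x n] by simp

lemma operad_morphism_zero:
  assumes "operad P" "operad Q" "operad_morphism P Q f"
  shows "f n (vzero P n) = vzero Q n"
proof -
  interpret P: operad P by fact
  interpret Q: operad Q by fact
  have "f n (vzero P n) = f n (vscale P n 0 (vzero P n))"
    by (simp add: P.scale_zero P.zero_closed)
  also have "\<dots> = vzero Q n"
    using operad_morphismD(1,3)[OF assms(3) P.zero_closed] by (simp add: Q.scale_zero)
  finally show ?thesis .
qed

lemma operad_ideal_preimage:
  assumes P: "operad P" and Q: "operad Q" and f: "operad_morphism P Q f" and J: "operad_ideal Q J"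
  shows "operad_ideal P (\<lambda>n. {x \<in> ops P n. f n x \<in> J n})"
proof -
  interpret P: operad P by fact
  note fD = operad_morphismD[OF f]
  have J': "vzero Q n \<in> J n" "\<lbrakk>x \<in> J n; y \<in> J n\<rbrakk> \<Longrightarrow> vadd Q n x y \<in> J n" "x \<in> J n \<Longrightarrow> vscale Q n c x \<in> J n"
    "\<lbrakk>x \<in> J n; s permutes {1..n}\<rbrakk> \<Longrightarrow> sact Q n x s \<in> J n"
    "\<lbrakk>i \<in> {1..m}; x \<in> ops Q m; y \<in> ops Q n; x \<in> J m \<or> y \<in> J n\<rbrakk> \<Longrightarrow> pcomp Q m n i x y \<in> J (m + n - 1)"
    for x y n m i s c
    using J unfolding operad_ideal_def subspace_of_def by blast+
  have "subspace_of P n {x \<in> ops P n. f n x \<in> J n}" for n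
    unfolding subspace_of_def using J' fD
    by (auto simp: P.zero_closed P.add_closed P.scale_closed operad_morphism_zero[OF P Q f])
  moreover have "sact P n x s \<in> {x \<in> ops P n. f n x \<in> J n}"
    if "x \<in> {x \<in> ops P n. f n x \<in> J n}" "s permutes {1..n}" for n x s
    using that J' fD by (auto simp: P.act_closed)
  moreover have "pcomp P m n i x y \<in> {x \<in> ops P (m + n - 1). f (m + n - 1) x \<in> J (m + n - 1)}"
    if i: "i \<in> {1..m}" and x: "x \<in> ops P m" and y: "y \<in> ops P n"
      and or: "x \<in> {x \<in> ops P m. f m x \<in> J m} \<or> y \<in> {x \<in> ops P n. f n x \<in> J n}" for m n i x y
    using P.comp_closed[OF x y i] J'(5)[OF i fD(1)[OF x] fD(1)[OF y]] or fD(5)[OF i x y] by auto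
  ultimately show ?thesis
    unfolding operad_ideal_def by blast
qed

text \<open>The preimage of the ideal generated by \<open>H\<close> is an ideal that contains
  \<open>G\<close>.\<close>

lemma ideal_gen_image:
  assumes P: "operad P" and Q: "operad Q" and f: "operad_morphism P Q f"
    and G: "\<And>m. G m \<subseteq> ops P m" and H: "\<And>m. H m \<subseteq> ops Q m"
    and GH: "\<And>m. f m ` G m \<subseteq> ideal_gen Q H m"
  shows "f n ` ideal_gen P G n \<subseteq> ideal_gen Q H n"
proof -
  have "G m \<subseteq> {x \<in> ops P m. f m x \<in> ideal_gen Q H m}" for m
    using G[of m] GH[of m] by blast
  then have "ideal_gen P G n \<subseteq> {x \<in> ops P n. f n x \<in> ideal_gen Q H n}"
    by (intro ideal_gen_minimal operad_ideal_preimage[OF P Q f] operad.operad_ideal_ideal_gen[OF Q H])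
  then show ?thesis by blast
qed

definition quot_map ::
    "('k, 'b) operad_struct \<Rightarrow> (nat \<Rightarrow> 'b set) \<Rightarrow> (nat \<Rightarrow> 'a \<Rightarrow> 'b) \<Rightarrow> nat \<Rightarrow> 'a set \<Rightarrow> 'b set" where
  "quot_map Q J f n A = (\<Union>x\<in>A. coset Q J n (f n x))"

locale quotient_morphism =
  P: operad_with_ideal P I + Q: operad_with_ideal Q J
  for P :: "('k::field, 'a) operad_struct" and I and Q :: "('k, 'b) operad_struct" and J +
  fixes f :: "nat \<Rightarrow> 'a \<Rightarrow> 'b"
  assumes morphism: "operad_morphism P Q f" and ideals: "x \<in> I n \<Longrightarrow> f n x \<in> J n"
begin

lemmas fD = operad_morphismD[OF morphism]

lemma quot_map_coset: "x \<in> ops P n \<Longrightarrow> quot_map Q J f n (coset P I n x) = coset Q J n (f n x)"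
  unfolding quot_map_def
proof -
  assume x: "x \<in> ops P n"
  have "coset Q J n (f n a) = coset Q J n (f n x)" if a: "a \<in> coset P I n x" for a
  proof -
    obtain d where "d \<in> I n" "a = vadd P n x d" using P.coset_member[OF a x] by blast
    then show ?thesis
      using fD(1,2) x P.I_closed Q.coset_add_ideal ideals by simp
  qed
  then show "(\<Union>x\<in>coset P I n x. coset Q J n (f n x)) = coset Q J n (f n x)"
    using P.coset_self[OF x] by blast
qed

lemma operad_morphism_quot_map:
  "operad_morphism (quot_operad P I) (quot_operad Q J) (quot_map Q J f)"
  unfolding operad_morphism_def
  by (auto simp: P.quot_simps Q.quot_simps quot_map_coset fD P.quot_add Q.quot_add P.quot_scale
      Q.quot_scale P.quot_act Q.quot_act P.quot_comp Q.quot_comp P.add_closed P.scale_closed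
      P.act_closed P.comp_closed P.unit_closed simp del: atLeastAtMost_iff One_nat_def)

end

definition inverse_morphisms ::
    "('k, 'a) operad_struct \<Rightarrow> ('k, 'b) operad_struct \<Rightarrow> (nat \<Rightarrow> 'a \<Rightarrow> 'b) \<Rightarrow> (nat \<Rightarrow> 'b \<Rightarrow> 'a) \<Rightarrow> bool" where
  "inverse_morphisms P Q f g \<longleftrightarrow> operad_morphism P Q f \<and> operad_morphism Q P g \<and>
     (\<forall>n. \<forall>x\<in>ops P n. g n (f n x) = x) \<and> (\<forall>n. \<forall>y\<in>ops Q n. f n (g n y) = y)"

lemma operad_isomorphic_inverse_morphisms:
  assumes "operad P" "operad Q" "inverse_morphisms P Q f g"
  shows "operad_isomorphic P Q"
proof -
  have "bij_betw (f n) (ops P n) (ops Q n)" for n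
    using assms(3) operad_morphismD(1)[of P Q f] operad_morphismD(1)[of Q P g]
    by (intro bij_betw_byWitness[where f' = "g n"]) (auto simp: inverse_morphisms_def)
  then show ?thesis
    using assms unfolding operad_isomorphic_def inverse_morphisms_def by blast
qed

lemma inverse_morphisms_quot:
  assumes "operad_with_ideal P I" "operad_with_ideal Q J" "inverse_morphisms P Q f g"
    and "\<And>n. f n ` I n \<subseteq> J n" "\<And>n. g n ` J n \<subseteq> I n"
  shows "inverse_morphisms (quot_operad P I) (quot_operad Q J) (quot_map Q J f) (quot_map P I g)"
proof -
  have "quotient_morphism P I Q J f" "quotient_morphism Q J P I g"
    using assms unfolding quotient_morphism_def quotient_morphism_axioms_def inverse_morphisms_def by blast+
  then interpret f: quotient_morphism P I Q J f + g: quotient_morphism Q J P I g .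
  show ?thesis
    unfolding inverse_morphisms_def
    using f.operad_morphism_quot_map g.operad_morphism_quot_map assms(3)
    by (auto simp: f.P.quot_simps f.Q.quot_simps f.quot_map_coset g.quot_map_coset f.fD(1) g.fD(1)
        inverse_morphisms_def)
qed


section \<open>Change of basis\<close>

primrec tree_weight :: "('i \<Rightarrow> 'k::field) \<Rightarrow> 'i tree \<Rightarrow> 'k" where
  "tree_weight \<epsilon> (Leaf l) = 1"
| "tree_weight \<epsilon> (Node i s t) = \<epsilon> i * tree_weight \<epsilon> s * tree_weight \<epsilon> t"

text \<open>The extension to trees of e_i \<mapsto> \<epsilon>(i) e_{\<phi>(i)}. Since generators go
  to multiples of generators, a tree goes to a multiple of one tree, and no general substitution in
  the nodes is required.\<close>

definition monomial_map ::
    "('i \<Rightarrow> 'j) \<Rightarrow> ('i \<Rightarrow> 'k::field) \<Rightarrow> ('i tree \<Rightarrow>\<^sub>0 'k) \<Rightarrow> ('j tree \<Rightarrow>\<^sub>0 'k)" where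
  "monomial_map \<phi> \<epsilon> x = (\<Sum>t\<in>Poly_Mapping.keys x.
     Poly_Mapping.single (map_tree \<phi> t) (Poly_Mapping.lookup x t * tree_weight \<epsilon> t))"

lemma monomial_map_superset:
  assumes "finite A" "Poly_Mapping.keys x \<subseteq> A"
  shows "monomial_map \<phi> \<epsilon> x =
    (\<Sum>t\<in>A. Poly_Mapping.single (map_tree \<phi> t) (Poly_Mapping.lookup x t * tree_weight \<epsilon> t))"
  unfolding monomial_map_def
  by (rule sum.mono_neutral_left) (use assms in \<open>auto simp: not_in_keys_iff_lookup_eq_zero\<close>)

lemma monomial_map_zero [simp]: "monomial_map \<phi> \<epsilon> 0 = 0"
  by (simp add: monomial_map_def)

lemma monomial_map_single [simp]:
  "monomial_map \<phi> \<epsilon> (Poly_Mapping.single t c) = Poly_Mapping.single (map_tree \<phi> t) (c * tree_weight \<epsilon> t)"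
  by (cases "c = 0") (simp_all add: monomial_map_def)

lemma monomial_map_add: "monomial_map \<phi> \<epsilon> (x + y) = monomial_map \<phi> \<epsilon> x + monomial_map \<phi> \<epsilon> y"
proof -
  let ?A = "Poly_Mapping.keys x \<union> Poly_Mapping.keys y"
  have "Poly_Mapping.keys (x + y) \<subseteq> ?A" by (rule keys_add)
  then show ?thesis
    by (subst (1 2 3) monomial_map_superset[of ?A])
       (auto simp: lookup_add single_add sum.distrib distrib_right)
qed

lemma monomial_map_scale: "monomial_map \<phi> \<epsilon> (pm_scale c x) = pm_scale c (monomial_map \<phi> \<epsilon> x)"
  by (induction x rule: pm_induct[OF subset_UNIV]) (auto simp: monomial_map_add pm_scale_add mult.assoc)

lemma monomial_map_diff: "monomial_map \<phi> \<epsilon> (x - y) = monomial_map \<phi> \<epsilon> x - monomial_map \<phi> \<epsilon> y"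
  using monomial_map_add[of \<phi> \<epsilon> "x - y" y] by (simp add: algebra_simps)

lemma monomial_map_sum: "monomial_map \<phi> \<epsilon> (\<Sum>a\<in>A. g a) = (\<Sum>a\<in>A. monomial_map \<phi> \<epsilon> (g a))"
  by (induction A rule: infinite_finite_induct) (auto simp: monomial_map_add)

lemma leaves_map_tree [simp]: "leaves (map_tree \<phi> t) = leaves t"
  by (induction t) auto

lemma map_tree_graft: "map_tree \<phi> (graft f t) = graft (\<lambda>l. map_tree \<phi> (f l)) (map_tree \<phi> t)"
  by (induction t) auto

lemma map_tree_relabel: "map_tree \<phi> (relabel g t) = relabel g (map_tree \<phi> t)"
  by (simp add: relabel_def map_tree_graft)

lemma map_tree_set_pcomp:
  "map_tree \<phi> (set_pcomp tree_operad m n i s t) = set_pcomp tree_operad m n i (map_tree \<phi> s) (map_tree \<phi> t)"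
  unfolding tree_operad_simps map_tree_graft
  by (rule arg_cong[where f = "\<lambda>f. graft f (map_tree \<phi> s)"]) (auto simp: map_tree_relabel)

lemma map_tree_set_ops: "map_tree \<phi> t \<in> set_ops tree_operad n \<longleftrightarrow> t \<in> set_ops tree_operad n"
  by (simp add: tree_operad_simps)

lemma tree_weight_relabel [simp]: "tree_weight \<epsilon> (relabel g t) = tree_weight \<epsilon> t"
  by (induction t) (auto simp: relabel_def)

text \<open>Distinct leaves let \<open>u\<close> occur at most once; this makes the weight
  multiplicative under partial composition.\<close>

lemma tree_weight_graft:
  assumes "distinct (leaves t)"
  shows "tree_weight \<epsilon> (graft (\<lambda>l. if l = i then u else Leaf (h l)) t) =
    tree_weight \<epsilon> t * (if i \<in> set (leaves t) then tree_weight \<epsilon> u else 1)"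
  using assms by (induction t) auto

lemma operad_morphism_monomial_map:
  "operad_morphism (linearisation tree_operad) (linearisation tree_operad) (\<lambda>n. monomial_map \<phi> \<epsilon>)"
proof -
  let ?m = "monomial_map \<phi> \<epsilon>"
  have closed: "?m x \<in> ops (linearisation tree_operad) n" if "x \<in> ops (linearisation tree_operad) n" for x n
    unfolding monomial_map_def using that
    by (intro linearisation_ops_sum linearisation_ops_single)
       (auto simp: map_tree_set_ops linearisation_simps)
  have act: "?m (lin_map (relabel s) x) = lin_map (relabel s) (?m x)" for x s
    by (induction x rule: pm_induct[OF subset_UNIV]) (auto simp: lin_map_add monomial_map_add map_tree_relabel)
  have comp: "?m (lin_map2 (set_pcomp tree_operad m n i) x y) = lin_map2 (set_pcomp tree_operad m n i) (?m x) (?m y)"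
    if "i \<in> {1..m}" "Poly_Mapping.keys x \<subseteq> set_ops tree_operad m" for m n i x y
    using that(2)
  proof (induction x rule: pm_induct)
    case (single s c)
    have "tree_weight \<epsilon> (set_pcomp tree_operad m n i s t) = tree_weight \<epsilon> s * tree_weight \<epsilon> t" for t
      using single that(1) by (simp add: tree_operad_simps tree_weight_graft)
    then show ?case
      by (induction y rule: pm_induct[OF subset_UNIV])
         (auto simp: lin_map2_add_right monomial_map_add map_tree_set_pcomp ac_simps)
  qed (auto simp: lin_map2_add_left monomial_map_add)
  show ?thesis
    unfolding operad_morphism_def
    using closed act comp
    by (auto simp: linearisation_simps monomial_map_add monomial_map_scale tree_operad_simps(2,4))
qed

text \<open>The last equation is equivariance: both sides are the coefficient of e_{\<phi>(j)} in
  the image of e_i \<tau>.\<close>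

definition monomial_isomorphism ::
    "('i::finite, 'k::field) S2_module \<Rightarrow> ('j::finite, 'k) S2_module \<Rightarrow> ('i \<Rightarrow> 'j) \<Rightarrow> ('i \<Rightarrow> 'k) \<Rightarrow> bool" where
  "monomial_isomorphism T T' \<phi> \<epsilon> \<longleftrightarrow>
     bij \<phi> \<and> (\<forall>i. \<epsilon> i \<noteq> 0) \<and> (\<forall>i j. T i j * \<epsilon> j = \<epsilon> i * T' (\<phi> i) (\<phi> j))"

lemma monomial_isomorphism_inverse:
  assumes "monomial_isomorphism T T' \<phi> \<epsilon>"
  shows "monomial_isomorphism T' T (inv \<phi>) (\<lambda>j. inverse (\<epsilon> (inv \<phi> j)))"
proof -
  have b: "bij \<phi>" and n: "\<And>i. \<epsilon> i \<noteq> 0" and t: "\<And>i j. T i j * \<epsilon> j = \<epsilon> i * T' (\<phi> i) (\<phi> j)"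
    using assms by (auto simp: monomial_isomorphism_def)
  have "T' i j * inverse (\<epsilon> (inv \<phi> j)) = inverse (\<epsilon> (inv \<phi> i)) * T (inv \<phi> i) (inv \<phi> j)" for i j
    using t[of "inv \<phi> i" "inv \<phi> j"] n surj_f_inv_f[OF bij_is_surj[OF b]] by (simp add: field_simps)
  then show ?thesis using b n by (simp add: monomial_isomorphism_def bij_imp_bij_inv)
qed

text \<open>By equivariance and reindexing along \<phi>, the symmetry relator of e_i goes to
  \<epsilon>(i) times that of e_{\<phi>(i)}.\<close>

lemma monomial_map_sym_ideal:
  fixes T :: "('i::finite, 'k::field) S2_module" and T' :: "('j::finite, 'k) S2_module"
  assumes iso: "monomial_isomorphism T T' \<phi> \<epsilon>"
  shows "monomial_map \<phi> \<epsilon> ` sym_ideal T n \<subseteq> sym_ideal T' n"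
  unfolding sym_ideal_def
proof (rule ideal_gen_image[OF operad_trees operad_trees operad_morphism_monomial_map])
  fix m
  have b: "bij \<phi>" and t: "\<And>i j. T i j * \<epsilon> j = \<epsilon> i * T' (\<phi> i) (\<phi> j)"
    using iso by (auto simp: monomial_isomorphism_def)
  have "monomial_map \<phi> \<epsilon> x \<in> sym_ideal T' 2" if x_rel: "x \<in> sym_relators T" for x
  proof -
    obtain i where x: "x = mono (Node i (Leaf 2) (Leaf 1)) -
        (\<Sum>j\<in>UNIV. Poly_Mapping.single (Node j (Leaf 1) (Leaf 2)) (T i j))"
      using x_rel by (auto simp: sym_relators_def)
    let ?y = "mono (Node (\<phi> i) (Leaf 2) (Leaf 1)) -
        (\<Sum>j\<in>UNIV. Poly_Mapping.single (Node j (Leaf 1) (Leaf 2)) (T' (\<phi> i) j)) :: 'j tree \<Rightarrow>\<^sub>0 'k"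
    have "(\<Sum>j\<in>UNIV. Poly_Mapping.single (Node (\<phi> j) (Leaf 1) (Leaf 2)) (\<epsilon> i * T' (\<phi> i) (\<phi> j))) =
        pm_scale (\<epsilon> i) (\<Sum>j\<in>UNIV. Poly_Mapping.single (Node j (Leaf 1) (Leaf 2)) (T' (\<phi> i) j))"
      by (subst sum.reindex_bij_betw[OF b, symmetric]) (simp add: pm_scale_sum)
    moreover have "pm_scale c (y - z) = pm_scale c y - pm_scale c z" for c and y z :: "'j tree \<Rightarrow>\<^sub>0 'k"
      by (rule poly_mapping_eqI) (simp add: lookup_minus algebra_simps)
    ultimately have "monomial_map \<phi> \<epsilon> x = pm_scale (\<epsilon> i) ?y"
      by (simp add: x monomial_map_diff monomial_map_sum t)
    moreover have "?y \<in> sym_ideal T' 2"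
      using ideal_gen_superset[of "in_arity 2 (sym_relators T')" 2 "linearisation tree_operad"]
      by (auto simp: sym_ideal_def in_arity_def sym_relators_def)
    ultimately show ?thesis by (simp add: sym_ideal_closed)
  qed
  then show "monomial_map \<phi> \<epsilon> ` in_arity 2 (sym_relators T) m \<subseteq>
      ideal_gen (linearisation tree_operad) (in_arity 2 (sym_relators T')) m"
    by (auto simp: in_arity_def sym_ideal_def)
qed (use sym_relators_subset_ops in \<open>auto simp: in_arity_def\<close>)

lemma quotient_morphism_monomial_map:
  assumes "monomial_isomorphism T T' \<phi> \<epsilon>"
  shows "quotient_morphism (linearisation tree_operad) (sym_ideal T) (linearisation tree_operad) (sym_ideal T')
    (\<lambda>n. monomial_map \<phi> \<epsilon>)"
proof (intro quotient_morphism.intro quotient_morphism_axioms.intro operad_with_ideal_free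
    operad_morphism_monomial_map)
  show "monomial_map \<phi> \<epsilon> x \<in> sym_ideal T' n" if "x \<in> sym_ideal T n" for x n
    using monomial_map_sym_ideal[OF assms, of n] that by blast
qed

lemma monomial_map_inverse:
  assumes "inj \<phi>" "\<And>i. \<epsilon> i \<noteq> 0"
  shows "monomial_map (inv \<phi>) (\<lambda>j. inverse (\<epsilon> (inv \<phi> j))) (monomial_map \<phi> \<epsilon> x) = x"
proof -
  have "map_tree (inv \<phi>) (map_tree \<phi> t) = t" for t :: "'a tree"
    by (induction t) (auto simp: assms(1))
  moreover have "tree_weight \<epsilon> t * tree_weight (\<lambda>j. inverse (\<epsilon> (inv \<phi> j))) (map_tree \<phi> t) = 1" (is "_ * ?w t = 1")
    for t :: "'a tree"
  proof (induction t)
    case (Node i s t)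
    have "tree_weight \<epsilon> (Node i s t) * ?w (Node i s t) =
        (\<epsilon> i * inverse (\<epsilon> i)) * (tree_weight \<epsilon> s * ?w s) * (tree_weight \<epsilon> t * ?w t)"
      by (simp add: assms(1) ac_simps)
    then show ?case using Node assms(2) by simp
  qed simp
  ultimately show ?thesis
    by (induction x rule: pm_induct[OF subset_UNIV]) (auto simp: monomial_map_add mult.assoc)
qed

lemma inverse_morphisms_monomial_map:
  assumes "monomial_isomorphism T T' \<phi> \<epsilon>"
  shows "inverse_morphisms (linearisation tree_operad) (linearisation tree_operad)
    (\<lambda>n. monomial_map \<phi> \<epsilon>) (\<lambda>n. monomial_map (inv \<phi>) (\<lambda>j. inverse (\<epsilon> (inv \<phi> j))))"
proof -
  have b: "bij \<phi>" and n: "\<And>i. \<epsilon> i \<noteq> 0"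
    using assms by (auto simp: monomial_isomorphism_def)
  have "monomial_map \<phi> \<epsilon> (monomial_map (inv \<phi>) (\<lambda>j. inverse (\<epsilon> (inv \<phi> j))) y) = y" for y
    using monomial_map_inverse[of "inv \<phi>" "\<lambda>j. inverse (\<epsilon> (inv \<phi> j))" y] b n
    by (simp add: inv_inv_eq bij_is_inj bij_imp_bij_inv)
  then show ?thesis
    unfolding inverse_morphisms_def
    by (intro conjI allI ballI operad_morphism_monomial_map) (simp_all add: monomial_map_inverse[OF bij_is_inj[OF b]] n)
qed

section \<open>Transport of quadratic relations along a change of basis\<close>

definition arity3_push ::
    "('i \<Rightarrow> 'j) \<Rightarrow> ('i \<Rightarrow> 'k::field) \<Rightarrow> ('i \<times> 'i \<times> nat \<times> nat \<times> nat \<Rightarrow> 'k) \<Rightarrow>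
      ('j \<times> 'j \<times> nat \<times> nat \<times> nat \<Rightarrow> 'k)" where
  "arity3_push \<phi> \<epsilon> u = (\<lambda>(i, j, t). \<epsilon> (inv \<phi> i) * \<epsilon> (inv \<phi> j) * u (inv \<phi> i, inv \<phi> j, t))"

lemma bij_betw_arity3_index:
  assumes "bij \<phi>"
  shows "bij_betw (\<lambda>(i, j, t). (\<phi> i, \<phi> j, t)) arity3_index arity3_index"
  by (rule bij_betw_byWitness[where f' = "\<lambda>(i, j, t). (inv \<phi> i, inv \<phi> j, t)"])
     (use assms in \<open>auto simp: arity3_index_def bij_is_inj bij_is_surj surj_f_inv_f\<close>)

lemma monomial_map_arity3_sum:
  assumes "bij \<phi>"
  shows "monomial_map \<phi> \<epsilon> (arity3_sum u) = arity3_sum (arity3_push \<phi> \<epsilon> u)"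
proof -
  have "arity3_sum (arity3_push \<phi> \<epsilon> u) = (\<Sum>p\<in>arity3_index. (\<lambda>q. Poly_Mapping.single (tri q) (arity3_push \<phi> \<epsilon> u q))
      (case p of (i, j, t) \<Rightarrow> (\<phi> i, \<phi> j, t)))"
    unfolding arity3_sum_def
    by (rule sum.reindex_bij_betw[OF bij_betw_arity3_index[OF assms], symmetric])
  also have "\<dots> = monomial_map \<phi> \<epsilon> (arity3_sum u)"
    unfolding arity3_sum_def monomial_map_sum
    by (rule sum.cong) (use assms in \<open>auto simp: tri_def arity3_push_def bij_is_inj ac_simps\<close>)
  finally show ?thesis ..
qed

text \<open>Inverse morphisms of the free operads that carry the generating relations into each
  other carry the generated ideals into each other and descend to the quotients. The relations are
  given as images of sets of coordinates, so both inclusions become statements about coordinate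
  functions.\<close>

lemma operad_isomorphic_quadratic_operad:
  fixes Q :: "('i::finite, 'k::field) quadratic_data" and Q' :: "('j::finite, 'k) quadratic_data"
  assumes iso: "monomial_isomorphism (gens Q) (gens Q') \<phi> \<epsilon>"
    and rels: "rels Q = arity3_element (gens Q) ` V" "rels Q' = arity3_element (gens Q') ` V'"
    and V: "\<And>v. v \<in> V \<Longrightarrow> arity3_push \<phi> \<epsilon> v \<in> V'"
    and V': "\<And>v. v \<in> V' \<Longrightarrow> arity3_push (inv \<phi>) (\<lambda>j. inverse (\<epsilon> (inv \<phi> j))) v \<in> V"
  shows "operad_isomorphic (quadratic_operad Q) (quadratic_operad Q')"
proof -
  let ?L = "linearisation tree_operad :: ('k, 'i tree \<Rightarrow>\<^sub>0 'k) operad_struct"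
  let ?L' = "linearisation tree_operad :: ('k, 'j tree \<Rightarrow>\<^sub>0 'k) operad_struct"
  define f where "f = quot_map ?L' (sym_ideal (gens Q')) (\<lambda>n. monomial_map \<phi> \<epsilon>)"
  define g where "g = quot_map ?L (sym_ideal (gens Q)) (\<lambda>n. monomial_map (inv \<phi>) (\<lambda>j. inverse (\<epsilon> (inv \<phi> j))))"
  note iso' = monomial_isomorphism_inverse[OF iso]
  have b: "bij \<phi>" "bij (inv \<phi>)"
    using iso iso' by (auto simp: monomial_isomorphism_def)
  have fg: "inverse_morphisms (free_operad (gens Q)) (free_operad (gens Q')) f g"
    unfolding f_def g_def free_operad_def
    by (intro inverse_morphisms_quot operad_with_ideal_free inverse_morphisms_monomial_map[OF iso]
        monomial_map_sym_ideal[OF iso] monomial_map_sym_ideal[OF iso'])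
  have qm: "quotient_morphism ?L (sym_ideal (gens Q)) ?L' (sym_ideal (gens Q')) (\<lambda>n. monomial_map \<phi> \<epsilon>)"
      "quotient_morphism ?L' (sym_ideal (gens Q')) ?L (sym_ideal (gens Q))
        (\<lambda>n. monomial_map (inv \<phi>) (\<lambda>j. inverse (\<epsilon> (inv \<phi> j))))"
    by (rule quotient_morphism_monomial_map[OF iso] quotient_morphism_monomial_map[OF iso'])+
  have "f 3 (arity3_element (gens Q) u) = arity3_element (gens Q') (arity3_push \<phi> \<epsilon> u)" for u
    using quotient_morphism.quot_map_coset[OF qm(1) arity3_sum_ops]
    by (simp add: f_def arity3_element_eq free_class_def monomial_map_arity3_sum[OF b(1)])
  then have f_rels: "f 3 ` rels Q \<subseteq> rels Q'" using rels V by auto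
  have "g 3 (arity3_element (gens Q') u) =
      arity3_element (gens Q) (arity3_push (inv \<phi>) (\<lambda>j. inverse (\<epsilon> (inv \<phi> j))) u)" for u
    using quotient_morphism.quot_map_coset[OF qm(2) arity3_sum_ops]
    by (simp add: g_def arity3_element_eq free_class_def monomial_map_arity3_sum[OF b(2)])
  then have g_rels: "g 3 ` rels Q' \<subseteq> rels Q" using rels V' by auto
  have R: "in_arity 3 (rels Q) n \<subseteq> ops (free_operad (gens Q)) n" for n
    using rels(1) arity3_sum_ops by (auto simp: in_arity_def ops_free_operad arity3_element_eq)
  have R': "in_arity 3 (rels Q') n \<subseteq> ops (free_operad (gens Q')) n" for n
    using rels(2) arity3_sum_ops by (auto simp: in_arity_def ops_free_operad arity3_element_eq)
  have fm: "operad_morphism (free_operad (gens Q)) (free_operad (gens Q')) f"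
    and gm: "operad_morphism (free_operad (gens Q')) (free_operad (gens Q)) g"
    using fg by (auto simp: inverse_morphisms_def)
  have f_in: "f m ` in_arity 3 (rels Q) m \<subseteq> ideal_gen (free_operad (gens Q')) (in_arity 3 (rels Q')) m" for m
    using f_rels ideal_gen_superset[of "in_arity 3 (rels Q')" m "free_operad (gens Q')"]
    by (cases "m = 3") (auto simp: in_arity_def)
  have g_in: "g m ` in_arity 3 (rels Q') m \<subseteq> ideal_gen (free_operad (gens Q)) (in_arity 3 (rels Q)) m" for m
    using g_rels ideal_gen_superset[of "in_arity 3 (rels Q)" m "free_operad (gens Q)"]
    by (cases "m = 3") (auto simp: in_arity_def)
  have q: "operad_with_ideal (free_operad (gens Q)) (ideal_gen (free_operad (gens Q)) (in_arity 3 (rels Q)))"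
      "operad_with_ideal (free_operad (gens Q')) (ideal_gen (free_operad (gens Q')) (in_arity 3 (rels Q')))"
    by (intro operad_with_ideal.intro operad_with_ideal_axioms.intro operad_free_operad
        operad.operad_ideal_ideal_gen[OF operad_free_operad] R R')+
  show ?thesis
    unfolding quadratic_operad_def
    by (rule operad_isomorphic_inverse_morphisms[OF _ _ inverse_morphisms_quot[OF q fg
          ideal_gen_image[OF operad_free_operad operad_free_operad fm R R' f_in]
          ideal_gen_image[OF operad_free_operad operad_free_operad gm R' R g_in]]])
       (intro operad_with_ideal.operad_quot q)+
qed


section \<open>The morphism into the tensor product\<close>

lemma operad_morphism_lin_map:
  fixes S :: "'a set_operad_struct" and S' :: "'b set_operad_struct"
  assumes "\<And>n t. t \<in> set_ops S n \<Longrightarrow> \<theta> n t \<in> set_ops S' n"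
    and "\<And>n t s. \<lbrakk>t \<in> set_ops S n; s permutes {1..n}\<rbrakk> \<Longrightarrow> \<theta> n (set_sact S n t s) = set_sact S' n (\<theta> n t) s"
    and "\<And>m n i s t. \<lbrakk>i \<in> {1..m}; s \<in> set_ops S m; t \<in> set_ops S n\<rbrakk> \<Longrightarrow>
      \<theta> (m + n - 1) (set_pcomp S m n i s t) = set_pcomp S' m n i (\<theta> m s) (\<theta> n t)"
    and "\<theta> 1 (set_unit S) = set_unit S'"
  shows "operad_morphism (linearisation S :: ('k::field, 'a \<Rightarrow>\<^sub>0 'k) operad_struct) (linearisation S')
    (\<lambda>n. lin_map (\<theta> n))"
proof -
  have act: "lin_map (\<theta> n) (lin_map (\<lambda>a. set_sact S n a s) x) = lin_map (\<lambda>a. set_sact S' n a s) (lin_map (\<theta> n) x)"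
    if "Poly_Mapping.keys x \<subseteq> set_ops S n" "s permutes {1..n}" for n s and x :: "'a \<Rightarrow>\<^sub>0 'k"
    using that(1) by (induction x rule: pm_induct) (auto simp: lin_map_add assms(2)[OF _ that(2)])
  have comp: "lin_map (\<theta> (m + n - 1)) (lin_map2 (set_pcomp S m n i) x y) =
      lin_map2 (set_pcomp S' m n i) (lin_map (\<theta> m) x) (lin_map (\<theta> n) y)"
    if "i \<in> {1..m}" "Poly_Mapping.keys x \<subseteq> set_ops S m" "Poly_Mapping.keys y \<subseteq> set_ops S n"
    for m n i and x y :: "'a \<Rightarrow>\<^sub>0 'k"
    using that(2)
  proof (induction x rule: pm_induct)
    case (single s c)
    show ?case using that(3)
      by (induction y rule: pm_induct)
         (use single in \<open>auto simp: lin_map_add lin_map2_add_right assms(3)[OF that(1)] simp del: One_nat_def\<close>)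
  qed (auto simp: lin_map2_add_left lin_map_add)
  have closed: "Poly_Mapping.keys (lin_map (\<theta> n) x) \<subseteq> set_ops S' n"
    if "Poly_Mapping.keys x \<subseteq> set_ops S n" for n and x :: "'a \<Rightarrow>\<^sub>0 'k"
    using keys_lin_map[of "\<theta> n" x] that assms(1) by blast
  show ?thesis
    unfolding operad_morphism_def linearisation_simps mem_Collect_eq
    using closed act comp by (simp add: lin_map_add lin_map_scale assms(4) del: One_nat_def)
qed

section \<open>Subspaces of formal combinations, linearity modulo a subspace, and
  projections\<close>

definition pm_subspace :: "('a \<Rightarrow>\<^sub>0 'k::field) set \<Rightarrow> bool" where
  "pm_subspace Z \<longleftrightarrow> 0 \<in> Z \<and> (\<forall>x\<in>Z. \<forall>y\<in>Z. x + y \<in> Z) \<and> (\<forall>c. \<forall>x\<in>Z. pm_scale c x \<in> Z)"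

lemma pm_subspaceD:
  assumes "pm_subspace Z"
  shows "0 \<in> Z" "\<lbrakk>x \<in> Z; y \<in> Z\<rbrakk> \<Longrightarrow> x + y \<in> Z" "x \<in> Z \<Longrightarrow> pm_scale c x \<in> Z"
    "\<lbrakk>x \<in> Z; y \<in> Z\<rbrakk> \<Longrightarrow> x - y \<in> Z" "(\<And>a. a \<in> A \<Longrightarrow> f a \<in> Z) \<Longrightarrow> (\<Sum>a\<in>A. f a) \<in> Z"
proof -
  show cl: "0 \<in> Z" "\<And>x y. \<lbrakk>x \<in> Z; y \<in> Z\<rbrakk> \<Longrightarrow> x + y \<in> Z" "\<And>x c. x \<in> Z \<Longrightarrow> pm_scale c x \<in> Z"
    using assms by (auto simp: pm_subspace_def)
  show "x - y \<in> Z" if "x \<in> Z" "y \<in> Z"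
    using cl(2)[of x "pm_scale (- 1) y"] cl(3)[of y "- 1"] that by (simp add: pm_scale_minus_one)
  show "(\<And>a. a \<in> A \<Longrightarrow> f a \<in> Z) \<Longrightarrow> (\<Sum>a\<in>A. f a) \<in> Z"
    by (induction A rule: infinite_finite_induct) (auto intro: cl)
qed

text \<open>Meant for \<open>formal_tensor\<close>: a pair of classes is a basis vector of the
  formal space, so the tensor of a sum equals the sum of the tensors only modulo the bilinearity
  ideal.\<close>

lemma linear_mod_sum:
  assumes Z: "pm_subspace Z" and X: "pm_subspace X"
    and add: "\<And>x y. \<lbrakk>x \<in> X; y \<in> X\<rbrakk> \<Longrightarrow> b (x + y) - b x - b y \<in> Z"
    and scale: "\<And>c x. x \<in> X \<Longrightarrow> b (pm_scale c x) - pm_scale c (b x) \<in> Z"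
    and A: "finite A" "\<And>a. a \<in> A \<Longrightarrow> x a \<in> X"
  shows "b (\<Sum>a\<in>A. pm_scale (f a) (x a)) - (\<Sum>a\<in>A. pm_scale (f a) (b (x a))) \<in> Z"
  using A
proof (induction A)
  case empty
  have "b (pm_scale 0 0) - pm_scale 0 (b 0) \<in> Z" using pm_subspaceD(1)[OF X] by (rule scale)
  moreover have "pm_scale 0 (b 0) = 0" by (rule poly_mapping_eqI) simp
  ultimately show ?case by simp
next
  case (insert a A)
  let ?s = "\<Sum>a\<in>A. pm_scale (f a) (x a)" and ?t = "\<Sum>a\<in>A. pm_scale (f a) (b (x a))"
  have "?s \<in> X" "pm_scale (f a) (x a) \<in> X"
    using insert.prems by (auto intro!: pm_subspaceD[OF X])
  then have "b (pm_scale (f a) (x a) + ?s) - b (pm_scale (f a) (x a)) - b ?s \<in> Z"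
    by (intro add)
  moreover have "b (pm_scale (f a) (x a)) - pm_scale (f a) (b (x a)) \<in> Z"
    using insert.prems by (intro scale) auto
  moreover have "b ?s - ?t \<in> Z" using insert by auto
  ultimately have "(b (pm_scale (f a) (x a) + ?s) - b (pm_scale (f a) (x a)) - b ?s) +
      (b (pm_scale (f a) (x a)) - pm_scale (f a) (b (x a))) + (b ?s - ?t) \<in> Z"
    by (intro pm_subspaceD(2)[OF Z])
  then show ?case using insert.hyps by (simp add: algebra_simps)
qed

text \<open>A basis \<open>B\<close> of \<open>U\<close> is extended to the whole space;
  \<open>f\<close> kills \<open>B\<close> and fixes the other basis vectors.\<close>

lemma pm_subspace_projection:
  fixes U :: "('a \<Rightarrow>\<^sub>0 'k::field) set"
  assumes U: "pm_subspace U"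
  obtains f :: "('a \<Rightarrow>\<^sub>0 'k) \<Rightarrow> ('a \<Rightarrow>\<^sub>0 'k)"
  where "\<And>x y. f (x + y) = f x + f y" "\<And>c x. f (pm_scale c x) = pm_scale c (f x)"
    "\<And>x. x \<in> U \<Longrightarrow> f x = 0" "\<And>x. x - f x \<in> U"
proof -
  interpret vs: vector_space "pm_scale :: 'k \<Rightarrow> ('a \<Rightarrow>\<^sub>0 'k) \<Rightarrow> ('a \<Rightarrow>\<^sub>0 'k)"
    by unfold_locales (simp_all add: pm_scale_add pm_scale_add_left pm_scale_scale)
  interpret vp: vector_space_pair "pm_scale :: 'k \<Rightarrow> ('a \<Rightarrow>\<^sub>0 'k) \<Rightarrow> _" "pm_scale :: 'k \<Rightarrow> ('a \<Rightarrow>\<^sub>0 'k) \<Rightarrow> _"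
    by unfold_locales
  have subU: "vs.subspace U"
    unfolding vs.subspace_def using pm_subspaceD[OF U] by blast
  obtain B where B: "B \<subseteq> U" "vs.independent B" "U \<subseteq> vs.span B"
    by (rule vs.maximal_independent_subset)
  let ?E = "vs.extend_basis B"
  have E: "B \<subseteq> ?E" "vs.independent ?E" "vs.span ?E = UNIV"
    using B(2) vs.extend_basis_superset vs.independent_extend_basis vs.span_extend_basis by auto
  obtain f where f: "Vector_Spaces.linear pm_scale pm_scale f" "\<forall>b\<in>?E. f b = (if b \<in> B then 0 else b)"
    using vp.linear_independent_extend[OF E(2), of "\<lambda>b. if b \<in> B then 0 else b"] by blast
  interpret f: Vector_Spaces.linear pm_scale pm_scale f by (rule f(1))
  have "x - f x \<in> U" for x
  proof -
    have "x \<in> vs.span ?E" using E(3) by simp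
    then show ?thesis
    proof (induction rule: vs.span_induct_alt)
      case base
      then show ?case using pm_subspaceD(1)[OF U] by simp
    next
      case (step c b y)
      have "b - f b \<in> U" using f(2) step(1) B(1) pm_subspaceD(1)[OF U] by auto
      then have "pm_scale c (b - f b) + (y - f y) \<in> U"
        using step by (intro pm_subspaceD(2,3)[OF U])
      then show ?case by (simp add: f.add f.scale vs.scale_right_diff_distrib algebra_simps)
    qed
  qed
  moreover have "f x = 0" if "x \<in> U" for x
  proof (rule f.eq_0_on_span)
    show "x \<in> vs.span B" using B(3) that by blast
  qed (use f(2) E(1) in auto)
  ultimately show ?thesis using that[of f] f.add f.scale by blast
qed

text \<open>The last closure condition allows a coordinate function, which may have infinite
  support, to be replaced by its restriction to the finite index set.\<close>

definition coord_subspace :: "('i::finite \<times> 'i \<times> nat \<times> nat \<times> nat \<Rightarrow> 'k::field) set \<Rightarrow> bool" where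
  "coord_subspace U \<longleftrightarrow> (\<lambda>p. 0) \<in> U \<and> (\<forall>u\<in>U. \<forall>v\<in>U. (\<lambda>p. u p + v p) \<in> U) \<and>
     (\<forall>c. \<forall>u\<in>U. (\<lambda>p. c * u p) \<in> U) \<and> (\<forall>u\<in>U. \<forall>v. (\<forall>p\<in>arity3_index. u p = v p) \<longrightarrow> v \<in> U)"

lemma coord_subspace_cong:
  "\<lbrakk>coord_subspace U; u \<in> U; \<And>p. p \<in> arity3_index \<Longrightarrow> u p = v p\<rbrakk> \<Longrightarrow> v \<in> U"
  unfolding coord_subspace_def by blast

lemma coord_subspace_perp: "coord_subspace (arity3_perp U)"
  by (auto simp: coord_subspace_def arity3_perp_def arity3_pairing_eq distrib_left sum.distrib
      mult.left_commute[of _ "_ :: 'b"] simp flip: sum_distrib_left)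

text \<open>\<open>N\<close> is the matrix of a projection with kernel \<open>U\<close>. Row
  \<open>p\<close> is the image of the \<open>p\<close>-th basis vector and differs from it by an
  element of \<open>U\<close>; column \<open>q\<close> is the \<open>q\<close>-th coordinate of the
  projection, a functional that kills \<open>U\<close>. Thus the orthogonal is supplied with enough
  elements to recover every basis vector modulo \<open>U\<close>.\<close>

lemma coord_subspace_projection:
  fixes U :: "('i::finite \<times> 'i \<times> nat \<times> nat \<times> nat \<Rightarrow> 'k::field) set"
  assumes U: "coord_subspace U"
  obtains N where "\<And>q. (\<lambda>p. N p q) \<in> arity3_perp U"
    "\<And>p. p \<in> arity3_index \<Longrightarrow> (\<lambda>q. (if q = p then 1 else 0) - N p q) \<in> U"
proof -
  have "pm_subspace {x. Poly_Mapping.lookup x \<in> U}"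
    using U by (auto simp: pm_subspace_def coord_subspace_def zero_poly_mapping.rep_eq
        plus_poly_mapping.rep_eq lookup_pm_scale[abs_def])
  then obtain f :: "_ \<Rightarrow> _ \<Rightarrow>\<^sub>0 'k" where f: "\<And>x y. f (x + y) = f x + f y" "\<And>c x. f (pm_scale c x) = pm_scale c (f x)"
      "\<And>x. x \<in> {x. Poly_Mapping.lookup x \<in> U} \<Longrightarrow> f x = 0"
      "\<And>x. x - f x \<in> {x. Poly_Mapping.lookup x \<in> U}"
    by (rule pm_subspace_projection) blast
  define N where "N p q = Poly_Mapping.lookup (f (Poly_Mapping.single p 1)) q" for p q
  show ?thesis
  proof
    fix q
    have "arity3_pairing u (\<lambda>p. N p q) = 0" if u: "u \<in> U" for u
    proof -
      \<comment> \<open>The truncation of \<open>u\<close> to the index set: a formal combination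
        needs finite support, and the truncation still lies in \<open>U\<close>.\<close>
      let ?x = "\<Sum>p\<in>arity3_index. Poly_Mapping.single p (u p)"
      have "Poly_Mapping.lookup ?x p = u p" if "p \<in> arity3_index" for p
        using that by (simp add: lookup_sum lookup_single when_def)
      then have "Poly_Mapping.lookup ?x \<in> U" by (intro coord_subspace_cong[OF U u]) simp
      then have "f ?x = 0" using f(3) by blast
      moreover have f0: "f 0 = 0" using f(1)[of 0 0] by simp
      have "f (\<Sum>p\<in>A. g p) = (\<Sum>p\<in>A. f (g p))" for g and A :: "('i \<times> 'i \<times> nat \<times> nat \<times> nat) set"
        by (induction A rule: infinite_finite_induct) (auto simp: f(1) f0)
      then have "f ?x = (\<Sum>p\<in>arity3_index. f (pm_scale (u p) (Poly_Mapping.single p 1)))" by simp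
      ultimately have "(\<Sum>p\<in>arity3_index. pm_scale (u p) (f (Poly_Mapping.single p 1))) = 0"
        by (simp only: f(2))
      then have "Poly_Mapping.lookup (\<Sum>p\<in>arity3_index. pm_scale (u p) (f (Poly_Mapping.single p 1))) q = 0"
        by simp
      then show ?thesis by (simp add: arity3_pairing_eq N_def lookup_sum)
    qed
    then show "(\<lambda>p. N p q) \<in> arity3_perp U" by (simp add: arity3_perp_def)
  next
    fix p :: "'i \<times> 'i \<times> nat \<times> nat \<times> nat" assume "p \<in> arity3_index"
    have "Poly_Mapping.lookup (Poly_Mapping.single p 1 - f (Poly_Mapping.single p 1)) \<in> U"
      using f(4) by blast
    moreover have "Poly_Mapping.lookup (Poly_Mapping.single p 1 - f (Poly_Mapping.single p 1)) =
        (\<lambda>q. (if q = p then 1 else 0) - N p q)"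
      by (rule ext) (simp add: lookup_minus lookup_single when_def N_def eq_commute)
    ultimately show "(\<lambda>q. (if q = p then 1 else 0) - N p q) \<in> U" by simp
  qed
qed


section \<open>The Manin morphism on trees and its determination in arity 3\<close>

definition formal_tensor ::
    "('i::finite, 'k::field) S2_module \<Rightarrow> ('j::finite, 'k) S2_module \<Rightarrow> nat \<Rightarrow>
      ('i tree \<Rightarrow>\<^sub>0 'k) \<Rightarrow> ('j tree \<Rightarrow>\<^sub>0 'k) \<Rightarrow> (('i tree \<Rightarrow>\<^sub>0 'k) set \<times> ('j tree \<Rightarrow>\<^sub>0 'k) set \<Rightarrow>\<^sub>0 'k)" where
  "formal_tensor T1 T2 n x y = Poly_Mapping.single (free_class T1 n x, free_class T2 n y) 1"

text \<open>A tree labelled by pairs goes to two trees of the same shape and leaves. The value is a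
  pair in the formal space, before the quotient by bilinearity.\<close>

definition tree_tensor ::
    "('i::finite, 'k::field) S2_module \<Rightarrow> ('j::finite, 'k) S2_module \<Rightarrow> nat \<Rightarrow>
      ('i \<times> 'j) tree \<Rightarrow> ('i tree \<Rightarrow>\<^sub>0 'k) set \<times> ('j tree \<Rightarrow>\<^sub>0 'k) set" where
  "tree_tensor T1 T2 n t = (free_class T1 n (mono (map_tree fst t)), free_class T2 n (mono (map_tree snd t)))"

lemma pm_subspace_ops: "pm_subspace (ops (linearisation S) n)"
  using linearisation_ops_add[of _ S n] linearisation_ops_scale[of _ S n]
  by (auto simp: pm_subspace_def) (simp add: linearisation_simps)

lemma pm_subspace_ideal: "operad_ideal (linearisation S) I \<Longrightarrow> pm_subspace (I n)"
  using linearisation_ideal_closed(1,2,3)[of S I] unfolding pm_subspace_def by blast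

context
  fixes T1 :: "('i::finite, 'k::field) S2_module" and T2 :: "('j::finite, 'k) S2_module"
begin

private abbreviation (input) "F1 \<equiv> free_operad T1"
private abbreviation (input) "F2 \<equiv> free_operad T2"
private abbreviation (input) "LP \<equiv> linearisation (pair_operad F1 F2) :: ('k, _) operad_struct"
private abbreviation (input) "B \<equiv> bilinearity_ideal F1 F2"
private abbreviation (input) "L1 \<equiv> linearisation tree_operad :: ('k, 'i tree \<Rightarrow>\<^sub>0 'k) operad_struct"
private abbreviation (input) "L2 \<equiv> linearisation tree_operad :: ('k, 'j tree \<Rightarrow>\<^sub>0 'k) operad_struct"
private abbreviation (input) "L12 \<equiv> linearisation tree_operad :: ('k, ('i \<times> 'j) tree \<Rightarrow>\<^sub>0 'k) operad_struct"

lemma operad_ideal_B: "operad_ideal LP B"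
  by (intro operad_ideal_bilinearity_ideal operad_free_operad)

lemma operad_LP: "operad LP"
  by (intro operad_linearisation set_operad_pair_operad operad_free_operad)

lemma operad_with_ideal_B: "operad_with_ideal LP B"
  by (intro operad_with_ideal.intro operad_with_ideal_axioms.intro operad_LP operad_ideal_B)

lemma pm_subspace_B: "pm_subspace (B n)"
  by (rule pm_subspace_ideal[OF operad_ideal_B])

lemma formal_tensor_bilinear:
  assumes "x \<in> ops L1 n" "x' \<in> ops L1 n" "y \<in> ops L2 n" "y' \<in> ops L2 n"
  shows "formal_tensor T1 T2 n (x + x') y - formal_tensor T1 T2 n x y - formal_tensor T1 T2 n x' y \<in> B n"
    and "formal_tensor T1 T2 n x (y + y') - formal_tensor T1 T2 n x y - formal_tensor T1 T2 n x y' \<in> B n"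
    and "formal_tensor T1 T2 n (pm_scale c x) y - pm_scale c (formal_tensor T1 T2 n x y) \<in> B n"
    and "formal_tensor T1 T2 n x (pm_scale c y) - pm_scale c (formal_tensor T1 T2 n x y) \<in> B n"
proof -
  have rel: "bilinearity_relators F1 F2 n \<subseteq> B n"
    unfolding bilinearity_ideal_def by (rule span_of_superset)
  have mem: "free_class T1 n x \<in> ops F1 n" "free_class T1 n x' \<in> ops F1 n"
      "free_class T2 n y \<in> ops F2 n" "free_class T2 n y' \<in> ops F2 n"
    using assms by (simp_all add: ops_free_operad)
  show "formal_tensor T1 T2 n (x + x') y - formal_tensor T1 T2 n x y - formal_tensor T1 T2 n x' y \<in> B n"
    unfolding formal_tensor_def vadd_free_class[OF assms(1,2), symmetric]
    by (rule subsetD[OF rel]) (unfold bilinearity_relators_def, use mem in blast)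
  show "formal_tensor T1 T2 n x (y + y') - formal_tensor T1 T2 n x y - formal_tensor T1 T2 n x y' \<in> B n"
    unfolding formal_tensor_def vadd_free_class[OF assms(3,4), symmetric]
    by (rule subsetD[OF rel]) (unfold bilinearity_relators_def, use mem in blast)
  show "formal_tensor T1 T2 n (pm_scale c x) y - pm_scale c (formal_tensor T1 T2 n x y) \<in> B n"
    unfolding formal_tensor_def vscale_free_class[OF assms(1), symmetric] pm_scale_single mult_1_right
    by (rule subsetD[OF rel]) (unfold bilinearity_relators_def, use mem in blast)
  show "formal_tensor T1 T2 n x (pm_scale c y) - pm_scale c (formal_tensor T1 T2 n x y) \<in> B n"
    unfolding formal_tensor_def vscale_free_class[OF assms(3), symmetric] pm_scale_single mult_1_right
    by (rule subsetD[OF rel]) (unfold bilinearity_relators_def, use mem in blast)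
qed

lemma formal_tensor_sum:
  assumes "finite A" "\<And>a. a \<in> A \<Longrightarrow> x a \<in> ops L1 n" "finite A'" "\<And>a. a \<in> A' \<Longrightarrow> y a \<in> ops L2 n"
  shows "formal_tensor T1 T2 n (\<Sum>a\<in>A. pm_scale (f a) (x a)) (\<Sum>b\<in>A'. pm_scale (g b) (y b)) -
    (\<Sum>a\<in>A. \<Sum>b\<in>A'. pm_scale (f a * g b) (formal_tensor T1 T2 n (x a) (y b))) \<in> B n"
proof -
  let ?t = "formal_tensor T1 T2 n"
  let ?x = "\<Sum>a\<in>A. pm_scale (f a) (x a)" and ?y = "\<Sum>b\<in>A'. pm_scale (g b) (y b)"
  have y: "?y \<in> ops L2 n"
    using assms(3,4) by (auto intro!: pm_subspaceD[OF pm_subspace_ops])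
  have "?t ?x ?y - (\<Sum>a\<in>A. pm_scale (f a) (?t (x a) ?y)) \<in> B n"
    using assms(1,2) y
    by (intro linear_mod_sum[OF pm_subspace_B pm_subspace_ops, where b = "\<lambda>x. ?t x ?y"]
        formal_tensor_bilinear(1,3)) auto
  moreover have "(\<Sum>a\<in>A. pm_scale (f a) (?t (x a) ?y - (\<Sum>b\<in>A'. pm_scale (g b) (?t (x a) (y b))))) \<in> B n"
    using assms
    by (intro pm_subspaceD(5,3)[OF pm_subspace_B] linear_mod_sum[OF pm_subspace_B pm_subspace_ops]
        formal_tensor_bilinear(2,4)) auto
  moreover have "pm_scale c (u - v) = pm_scale c u - pm_scale c v"
    for c and u v :: "('i tree \<Rightarrow>\<^sub>0 'k) set \<times> ('j tree \<Rightarrow>\<^sub>0 'k) set \<Rightarrow>\<^sub>0 'k"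
    by (rule poly_mapping_eqI) (simp add: lookup_minus algebra_simps)
  ultimately have "(?t ?x ?y - (\<Sum>a\<in>A. pm_scale (f a) (?t (x a) ?y))) +
      (\<Sum>a\<in>A. pm_scale (f a) (?t (x a) ?y) - (\<Sum>b\<in>A'. pm_scale (f a * g b) (?t (x a) (y b)))) \<in> B n"
    by (intro pm_subspaceD(2)[OF pm_subspace_B]) (simp_all add: pm_scale_sum pm_scale_scale)
  then show ?thesis by (simp add: sum_subtractf)
qed

lemma tree_tensor_eq: "Poly_Mapping.single (tree_tensor T1 T2 n t) c =
    pm_scale c (formal_tensor T1 T2 n (mono (map_tree fst t)) (mono (map_tree snd t)))"
  by (simp add: tree_tensor_def formal_tensor_def)

lemma mono_map_tree_ops:
  "t \<in> set_ops tree_operad n \<Longrightarrow> mono (map_tree \<phi> t) \<in> ops (linearisation tree_operad) n"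
  by (intro linearisation_ops_single) (simp add: map_tree_set_ops)

lemma ounit_free_operad: "ounit (free_operad T) = free_class T 1 (mono (Leaf 1))"
  by (simp add: free_operad_def quot_operad_def free_class_def linearisation_simps tree_operad_simps)

lemma operad_morphism_tree_tensor: "operad_morphism L12 LP (\<lambda>n. lin_map (tree_tensor T1 T2 n))"
proof (rule operad_morphism_lin_map)
  fix n and t :: "('i \<times> 'j) tree" assume t: "t \<in> set_ops tree_operad n"
  then show "tree_tensor T1 T2 n t \<in> set_ops (pair_operad F1 F2) n"
    by (simp add: pair_operad_simps tree_tensor_def ops_free_operad mono_map_tree_ops)
  fix s assume "s permutes {1..n}"
  then show "tree_tensor T1 T2 n (set_sact tree_operad n t s) = set_sact (pair_operad F1 F2) n (tree_tensor T1 T2 n t) s"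
    using t by (simp add: pair_operad_simps tree_tensor_def mono_map_tree_ops sact_free_class
        map_tree_relabel tree_operad_simps(2))
next
  fix m n i and s t :: "('i \<times> 'j) tree"
  assume "i \<in> {1..m}" "s \<in> set_ops tree_operad m" "t \<in> set_ops tree_operad n"
  then show "tree_tensor T1 T2 (m + n - 1) (set_pcomp tree_operad m n i s t) =
      set_pcomp (pair_operad F1 F2) m n i (tree_tensor T1 T2 m s) (tree_tensor T1 T2 n t)"
    by (simp add: pair_operad_simps tree_tensor_def mono_map_tree_ops pcomp_free_class
        map_tree_set_pcomp del: atLeastAtMost_iff One_nat_def)
next
  show "tree_tensor T1 T2 1 (set_unit tree_operad) = set_unit (pair_operad F1 F2)"
    by (simp add: pair_operad_simps tree_tensor_def tree_operad_simps(4) ounit_free_operad)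
qed

lemma free_class_swap:
  "free_class T 2 (mono (Node i (Leaf 2) (Leaf 1))) =
    free_class T 2 (\<Sum>k\<in>UNIV. pm_scale (T i k) (mono (Node k (Leaf 1) (Leaf 2))))"
proof -
  have two: "{1..2} = {1, 2::nat}" by auto
  have "mono (Node i (Leaf 2) (Leaf 1)) -
      (\<Sum>k\<in>UNIV. pm_scale (T i k) (mono (Node k (Leaf 1) (Leaf 2)))) \<in> sym_ideal T 2"
    using ideal_gen_superset[of "in_arity 2 (sym_relators T)" 2 "linearisation tree_operad"]
    by (auto simp: sym_ideal_def in_arity_def sym_relators_def)
  then show ?thesis
    by (subst free_class_eq_iff)
       (auto intro!: linearisation_ops_sum linearisation_ops_single simp: tree_operad_simps two)
qed

text \<open>Swapping the inputs swaps them in both factors, and the tensor of the two resulting sums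
  expands, modulo bilinearity, with the coefficients \<open>T1 i k * T2 j l\<close> of the diagonal
  action.\<close>

lemma tree_tensor_sym_ideal:
  "lin_map (tree_tensor T1 T2 n) ` sym_ideal (tensor_module T1 T2) n \<subseteq> B n"
proof -
  have two: "{1..2} = {1, 2::nat}" by auto
  have gen_ops: "mono (Node k (Leaf 1) (Leaf 2)) \<in> ops (linearisation tree_operad) 2" for k
    by (intro linearisation_ops_single) (unfold tree_operad_simps two, simp)
  have "lin_map (tree_tensor T1 T2 2) r \<in> B 2" if r: "r \<in> sym_relators (tensor_module T1 T2)" for r
  proof -
    obtain i j where ij: "r = mono (Node (i, j) (Leaf 2) (Leaf 1)) -
        (\<Sum>q\<in>UNIV. Poly_Mapping.single (Node q (Leaf 1) (Leaf 2)) (tensor_module T1 T2 (i, j) q))"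
      using r by (auto simp: sym_relators_def)
    have "lin_map (tree_tensor T1 T2 2) r =
        formal_tensor T1 T2 2 (mono (Node i (Leaf 2) (Leaf 1))) (mono (Node j (Leaf 2) (Leaf 1))) -
        (\<Sum>q\<in>UNIV \<times> UNIV. pm_scale (T1 i (fst q) * T2 j (snd q)) (formal_tensor T1 T2 2
          (mono (Node (fst q) (Leaf 1) (Leaf 2))) (mono (Node (snd q) (Leaf 1) (Leaf 2)))))"
      by (simp add: ij lin_map_diff lin_map_sum tree_tensor_eq tensor_module_def case_prod_beta
          del: pm_scale_single)
    also have "\<dots> = formal_tensor T1 T2 2 (\<Sum>k\<in>UNIV. pm_scale (T1 i k) (mono (Node k (Leaf 1) (Leaf 2))))
          (\<Sum>l\<in>UNIV. pm_scale (T2 j l) (mono (Node l (Leaf 1) (Leaf 2)))) -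
        (\<Sum>k\<in>UNIV. \<Sum>l\<in>UNIV. pm_scale (T1 i k * T2 j l) (formal_tensor T1 T2 2
          (mono (Node k (Leaf 1) (Leaf 2))) (mono (Node l (Leaf 1) (Leaf 2)))))"
      by (simp only: formal_tensor_def free_class_swap sum.cartesian_product' fst_conv snd_conv)
    also have "\<dots> \<in> B 2" by (intro formal_tensor_sum gen_ops) auto
    finally show ?thesis .
  qed
  then have "in_arity 2 (sym_relators (tensor_module T1 T2)) m \<subseteq>
      {x \<in> ops L12 m. lin_map (tree_tensor T1 T2 m) x \<in> B m}" for m
    using sym_relators_subset_ops by (auto simp: in_arity_def)
  then show ?thesis
    using ideal_gen_minimal[OF operad_ideal_preimage[OF operad_trees operad_LP operad_morphism_tree_tensor
          operad_ideal_B], of "in_arity 2 (sym_relators (tensor_module T1 T2))" n]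
    by (fastforce simp: sym_ideal_def)
qed

lemma quotient_morphism_tree_tensor:
  "quotient_morphism L12 (sym_ideal (tensor_module T1 T2)) LP B (\<lambda>n. lin_map (tree_tensor T1 T2 n))"
proof (intro quotient_morphism.intro quotient_morphism_axioms.intro operad_with_ideal_free
    operad_with_ideal_B operad_morphism_tree_tensor)
  show "lin_map (tree_tensor T1 T2 n) x \<in> B n" if "x \<in> sym_ideal (tensor_module T1 T2) n" for x n
    using tree_tensor_sym_ideal[of n] that by blast
qed

text \<open>The explicit morphism \<Phi> shows that the choice in \<open>manin_morphism\<close>
  succeeds. The chosen morphism agrees with \<Phi> on generators, hence on each basis tree, which is
  a relabelled composite at input 1 of two generators, and then on all of arity 3 by
  linearity.\<close>

lemma manin_morphism_arity3_element:
  "manin_morphism T1 T2 3 (arity3_element (tensor_module T1 T2) u) =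
    coset LP B 3 (lin_map (tree_tensor T1 T2 3) (arity3_sum u))"
proof -
  let ?T = "tensor_module T1 T2"
  let ?gen = "\<lambda>i j f. f 2 (free_gen ?T (i, j)) = pure_tensor F1 F2 2 (free_gen T1 i) (free_gen T2 j)"
  define \<Phi> where "\<Phi> = quot_map LP B (\<lambda>n. lin_map (tree_tensor T1 T2 n))"
  have two: "{1..2} = {1, 2::nat}" by auto
  have gen_ops: "mono (Node k (Leaf 1) (Leaf 2)) \<in> ops (linearisation tree_operad) 2" for k
    by (intro linearisation_ops_single) (unfold tree_operad_simps two, simp)
  have \<Phi>_class: "\<Phi> n (free_class ?T n x) = coset LP B n (lin_map (tree_tensor T1 T2 n) x)"
    if "x \<in> ops L12 n" for n x
    unfolding \<Phi>_def free_class_def by (rule quotient_morphism.quot_map_coset[OF quotient_morphism_tree_tensor that])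
  have \<Phi>: "operad_morphism (free_operad ?T) (tensor_operad F1 F2) \<Phi>"
    unfolding \<Phi>_def free_operad_def[of ?T] tensor_operad_def
    by (rule quotient_morphism.operad_morphism_quot_map[OF quotient_morphism_tree_tensor])
  have \<Phi>_gen: "?gen i j \<Phi>" for i j
    unfolding free_gen_def \<Phi>_class[OF gen_ops] pure_tensor_def by (simp add: tree_tensor_def)
  define M where "M = manin_morphism T1 T2"
  have "operad_morphism (free_operad ?T) (tensor_operad F1 F2) M \<and> (\<forall>i j. ?gen i j M)"
    unfolding M_def manin_morphism_def by (rule someI[of _ \<Phi>]) (use \<Phi> \<Phi>_gen in blast)
  then have M: "operad_morphism (free_operad ?T) (tensor_operad F1 F2) M" and M_gen: "?gen i j M" for i j
    by auto
  have gen_mem: "free_gen ?T q \<in> ops (free_operad ?T) 2" for q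
    unfolding free_gen_def ops_free_operad by (intro imageI gen_ops)
  have gen_eq: "M 2 (free_gen ?T q) = \<Phi> 2 (free_gen ?T q)" for q
    using M_gen \<Phi>_gen by (cases q) simp
  interpret F: operad "free_operad ?T" by (rule operad_free_operad)
  have tri: "M 3 (free_class ?T 3 (mono (tri p))) = \<Phi> 3 (free_class ?T 3 (mono (tri p)))"
    if "p \<in> arity3_index" for p
  proof -
    obtain q q' a b c where p: "p = (q, q', a, b, c)" by (metis prod.collapse)
    have abc: "distinct [a, b, c]" "{a, b, c} = {1, 2, 3}"
      using that by (auto simp: p arity3_index_def cyclic_triples_def)
    obtain r where r: "r permutes {1..3}" "r 1 = a" "r 2 = b" "r 3 = c"
      by (rule permutes_3[OF abc])
    have ir: "inv r permutes {1..3}" "inv (inv r) = r"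
      using r(1) by (auto intro: permutes_inv simp: permutes_bij inv_inv_eq)
    have one: "1 \<in> {1..2::nat}" by simp
    let ?c = "pcomp (free_operad ?T) 2 2 1 (free_gen ?T q) (free_gen ?T q')"
    have c: "?c \<in> ops (free_operad ?T) 3"
      using F.comp_closed[OF gen_mem gen_mem one] by simp
    have "?c = free_class ?T 3 (mono (Node q (Node q' (Leaf 1) (Leaf 2)) (Leaf 3)))"
      unfolding free_gen_def pcomp_free_class[OF gen_ops gen_ops one]
      by (simp add: tree_operad_simps outer_input_def relabel_def)
    moreover have c_ops: "mono (Node q (Node q' (Leaf 1) (Leaf 2)) (Leaf 3)) \<in> ops L12 3"
      using linearisation_ops_single[OF tri_ops[of "(q, q', 1, 2, 3)"]]
      by (simp add: tri_def mem_arity3_index cyclic_triples_def)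
    ultimately have "free_class ?T 3 (mono (tri p)) = sact (free_operad ?T) 3 ?c (inv r)"
      using sact_free_class[OF c_ops ir(1), of ?T]
      by (simp add: ir(2) p tri_def relabel_def r[simplified])
    moreover have e: "f 3 (sact (free_operad ?T) 3 ?c (inv r)) = sact (tensor_operad F1 F2) 3
        (pcomp (tensor_operad F1 F2) 2 2 1 (f 2 (free_gen ?T q)) (f 2 (free_gen ?T q'))) (inv r)"
      if f: "operad_morphism (free_operad ?T) (tensor_operad F1 F2) f" for f
      using operad_morphismD(4)[OF f c ir(1)] operad_morphismD(5)[OF f one gen_mem gen_mem] by simp
    ultimately show ?thesis using e[OF M] e[OF \<Phi>] by (simp add: gen_eq)
  qed
  have "x \<in> ops L12 3 \<and> M 3 (free_class ?T 3 x) = \<Phi> 3 (free_class ?T 3 x)"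
    if "x = (\<Sum>p\<in>A. pm_scale (u p) (mono (tri p)))" "A \<subseteq> arity3_index" "finite A" for x A
    using that(3,2) unfolding that(1)
  proof (induction A)
    case empty
    have "M 3 (vzero (free_operad ?T) 3) = \<Phi> 3 (vzero (free_operad ?T) 3)"
      unfolding operad_morphism_zero[OF operad_free_operad operad_tensor_operad[OF operad_free_operad operad_free_operad] M]
        operad_morphism_zero[OF operad_free_operad operad_tensor_operad[OF operad_free_operad operad_free_operad] \<Phi>] ..
    then show ?case by (simp add: vzero_free_operad linearisation_simps)
  next
    case (insert p A)
    let ?y = "\<Sum>p\<in>A. pm_scale (u p) (mono (tri p))"
    have y: "?y \<in> ops L12 3" "M 3 (free_class ?T 3 ?y) = \<Phi> 3 (free_class ?T 3 ?y)" and p: "p \<in> arity3_index"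
      using insert by auto
    have m: "mono (tri p) \<in> ops L12 3" by (intro linearisation_ops_single tri_ops p)
    have eq: "f 3 (free_class ?T 3 (pm_scale (u p) (mono (tri p)) + ?y)) = vadd (tensor_operad F1 F2) 3
        (vscale (tensor_operad F1 F2) 3 (u p) (f 3 (free_class ?T 3 (mono (tri p))))) (f 3 (free_class ?T 3 ?y))"
      if f: "operad_morphism (free_operad ?T) (tensor_operad F1 F2) f" for f
    proof -
      have "free_class ?T 3 x \<in> ops (free_operad ?T) 3" if "x \<in> ops L12 3" for x
        using that by (simp add: ops_free_operad)
      then show ?thesis
        unfolding vadd_free_class[OF linearisation_ops_scale[OF m] y(1), symmetric]
          vscale_free_class[OF m, symmetric]
        using F.scale_closed m y(1) by (simp add: operad_morphismD(2,3)[OF f])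
    qed
    show ?case
      unfolding sum.insert[OF insert.hyps]
      using eq[OF M] eq[OF \<Phi>] tri[OF p] y linearisation_ops_add[OF linearisation_ops_scale[OF m] y(1)]
      by simp
  qed
  from this[OF refl subset_refl finite_arity3_index] show ?thesis
    using \<Phi>_class[OF arity3_sum_ops] by (simp add: M_def arity3_element_eq arity3_sum_def)
qed

end


section \<open>Relations of the white product\<close>

definition index_fst :: "('i \<times> 'j) \<times> ('i \<times> 'j) \<times> 't \<Rightarrow> 'i \<times> 'i \<times> 't" where
  "index_fst = (\<lambda>((i, i'), (j, j'), t). (i, j, t))"

definition index_snd :: "('i \<times> 'j) \<times> ('i \<times> 'j) \<times> 't \<Rightarrow> 'j \<times> 'j \<times> 't" where
  "index_snd = (\<lambda>((i, i'), (j, j'), t). (i', j', t))"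

lemma index_mem:
  "p \<in> arity3_index \<Longrightarrow> index_fst p \<in> arity3_index"
  "p \<in> arity3_index \<Longrightarrow> index_snd p \<in> arity3_index"
  by (auto simp: arity3_index_def index_fst_def index_snd_def)

lemma map_tree_tri: "map_tree fst (tri p) = tri (index_fst p)" "map_tree snd (tri p) = tri (index_snd p)"
  by (auto simp: tri_def index_fst_def index_snd_def split: prod.split)

text \<open>Any representative may be chosen: for an involutive \<open>T\<close> the functional
  \<open>arity3_dual T h\<close> vanishes on \<open>sym_ideal T 3\<close>.\<close>

definition class_functional ::
    "('i::finite, 'k::field) S2_module \<Rightarrow> ('i \<times> 'i \<times> nat \<times> nat \<times> nat \<Rightarrow> 'k) \<Rightarrow> ('i tree \<Rightarrow>\<^sub>0 'k) set \<Rightarrow> 'k" where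
  "class_functional T h A = pm_eval (arity3_dual T h) (SOME x. x \<in> A)"

lemma class_functional_free_class:
  assumes T: "involutive_module T" and x: "x \<in> ops (linearisation tree_operad) 3"
  shows "class_functional T h (free_class T 3 x) = pm_eval (arity3_dual T h) x"
proof -
  interpret operad_with_ideal "linearisation tree_operad" "sym_ideal T"
    by (rule operad_with_ideal_free)
  let ?y = "SOME y. y \<in> free_class T 3 x"
  have "?y \<in> free_class T 3 x"
    using coset_self[OF x] unfolding free_class_def by (rule someI)
  then obtain d where "d \<in> sym_ideal T 3" "?y = x + d"
    by (auto simp: free_class_def coset_def linearisation_simps)
  then show ?thesis
    by (simp add: class_functional_def arity3_dual_sym_ideal[OF T])
qed

lemma arity3_sum_delta:
  assumes "p \<in> arity3_index"
  shows "arity3_sum (\<lambda>q. (if q = p then 1 else 0) - f q) + arity3_sum f = mono (tri p)"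
proof -
  have "arity3_sum (\<lambda>q. (if q = p then 1 else 0) - f q) + arity3_sum f =
      (\<Sum>q\<in>arity3_index. if q = p then mono (tri q) else 0)"
    unfolding arity3_sum_add unfolding arity3_sum_def by (intro sum.cong) simp_all
  then show ?thesis using assms by simp
qed

text \<open>Since the Manin morphism duplicates the shape of a tree, both factors of a term carry
  the same cyclic triple, which \<open>index_fst\<close> and \<open>index_snd\<close> keep. For one
  inclusion, h \<otimes> g is a functional that kills the tensors with a relation in either factor.
  For the other, the two projections rewrite the image of \<open>u\<close>, modulo such tensors,
  with coefficients that are values of some h \<otimes> g on \<open>u\<close>.\<close>

lemma arity3_coeffs_white_product:
  fixes Q1 :: "('i::finite, 'k::field) quadratic_data" and Q2 :: "('j::finite, 'k) quadratic_data"
  assumes T: "involutive_module (gens Q1)" "involutive_module (gens Q2)"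
    and U: "coord_subspace (arity3_coeffs Q1)" "coord_subspace (arity3_coeffs Q2)"
    and rels: "rels Q1 = arity3_element (gens Q1) ` arity3_coeffs Q1"
      "rels Q2 = arity3_element (gens Q2) ` arity3_coeffs Q2"
  shows "arity3_coeffs (white_product Q1 Q2) =
    {u. \<forall>h\<in>arity3_perp (arity3_coeffs Q1). \<forall>g\<in>arity3_perp (arity3_coeffs Q2).
      (\<Sum>p\<in>arity3_index. u p * (h (index_fst p) * g (index_snd p))) = 0}"
proof -
  define T1 where "T1 = gens Q1"
  define T2 where "T2 = gens Q2"
  define F1 where "F1 = free_operad T1"
  define F2 where "F2 = free_operad T2"
  define LP :: "('k, _) operad_struct" where "LP = linearisation (pair_operad F1 F2)"
  define B where "B = bilinearity_ideal F1 F2"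
  let ?L1 = "linearisation tree_operad :: ('k, 'i tree \<Rightarrow>\<^sub>0 'k) operad_struct"
  let ?L2 = "linearisation tree_operad :: ('k, 'j tree \<Rightarrow>\<^sub>0 'k) operad_struct"
  let ?t = "formal_tensor T1 T2 3"
  define G where "G = {pure_tensor F1 F2 3 r y | r y. r \<in> rels Q1 \<and> y \<in> ops F2 3} \<union>
     {pure_tensor F1 F2 3 x r | x r. x \<in> ops F1 3 \<and> r \<in> rels Q2}"
  define S where "S = span_of (tensor_operad F1 F2) 3 G"
  define z where "z u = lin_map (tree_tensor T1 T2 3) (arity3_sum u)" for u :: "_ \<Rightarrow> 'k"
  note T' = T[folded T1_def T2_def]
  note rels' = rels[folded T1_def T2_def]
  have LP_B: "operad_with_ideal LP B"
    unfolding LP_def B_def F1_def F2_def by (rule operad_with_ideal_B)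
  interpret I: operad_with_ideal LP B by (rule LP_B)
  have tensor: "tensor_operad F1 F2 = quot_operad LP B"
    by (simp add: tensor_operad_def LP_def B_def)
  have coset_iff: "coset LP B 3 x = coset LP B 3 y \<longleftrightarrow> x - y \<in> B 3" if "x \<in> ops LP 3" "y \<in> ops LP 3" for x y
    using linearisation_coset_eq_iff[of "pair_operad F1 F2" B x 3 y] LP_B that by (simp add: LP_def)
  have LP: "x \<in> ops LP 3 \<Longrightarrow> y \<in> ops LP 3 \<Longrightarrow> x + y \<in> ops LP 3" "x \<in> ops LP 3 \<Longrightarrow> pm_scale c x \<in> ops LP 3"
      "0 \<in> ops LP 3" for x y c
    unfolding LP_def using linearisation_ops_add linearisation_ops_scale pm_subspaceD(1)[OF pm_subspace_ops] by blast+
  have vLP: "vadd LP n = (+)" "vscale LP n = pm_scale" "vzero LP n = 0" for n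
    by (simp_all add: LP_def linearisation_simps)
  have B: "pm_subspace (B n)" for n
    unfolding B_def F1_def F2_def by (rule pm_subspace_B)
  have F_ops: "free_class T1 3 x \<in> ops F1 3" if "x \<in> ops ?L1 3" for x
    using that by (simp add: F1_def ops_free_operad)
  have F_ops': "free_class T2 3 x \<in> ops F2 3" if "x \<in> ops ?L2 3" for x
    using that by (simp add: F2_def ops_free_operad)
  have rels_ops: "rels Q1 \<subseteq> ops F1 3" "rels Q2 \<subseteq> ops F2 3"
    using rels' F_ops[OF arity3_sum_ops] F_ops'[OF arity3_sum_ops] by (auto simp: arity3_element_eq)
  have single_ops: "Poly_Mapping.single (x, y) c \<in> ops LP 3" if "x \<in> ops F1 3" "y \<in> ops F2 3" for x y c
    unfolding LP_def using that by (intro linearisation_ops_single) (simp add: pair_operad_simps)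
  have G_ops: "G \<subseteq> ops (tensor_operad F1 F2) 3"
    using rels_ops single_ops
    by (auto simp: G_def tensor I.quot_simps pure_tensor_def simp flip: LP_def B_def)
  have S: "subspace_of (tensor_operad F1 F2) 3 S"
    unfolding S_def by (intro operad.subspace_of_span_of operad_tensor_operad G_ops)
       (simp_all add: F1_def F2_def operad_free_operad)
  have z_ops: "z u \<in> ops LP 3" for u
    using operad_morphismD(1)[OF operad_morphism_tree_tensor arity3_sum_ops]
    by (simp add: z_def LP_def F1_def F2_def)
  have z_eq: "z u = (\<Sum>p\<in>arity3_index. pm_scale (u p) (?t (mono (tri (index_fst p))) (mono (tri (index_snd p)))))" for u
    by (simp add: z_def arity3_sum_def lin_map_sum tree_tensor_eq map_tree_tri del: pm_scale_single)
  have coeffs: "u \<in> arity3_coeffs (white_product Q1 Q2) \<longleftrightarrow> coset LP B 3 (z u) \<in> S" for u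
    using manin_morphism_arity3_element[of T1 T2 u]
    by (simp add: arity3_coeffs_def white_product_def Let_def S_def G_def z_def LP_def B_def F1_def F2_def
        arity3_element_eq ops_free_operad arity3_sum_ops flip: T1_def T2_def)
  define Z where "Z = {x \<in> ops LP 3. coset LP B 3 x \<in> S}"
  have Z: "pm_subspace Z"
    unfolding pm_subspace_def
  proof (intro conjI ballI allI)
    show "0 \<in> Z" using S LP by (simp add: Z_def subspace_of_def tensor I.quot_simps vLP)
    show "x + y \<in> Z" if "x \<in> Z" "y \<in> Z" for x y
    proof -
      have "vadd (tensor_operad F1 F2) 3 (coset LP B 3 x) (coset LP B 3 y) \<in> S"
        using S that unfolding subspace_of_def Z_def by blast
      then show ?thesis using that LP by (simp add: Z_def tensor I.quot_add vLP)
    qed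
    show "pm_scale c x \<in> Z" if "x \<in> Z" for x c
    proof -
      have "vscale (tensor_operad F1 F2) 3 c (coset LP B 3 x) \<in> S"
        using S that unfolding subspace_of_def Z_def by blast
      then show ?thesis using that LP by (simp add: Z_def tensor I.quot_scale vLP)
    qed
  qed
  have B_Z: "x \<in> Z" if "x \<in> B 3" for x
    using that pm_subspaceD(1)[OF Z] LP coset_iff[OF I.I_closed[OF that] LP(3)] I.I_closed by (simp add: Z_def)
  have G_Z: "?t x y \<in> Z" if "x \<in> ops ?L1 3" "y \<in> ops ?L2 3" "free_class T1 3 x \<in> rels Q1 \<or> free_class T2 3 y \<in> rels Q2" for x y
  proof -
    have "coset LP B 3 (?t x y) \<in> G"
      using that F_ops F_ops' unfolding G_def formal_tensor_def pure_tensor_def LP_def B_def by blast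
    then show ?thesis
      using single_ops F_ops F_ops' that subsetD[OF span_of_superset]
      by (simp add: Z_def S_def formal_tensor_def)
  qed
  have lower: "z u \<in> Z" if u: "\<And>h g. \<lbrakk>h \<in> arity3_perp (arity3_coeffs Q1); g \<in> arity3_perp (arity3_coeffs Q2)\<rbrakk> \<Longrightarrow>
      (\<Sum>p\<in>arity3_index. u p * (h (index_fst p) * g (index_snd p))) = 0" for u
  proof -
    \<comment> \<open>modulo \<open>Z\<close>, the vectors of the two bases may be replaced by their projections \<open>N1\<close> and \<open>N2\<close>\<close>
    obtain N1 where N1: "\<And>q. (\<lambda>p. N1 p q) \<in> arity3_perp (arity3_coeffs Q1)"
        "\<And>p. p \<in> arity3_index \<Longrightarrow> (\<lambda>q. (if q = p then 1 else 0) - N1 p q) \<in> arity3_coeffs Q1"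
      using coord_subspace_projection[OF U(1)] by blast
    obtain N2 where N2: "\<And>q. (\<lambda>p. N2 p q) \<in> arity3_perp (arity3_coeffs Q2)"
        "\<And>p. p \<in> arity3_index \<Longrightarrow> (\<lambda>q. (if q = p then 1 else 0) - N2 p q) \<in> arity3_coeffs Q2"
      using coord_subspace_projection[OF U(2)] by blast
    have sum_eq: "arity3_sum f = (\<Sum>r\<in>arity3_index. pm_scale (f r) (mono (tri r)))"
      for f :: "'x::finite \<times> 'x \<times> nat \<times> nat \<times> nat \<Rightarrow> 'k"
      by (simp add: arity3_sum_def)
    have left: "?t (mono (tri p)) y - ?t (arity3_sum (N1 p)) y \<in> Z" if "p \<in> arity3_index" "y \<in> ops ?L2 3" for p y
    proof -
      let ?d = "arity3_sum (\<lambda>q. (if q = p then 1 else 0) - N1 p q)"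
      have "free_class T1 3 ?d \<in> rels Q1"
        using N1(2)[OF that(1)] rels'(1) by (auto simp: arity3_element_eq)
      then have "?t ?d y \<in> Z" by (intro G_Z arity3_sum_ops that(2) disjI1)
      moreover have "?t (?d + arity3_sum (N1 p)) y - ?t ?d y - ?t (arity3_sum (N1 p)) y \<in> Z"
        by (rule B_Z[unfolded B_def F1_def F2_def,
              OF formal_tensor_bilinear(1)[OF arity3_sum_ops arity3_sum_ops that(2) that(2)]])
      ultimately have "?t ?d y + (?t (?d + arity3_sum (N1 p)) y - ?t ?d y - ?t (arity3_sum (N1 p)) y) \<in> Z"
        by (rule pm_subspaceD(2)[OF Z])
      then show ?thesis by (simp add: arity3_sum_delta[OF that(1)])
    qed
    have right: "?t x (mono (tri p)) - ?t x (arity3_sum (N2 p)) \<in> Z" if "p \<in> arity3_index" "x \<in> ops ?L1 3" for p x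
    proof -
      let ?d = "arity3_sum (\<lambda>q. (if q = p then 1 else 0) - N2 p q)"
      have "free_class T2 3 ?d \<in> rels Q2"
        using N2(2)[OF that(1)] rels'(2) by (auto simp: arity3_element_eq)
      then have "?t x ?d \<in> Z" by (intro G_Z arity3_sum_ops that(2) disjI2)
      moreover have "?t x (?d + arity3_sum (N2 p)) - ?t x ?d - ?t x (arity3_sum (N2 p)) \<in> Z"
        by (rule B_Z[unfolded B_def F1_def F2_def,
              OF formal_tensor_bilinear(2)[OF that(2) that(2) arity3_sum_ops arity3_sum_ops]])
      ultimately have "?t x ?d + (?t x (?d + arity3_sum (N2 p)) - ?t x ?d - ?t x (arity3_sum (N2 p))) \<in> Z"
        by (rule pm_subspaceD(2)[OF Z])
      then show ?thesis by (simp add: arity3_sum_delta[OF that(1)])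
    qed
    let ?e = "\<lambda>p. \<Sum>r\<in>arity3_index. \<Sum>s\<in>arity3_index. pm_scale (N1 (index_fst p) r * N2 (index_snd p) s)
        (?t (mono (tri r)) (mono (tri s)))"
    have "?t (mono (tri (index_fst p))) (mono (tri (index_snd p))) - ?e p \<in> Z" if p: "p \<in> arity3_index" for p
    proof -
      let ?x = "mono (tri (index_fst p))" and ?y = "mono (tri (index_snd p))"
      let ?x' = "arity3_sum (N1 (index_fst p))" and ?y' = "arity3_sum (N2 (index_snd p))"
      have y: "?y \<in> ops ?L2 3" by (intro linearisation_ops_single tri_ops index_mem p)
      have "?t ?x' ?y' - ?e p \<in> Z"
        unfolding sum_eq
        by (intro B_Z[unfolded B_def F1_def F2_def] formal_tensor_sum linearisation_ops_single tri_ops finite_arity3_index)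
      then have "(?t ?x ?y - ?t ?x' ?y) + (?t ?x' ?y - ?t ?x' ?y') + (?t ?x' ?y' - ?e p) \<in> Z"
        using left[OF index_mem(1)[OF p] y] right[OF index_mem(2)[OF p] arity3_sum_ops]
        by (intro pm_subspaceD(2)[OF Z])
      then show ?thesis by simp
    qed
    then have "(\<Sum>p\<in>arity3_index. pm_scale (u p) (?t (mono (tri (index_fst p))) (mono (tri (index_snd p))) - ?e p)) \<in> Z"
      by (intro pm_subspaceD(5,3)[OF Z])
    moreover have "pm_scale c (x - y) = pm_scale c x - pm_scale c y"
      for c and x y :: "('i tree \<Rightarrow>\<^sub>0 'k) set \<times> ('j tree \<Rightarrow>\<^sub>0 'k) set \<Rightarrow>\<^sub>0 'k"
      by (rule poly_mapping_eqI) (simp add: lookup_minus algebra_simps)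
    moreover have "(\<Sum>p\<in>arity3_index. pm_scale (u p) (?e p)) = 0"
    proof -
      have scale_sum: "(\<Sum>p\<in>A. pm_scale (f p) x) = pm_scale (\<Sum>p\<in>A. f p) x"
        for f and A :: "(('i \<times> 'j) \<times> ('i \<times> 'j) \<times> nat \<times> nat \<times> nat) set"
          and x :: "('i tree \<Rightarrow>\<^sub>0 'k) set \<times> ('j tree \<Rightarrow>\<^sub>0 'k) set \<Rightarrow>\<^sub>0 'k"
        by (rule poly_mapping_eqI) (simp add: lookup_sum sum_distrib_right)
      have "(\<Sum>p\<in>arity3_index. pm_scale (u p) (?e p)) =
          (\<Sum>r\<in>arity3_index. \<Sum>s\<in>arity3_index. \<Sum>p\<in>arity3_index.
            pm_scale (u p * (N1 (index_fst p) r * N2 (index_snd p) s)) (?t (mono (tri r)) (mono (tri s))))"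
        unfolding pm_scale_sum pm_scale_scale
        by (subst sum.swap, rule sum.cong[OF refl], rule sum.swap)
      \<comment> \<open>The coefficient of the pair \<open>r\<close>, \<open>s\<close> is
        \<open>u\<close> paired with column \<open>r\<close> of \<open>N1\<close> times column
        \<open>s\<close> of \<open>N2\<close>, and these columns lie in the two orthogonals.\<close>
      also have "\<dots> = (\<Sum>r\<in>arity3_index. \<Sum>s\<in>arity3_index. pm_scale 0 (?t (mono (tri r)) (mono (tri s))))"
        unfolding scale_sum u[OF N1(1) N2(1)] ..
      also have "\<dots> = 0"
        by (intro sum.neutral ballI poly_mapping_eqI) simp
      finally show ?thesis .
    qed
    ultimately show ?thesis by (simp add: z_eq sum_subtractf)
  qed
  have upper: "(\<Sum>p\<in>arity3_index. u p * (h (index_fst p) * g (index_snd p))) = 0"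
    if u: "coset LP B 3 (z u) \<in> S" and h: "h \<in> arity3_perp (arity3_coeffs Q1)"
      and g: "g \<in> arity3_perp (arity3_coeffs Q2)" for u h g
  proof -
    let ?h = "class_functional T1 h" and ?g = "class_functional T2 g"
    define \<Lambda> where "\<Lambda> = pm_eval (\<lambda>(x, y). ?h x * ?g y)"
    have h_rel: "?h r = 0" if "r \<in> rels Q1" for r
      using that h rels'(1) class_functional_free_class[OF T'(1) arity3_sum_ops]
      by (auto simp: arity3_element_eq arity3_dual_arity3_sum arity3_perp_def)
    have g_rel: "?g r = 0" if "r \<in> rels Q2" for r
      using that g rels'(2) class_functional_free_class[OF T'(2) arity3_sum_ops]
      by (auto simp: arity3_element_eq arity3_dual_arity3_sum arity3_perp_def)
    have h_add: "?h (vadd F1 3 x y) = ?h x + ?h y" if "x \<in> ops F1 3" "y \<in> ops F1 3" for x y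
      using that class_functional_free_class[OF T'(1)]
      by (auto simp: F1_def ops_free_operad vadd_free_class linearisation_ops_add)
    have g_add: "?g (vadd F2 3 x y) = ?g x + ?g y" if "x \<in> ops F2 3" "y \<in> ops F2 3" for x y
      using that class_functional_free_class[OF T'(2)]
      by (auto simp: F2_def ops_free_operad vadd_free_class linearisation_ops_add)
    have h_scale: "?h (vscale F1 3 c x) = c * ?h x" if "x \<in> ops F1 3" for x c
      using that class_functional_free_class[OF T'(1)]
      by (auto simp: F1_def ops_free_operad vscale_free_class linearisation_ops_scale)
    have g_scale: "?g (vscale F2 3 c x) = c * ?g x" if "x \<in> ops F2 3" for x c
      using that class_functional_free_class[OF T'(2)]
      by (auto simp: F2_def ops_free_operad vscale_free_class linearisation_ops_scale)
    have "B 3 \<subseteq> {x \<in> ops LP 3. \<Lambda> x = 0}"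
      unfolding B_def bilinearity_ideal_def LP_def[symmetric]
    proof (rule span_of_minimal)
      show "subspace_of LP 3 {x \<in> ops LP 3. \<Lambda> x = 0}"
        using LP by (auto simp: subspace_of_def vLP \<Lambda>_def)
      have "bilinearity_relators F1 F2 3 \<subseteq> B 3"
        unfolding B_def bilinearity_ideal_def by (rule span_of_superset)
      then have "bilinearity_relators F1 F2 3 \<subseteq> ops LP 3" using I.I_closed by blast
      moreover have "\<Lambda> x = 0" if "x \<in> bilinearity_relators F1 F2 3" for x
        using that unfolding bilinearity_relators_def
        by (auto simp: \<Lambda>_def h_add g_add h_scale g_scale distrib_left distrib_right)
      ultimately show "bilinearity_relators F1 F2 3 \<subseteq> {x \<in> ops LP 3. \<Lambda> x = 0}" by blast
    qed
    then have \<Lambda>_B: "\<Lambda> x = 0" if "x \<in> B 3" for x using that by blast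
    \<comment> \<open>\<Lambda> is defined on formal pairs while \<open>S\<close> consists of
      cosets, so \<open>S\<close> is bounded by the cosets of the kernel. Two elements of one coset
      have the same value because \<Lambda> vanishes on \<open>B 3\<close>.\<close>
    have "S \<subseteq> coset LP B 3 ` {x \<in> ops LP 3. \<Lambda> x = 0}"
      unfolding S_def
    proof (rule span_of_minimal)
      show "subspace_of (tensor_operad F1 F2) 3 (coset LP B 3 ` {x \<in> ops LP 3. \<Lambda> x = 0})"
        unfolding subspace_of_def tensor
        using LP by (auto simp: I.quot_simps I.quot_add I.quot_scale vLP \<Lambda>_def)
      show "G \<subseteq> coset LP B 3 ` {x \<in> ops LP 3. \<Lambda> x = 0}"
        unfolding G_def pure_tensor_def LP_def[symmetric] B_def[symmetric]
        using single_ops rels_ops by (auto simp: \<Lambda>_def h_rel g_rel)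
    qed
    then obtain y where y: "y \<in> ops LP 3" "\<Lambda> y = 0" "coset LP B 3 (z u) = coset LP B 3 y"
      using u by blast
    then have "z u - y \<in> B 3" using coset_iff[OF z_ops] by blast
    then have "\<Lambda> (z u - y) = 0" by (rule \<Lambda>_B)
    then have "\<Lambda> (z u) = 0" using y(2) by (simp add: \<Lambda>_def)
    moreover have "\<Lambda> (?t (mono (tri (index_fst p))) (mono (tri (index_snd p)))) = h (index_fst p) * g (index_snd p)"
      if p: "p \<in> arity3_index" for p
      using class_functional_free_class[OF T'(1) linearisation_ops_single[OF tri_ops[OF index_mem(1)[OF p]]]]
        class_functional_free_class[OF T'(2) linearisation_ops_single[OF tri_ops[OF index_mem(2)[OF p]]]]
      by (simp add: \<Lambda>_def formal_tensor_def arity3_dual_tri index_mem p)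
    ultimately show ?thesis by (simp add: z_eq \<Lambda>_def pm_eval_sum del: pm_scale_single)
  qed
  show ?thesis
    using lower upper by (auto simp: coeffs Z_def)
qed


section \<open>Relations of the three operads\<close>

lemma cyclic_triples_rotate:
  "(a, b, c) \<in> cyclic_triples \<Longrightarrow> (b, c, a) \<in> cyclic_triples"
  "(a, b, c) \<in> cyclic_triples \<Longrightarrow> (c, a, b) \<in> cyclic_triples"
  by (auto simp: cyclic_triples_def)

text \<open>S_3 is split into the three rotations and their composites with the exchange of the
  first two entries; each resulting tree is then a basis tree up to the two swap rules.\<close>

lemma all_permutes_3:
  "(\<forall>r. r permutes {1..3::nat} \<longrightarrow> P (r 1) (r 2) (r 3)) \<longleftrightarrow>
    (\<forall>a b c. (a, b, c) \<in> cyclic_triples \<longrightarrow> P a b c \<and> P b a c)" (is "?l \<longleftrightarrow> ?r")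
proof
  assume ?l
  have "P a b c" if abc: "distinct [a, b, c]" "{a, b, c} = {1, 2, 3::nat}" for a b c
  proof -
    obtain r where "r permutes {1..3}" "r 1 = a" "r 2 = b" "r 3 = c"
      by (rule permutes_3[OF abc])
    with \<open>?l\<close> show ?thesis by blast
  qed
  moreover have "distinct [a, b, c] \<and> {a, b, c} = {1, 2, 3} \<and> distinct [b, a, c] \<and> {b, a, c} = {1, 2, 3}"
    if "(a, b, c) \<in> cyclic_triples" for a b c
    using that by (auto simp: cyclic_triples_def)
  ultimately show ?r by blast
next
  assume ?r
  show ?l
  proof (intro allI impI)
    fix r :: "nat \<Rightarrow> nat" assume r: "r permutes {1..3}"
    have three: "{1..3} = {1, 2, 3::nat}" by auto
    have "{r 1, r 2, r 3} = {1, 2, 3}" using permutes_image[OF r] unfolding three by simp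
    moreover have "distinct [r 1, r 2, r 3]" using permutes_inj[OF r] by (simp add: inj_eq)
    ultimately show "P (r 1) (r 2) (r 3)" using cyclic_or_swapped \<open>?r\<close> by blast
  qed
qed

lemma relabel_Node [simp]: "relabel g (Node i s t) = Node i (relabel g s) (relabel g t)"
  by (simp add: relabel_def)

lemma arity3_perp_relators_cyclic:
  assumes "involutive_module T" "G \<subseteq> ops (linearisation tree_operad) 3"
    and "\<And>v r. (\<forall>g\<in>G. pm_eval (\<lambda>t. arity3_dual T v (relabel r t)) g = 0) \<longleftrightarrow> P v (r 1) (r 2) (r 3)"
  shows "arity3_perp (arity3_coeffs (quadratic_data_of_relators T G)) =
    {v. \<forall>a b c. (a, b, c) \<in> cyclic_triples \<longrightarrow> P v a b c \<and> P v b a c}"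
  unfolding arity3_perp_relators[OF assms(1,2)] all_permutes_3[symmetric] assms(3)[symmetric] by blast

lemma sum_regular_module:
  fixes p :: "'p::finite" and f :: "'p \<times> bool \<Rightarrow> 'k::field"
  shows "(\<Sum>k\<in>UNIV. regular_module (p, b) k * f k) = f (p, \<not> b)"
proof -
  have "(\<Sum>k\<in>UNIV. regular_module (p, b) k * f k) = (\<Sum>k\<in>UNIV. if k = (p, \<not> b) then f k else 0)"
    by (intro sum.cong) (auto simp: regular_module_def split: prod.split)
  then show ?thesis by simp
qed

lemma involutive_regular_module: "involutive_module (regular_module :: ('p::finite \<times> bool, 'k::field) S2_module)"
  unfolding involutive_module_def split_paired_All sum_regular_module
  by (auto simp: regular_module_def)

lemma sum_poisson_module:
  "(\<Sum>k\<in>UNIV. poisson_module p k * f k) = poisson_module p p * f p"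
proof -
  have "(\<Sum>k\<in>UNIV. poisson_module p k * f k) = (\<Sum>k\<in>UNIV. if k = p then poisson_module p p * f k else 0)"
    by (intro sum.cong) (auto simp: poisson_module_def)
  then show ?thesis by simp
qed

lemma involutive_poisson_module: "involutive_module poisson_module"
  unfolding involutive_module_def sum_poisson_module
  by (auto simp: poisson_module_def split: poisson_op.split)

lemma arity3_dual_cyclic:
  "(a, b, c) \<in> cyclic_triples \<Longrightarrow> arity3_dual T v (Node i (Node j (Leaf a) (Leaf b)) (Leaf c)) = v (i, j, a, b, c)"
  using arity3_dual_tri[of "(i, j, a, b, c)" T v] by (simp add: tri_def mem_arity3_index)

lemma arity3_dual_regular:
  fixes v :: "('p::finite \<times> bool) \<times> ('p \<times> bool) \<times> nat \<times> nat \<times> nat \<Rightarrow> 'k::field"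
  shows "arity3_dual regular_module v (Node (p, \<beta>) (Leaf c) (Node j s t)) =
      arity3_dual regular_module v (Node (p, \<not> \<beta>) (Node j s t) (Leaf c))"
    and "(a, b, c) \<in> cyclic_triples \<Longrightarrow>
      arity3_dual regular_module v (Node i (Node (p, \<beta>) (Leaf b) (Leaf a)) (Leaf c)) = v (i, (p, \<not> \<beta>), a, b, c)"
proof -
  show "arity3_dual regular_module v (Node (p, \<beta>) (Leaf c) (Node j s t)) =
      arity3_dual regular_module v (Node (p, \<not> \<beta>) (Node j s t) (Leaf c))"
    by (subst arity3_dual_swap_outer[OF involutive_regular_module]) (rule sum_regular_module)
  show "arity3_dual regular_module v (Node i (Node (p, \<beta>) (Leaf b) (Leaf a)) (Leaf c)) = v (i, (p, \<not> \<beta>), a, b, c)"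
    if "(a, b, c) \<in> cyclic_triples"
    by (subst arity3_dual_swap_inner[OF involutive_regular_module])
       (simp add: sum_regular_module arity3_dual_cyclic[OF that])
qed

lemma arity3_dual_poisson:
  "arity3_dual poisson_module v (Node p (Leaf c) (Node j s t)) =
      poisson_module p p * arity3_dual poisson_module v (Node p (Node j s t) (Leaf c))"
  "(a, b, c) \<in> cyclic_triples \<Longrightarrow>
      arity3_dual poisson_module v (Node i (Node p (Leaf b) (Leaf a)) (Leaf c)) =
        poisson_module p p * v (i, p, a, b, c)"
proof -
  show "arity3_dual poisson_module v (Node p (Leaf c) (Node j s t)) =
      poisson_module p p * arity3_dual poisson_module v (Node p (Node j s t) (Leaf c))"
    by (subst arity3_dual_swap_outer[OF involutive_poisson_module]) (rule sum_poisson_module)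
  show "arity3_dual poisson_module v (Node i (Node p (Leaf b) (Leaf a)) (Leaf c)) =
        poisson_module p p * v (i, p, a, b, c)" if "(a, b, c) \<in> cyclic_triples"
    by (subst arity3_dual_swap_inner[OF involutive_poisson_module])
       (simp add: sum_poisson_module arity3_dual_cyclic[OF that])
qed

section \<open>The orthogonals of the relations of Perm, Poiss and dual-prePoisson algebras\<close>

lemma mono_arity3_ops:
  assumes "distinct (leaves t)" "set (leaves t) = {1, 2, 3}"
  shows "mono t \<in> ops (linearisation tree_operad) 3"
proof -
  have "{1..3} = {1, 2, 3::nat}" by auto
  then show ?thesis
    using assms by (intro linearisation_ops_single) (simp only: tree_operad_simps mem_Collect_eq)
qed

text \<open>With \<open>True\<close> meaning reversed inputs, the four coordinates are those of (x_a
  x_b) x_c, (x_b x_a) x_c, x_a (x_b x_c) and x_b (x_a x_c): the monomials with last factor x_c,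
  which Perm identifies.\<close>

lemma perp_perm_data:
  fixes v :: "(unit \<times> bool) \<times> (unit \<times> bool) \<times> nat \<times> nat \<times> nat \<Rightarrow> 'k::field"
  shows "v \<in> arity3_perp (arity3_coeffs perm_data) \<longleftrightarrow>
    (\<forall>a b c. (a, b, c) \<in> cyclic_triples \<longrightarrow>
      v (((), False), ((), True), a, b, c) = v (((), False), ((), False), a, b, c) \<and>
      v (((), True), ((), False), b, c, a) = v (((), False), ((), False), a, b, c) \<and>
      v (((), True), ((), True), c, a, b) = v (((), False), ((), False), a, b, c))"
proof -
  let ?m = "Node ((), False)"
  let ?D = "arity3_dual regular_module :: ((unit \<times> bool) \<times> (unit \<times> bool) \<times> nat \<times> nat \<times> nat \<Rightarrow> 'k) \<Rightarrow> _"
  let ?P = "\<lambda>v x y z.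
    ?D v (?m (?m (Leaf x) (Leaf y)) (Leaf z)) - ?D v (?m (Leaf x) (?m (Leaf y) (Leaf z))) = 0 \<and>
    ?D v (?m (?m (Leaf x) (Leaf y)) (Leaf z)) - ?D v (?m (?m (Leaf y) (Leaf x)) (Leaf z)) = 0"
  have "arity3_perp (arity3_coeffs perm_data) =
      {v. \<forall>a b c. (a, b, c) \<in> cyclic_triples \<longrightarrow> ?P v a b c \<and> ?P v b a c}"
    unfolding perm_data_def Let_def
    by (rule arity3_perp_relators_cyclic[OF involutive_regular_module])
       (auto intro!: linearisation_ops_diff mono_arity3_ops)
  moreover have "?P v a b c \<and> ?P v b a c \<longleftrightarrow>
      v (((), False), ((), True), a, b, c) = v (((), False), ((), False), a, b, c) \<and>
      v (((), True), ((), False), b, c, a) = v (((), False), ((), False), a, b, c) \<and>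
      v (((), True), ((), True), c, a, b) = v (((), False), ((), False), a, b, c)"
    if "(a, b, c) \<in> cyclic_triples" for a b c
    using that cyclic_triples_rotate[OF that]
    by (auto simp: arity3_dual_regular arity3_dual_cyclic)
  ultimately show ?thesis by blast
qed

text \<open>The two orders of the variables give two associativity and two Leibniz equations; in
  each case one is a rotation of the other, so one per cyclic triple is kept. The Leibniz equation
  is solved for the coordinate at (\<open>Lie\<close>, \<open>Com\<close>).\<close>

lemma perp_poisson_data:
  fixes v :: "poisson_op \<times> poisson_op \<times> nat \<times> nat \<times> nat \<Rightarrow> 'k::field"
  shows "v \<in> arity3_perp (arity3_coeffs poisson_data) \<longleftrightarrow>
    (\<forall>a b c. (a, b, c) \<in> cyclic_triples \<longrightarrow>
      v (Com, Com, a, b, c) = v (Com, Com, b, c, a) \<and>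
      v (Lie, Lie, a, b, c) + v (Lie, Lie, b, c, a) + v (Lie, Lie, c, a, b) = 0 \<and>
      v (Lie, Com, b, c, a) = v (Com, Lie, c, a, b) - v (Com, Lie, a, b, c))" (is "_ \<longleftrightarrow> ?r")
proof -
  let ?c = "Node Com" and ?l = "Node Lie"
  let ?D = "arity3_dual poisson_module :: (poisson_op \<times> poisson_op \<times> nat \<times> nat \<times> nat \<Rightarrow> 'k) \<Rightarrow> _"
  let ?P = "\<lambda>v x y z.
    ?D v (?c (?c (Leaf x) (Leaf y)) (Leaf z)) - ?D v (?c (Leaf x) (?c (Leaf y) (Leaf z))) = 0 \<and>
    ?D v (?l (?l (Leaf x) (Leaf y)) (Leaf z)) + ?D v (?l (?l (Leaf y) (Leaf z)) (Leaf x)) +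
      ?D v (?l (?l (Leaf z) (Leaf x)) (Leaf y)) = 0 \<and>
    ?D v (?l (Leaf x) (?c (Leaf y) (Leaf z))) - ?D v (?c (?l (Leaf x) (Leaf y)) (Leaf z)) -
      ?D v (?c (Leaf y) (?l (Leaf x) (Leaf z))) = 0"
  have perp: "arity3_perp (arity3_coeffs poisson_data) =
      {v. \<forall>a b c. (a, b, c) \<in> cyclic_triples \<longrightarrow> ?P v a b c \<and> ?P v b a c}"
    unfolding poisson_data_def Let_def
    by (rule arity3_perp_relators_cyclic[OF involutive_poisson_module])
       (auto intro!: linearisation_ops_diff linearisation_ops_add mono_arity3_ops)
  have sym: "poisson_module Com Com = (1 :: 'k)" "poisson_module Lie Lie = (- 1 :: 'k)"
    by (simp_all add: poisson_module_def)
  \<comment> \<open>For the exchanged order every term of the Jacobi relator changes sign, and two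
    of its terms trade places.\<close>
  have neg: "- x + - y + - z = 0 \<longleftrightarrow> x + z + y = 0" for x y z :: 'k
  proof -
    have "- x + - y + - z = - (x + z + y)" by simp
    then show ?thesis by (simp only: neg_equal_0_iff_equal)
  qed
  have P: "?P v a b c \<and> ?P v b a c \<longleftrightarrow>
      v (Com, Com, a, b, c) = v (Com, Com, b, c, a) \<and> v (Com, Com, a, b, c) = v (Com, Com, c, a, b) \<and>
      v (Lie, Lie, a, b, c) + v (Lie, Lie, b, c, a) + v (Lie, Lie, c, a, b) = 0 \<and>
      - v (Lie, Com, b, c, a) - v (Com, Lie, a, b, c) - - v (Com, Lie, c, a, b) = 0 \<and>
      - v (Lie, Com, c, a, b) - - v (Com, Lie, a, b, c) - v (Com, Lie, b, c, a) = 0"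
    if abc: "(a, b, c) \<in> cyclic_triples" for a b c
    unfolding arity3_dual_poisson(1) arity3_dual_cyclic[OF abc] arity3_dual_poisson(2)[OF abc]
      arity3_dual_cyclic[OF cyclic_triples_rotate(1)[OF abc]] arity3_dual_poisson(2)[OF cyclic_triples_rotate(1)[OF abc]]
      arity3_dual_cyclic[OF cyclic_triples_rotate(2)[OF abc]] arity3_dual_poisson(2)[OF cyclic_triples_rotate(2)[OF abc]]
      sym mult_1 mult_minus1 mult_minus1_right neg right_minus_eq
    by blast
  show ?thesis
  proof
    assume "v \<in> arity3_perp (arity3_coeffs poisson_data)"
    then have v: "?P v a b c \<and> ?P v b a c" if "(a, b, c) \<in> cyclic_triples" for a b c
      using that unfolding perp by blast
    show ?r
    proof (intro allI impI)
      fix a b c :: nat assume abc: "(a, b, c) \<in> cyclic_triples"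
      show "v (Com, Com, a, b, c) = v (Com, Com, b, c, a) \<and>
          v (Lie, Lie, a, b, c) + v (Lie, Lie, b, c, a) + v (Lie, Lie, c, a, b) = 0 \<and>
          v (Lie, Com, b, c, a) = v (Com, Lie, c, a, b) - v (Com, Lie, a, b, c)"
        using v[OF abc] unfolding P[OF abc] by (simp add: algebra_simps)
    qed
  next
    assume r: ?r
    have "?P v a b c \<and> ?P v b a c" if abc: "(a, b, c) \<in> cyclic_triples" for a b c
      using r[rule_format, OF abc] r[rule_format, OF cyclic_triples_rotate(1)[OF abc]]
        r[rule_format, OF cyclic_triples_rotate(2)[OF abc]]
      unfolding P[OF abc] by (simp add: algebra_simps)
    then show "v \<in> arity3_perp (arity3_coeffs poisson_data)" unfolding perp by blast
  qed
qed

text \<open>Six relators in two orders give twelve equations. Ten remain, since the relator (x*y)*z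
  - (y*x)*z and the last one each yield the same equation in both orders. As for Perm, all
  coordinates in the equations for \<open>(a, b, c)\<close> belong to monomials that end in x_c, so
  the system splits by the last variable.\<close>

lemma perp_dual_prePoisson_data:
  fixes v :: "(dual_prepoisson_op \<times> bool) \<times> (dual_prepoisson_op \<times> bool) \<times> nat \<times> nat \<times> nat \<Rightarrow> 'k::field"
  defines "V \<equiv> \<lambda>p \<beta> q \<gamma> t. v ((p, \<beta>), (q, \<gamma>), t)"
  shows "v \<in> arity3_perp (arity3_coeffs dual_prePoisson_data) \<longleftrightarrow>
    (\<forall>a b c. (a, b, c) \<in> cyclic_triples \<longrightarrow>
      V Bracket True Bracket False (b, c, a) =
        V Bracket False Bracket False (a, b, c) + V Bracket True Bracket True (c, a, b) \<and>
      V Bracket True Bracket True (c, a, b) =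
        V Bracket False Bracket True (a, b, c) + V Bracket True Bracket False (b, c, a) \<and>
      V Star False Star False (a, b, c) = V Star True Star False (b, c, a) \<and>
      V Star False Star True (a, b, c) = V Star True Star True (c, a, b) \<and>
      V Star False Star False (a, b, c) = V Star False Star True (a, b, c) \<and>
      V Bracket True Star False (b, c, a) =
        V Star False Bracket False (a, b, c) + V Star True Bracket True (c, a, b) \<and>
      V Bracket True Star True (c, a, b) =
        V Star False Bracket True (a, b, c) + V Star True Bracket False (b, c, a) \<and>
      V Bracket False Star False (a, b, c) =
        V Star True Bracket False (b, c, a) + V Star True Bracket True (c, a, b) \<and>
      V Bracket False Star True (a, b, c) =
        V Star True Bracket False (b, c, a) + V Star True Bracket True (c, a, b) \<and>
      V Star False Bracket False (a, b, c) + V Star False Bracket True (a, b, c) = 0)"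
proof -
  let ?b = "Node (Bracket, False)" and ?m = "Node (Star, False)"
  let ?D = "arity3_dual regular_module :: ((dual_prepoisson_op \<times> bool) \<times> (dual_prepoisson_op \<times> bool) \<times> nat \<times> nat \<times> nat \<Rightarrow> 'k) \<Rightarrow> _"
  let ?P = "\<lambda>v x y z.
    ?D v (?b (Leaf x) (?b (Leaf y) (Leaf z))) - ?D v (?b (?b (Leaf x) (Leaf y)) (Leaf z)) -
      ?D v (?b (Leaf y) (?b (Leaf x) (Leaf z))) = 0 \<and>
    ?D v (?m (?m (Leaf x) (Leaf y)) (Leaf z)) - ?D v (?m (Leaf x) (?m (Leaf y) (Leaf z))) = 0 \<and>
    ?D v (?m (?m (Leaf x) (Leaf y)) (Leaf z)) - ?D v (?m (?m (Leaf y) (Leaf x)) (Leaf z)) = 0 \<and>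
    ?D v (?b (Leaf x) (?m (Leaf y) (Leaf z))) - ?D v (?m (?b (Leaf x) (Leaf y)) (Leaf z)) -
      ?D v (?m (Leaf y) (?b (Leaf x) (Leaf z))) = 0 \<and>
    ?D v (?b (?m (Leaf x) (Leaf y)) (Leaf z)) - ?D v (?m (Leaf x) (?b (Leaf y) (Leaf z))) -
      ?D v (?m (Leaf y) (?b (Leaf x) (Leaf z))) = 0 \<and>
    ?D v (?m (?b (Leaf x) (Leaf y)) (Leaf z)) + ?D v (?m (?b (Leaf y) (Leaf x)) (Leaf z)) = 0"
  have perp: "arity3_perp (arity3_coeffs dual_prePoisson_data) =
      {v. \<forall>a b c. (a, b, c) \<in> cyclic_triples \<longrightarrow> ?P v a b c \<and> ?P v b a c}"
    unfolding dual_prePoisson_data_def Let_def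
    by (rule arity3_perp_relators_cyclic[OF involutive_regular_module])
       (auto intro!: linearisation_ops_diff linearisation_ops_add mono_arity3_ops)
  have eq3: "x - y - z = 0 \<longleftrightarrow> x = y + z" for x y z :: 'k
    by (auto simp: algebra_simps)
  have "?P v a b c \<and> ?P v b a c \<longleftrightarrow>
      V Bracket True Bracket False (b, c, a) =
        V Bracket False Bracket False (a, b, c) + V Bracket True Bracket True (c, a, b) \<and>
      V Bracket True Bracket True (c, a, b) =
        V Bracket False Bracket True (a, b, c) + V Bracket True Bracket False (b, c, a) \<and>
      V Star False Star False (a, b, c) = V Star True Star False (b, c, a) \<and>
      V Star False Star True (a, b, c) = V Star True Star True (c, a, b) \<and>
      V Star False Star False (a, b, c) = V Star False Star True (a, b, c) \<and>
      V Bracket True Star False (b, c, a) =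
        V Star False Bracket False (a, b, c) + V Star True Bracket True (c, a, b) \<and>
      V Bracket True Star True (c, a, b) =
        V Star False Bracket True (a, b, c) + V Star True Bracket False (b, c, a) \<and>
      V Bracket False Star False (a, b, c) =
        V Star True Bracket False (b, c, a) + V Star True Bracket True (c, a, b) \<and>
      V Bracket False Star True (a, b, c) =
        V Star True Bracket False (b, c, a) + V Star True Bracket True (c, a, b) \<and>
      V Star False Bracket False (a, b, c) + V Star False Bracket True (a, b, c) = 0"
    if "(a, b, c) \<in> cyclic_triples" for a b c
    using that cyclic_triples_rotate[OF that]
    by (simp add: arity3_dual_regular arity3_dual_cyclic V_def eq3 del: right_minus_eq) (auto simp: add.commute)
  then show ?thesis unfolding perp mem_Collect_eq by blast
qed


text \<open>Ten of the sixteen coordinates of the monomials ending in x_c are expressed by the other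
  six. Six is also the dimension of the solution space in \<open>perp_perp_poisson_data\<close>, as
  the comparison by triples requires.\<close>

lemma perp_dual_prePoisson_data_solved:
  fixes v :: "(dual_prepoisson_op \<times> bool) \<times> (dual_prepoisson_op \<times> bool) \<times> nat \<times> nat \<times> nat \<Rightarrow> 'k::field"
  defines "V \<equiv> \<lambda>p \<beta> q \<gamma> t. v ((p, \<beta>), (q, \<gamma>), t)"
  shows "v \<in> arity3_perp (arity3_coeffs dual_prePoisson_data) \<longleftrightarrow>
    (\<forall>a b c. (a, b, c) \<in> cyclic_triples \<longrightarrow>
      V Bracket False Bracket True (a, b, c) = - V Bracket False Bracket False (a, b, c) \<and>
      V Bracket True Bracket False (b, c, a) =
        V Bracket False Bracket False (a, b, c) + V Bracket True Bracket True (c, a, b) \<and>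
      V Star False Star True (a, b, c) = V Star False Star False (a, b, c) \<and>
      V Star True Star False (b, c, a) = V Star False Star False (a, b, c) \<and>
      V Star True Star True (c, a, b) = V Star False Star False (a, b, c) \<and>
      V Star False Bracket True (a, b, c) = - V Star False Bracket False (a, b, c) \<and>
      V Bracket False Star False (a, b, c) =
        V Star True Bracket False (b, c, a) + V Star True Bracket True (c, a, b) \<and>
      V Bracket False Star True (a, b, c) =
        V Star True Bracket False (b, c, a) + V Star True Bracket True (c, a, b) \<and>
      V Bracket True Star False (b, c, a) =
        V Star False Bracket False (a, b, c) + V Star True Bracket True (c, a, b) \<and>
      V Bracket True Star True (c, a, b) =
        V Star True Bracket False (b, c, a) - V Star False Bracket False (a, b, c))"
proof -
  have linear: "(x1 = x2 + x3 \<and> x3 = x4 + x1 \<and> y1 = y2 \<and> y3 = y4 \<and> y1 = y3 \<and> z1 = z2 + z3 \<and>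
        z4 = z5 + z6 \<and> w1 = z6 + z3 \<and> w2 = z6 + z3 \<and> z2 + z5 = 0) \<longleftrightarrow>
      (x4 = - x2 \<and> x1 = x2 + x3 \<and> y3 = y1 \<and> y2 = y1 \<and> y4 = y1 \<and> z5 = - z2 \<and> w1 = z6 + z3 \<and>
        w2 = z6 + z3 \<and> z1 = z2 + z3 \<and> z4 = z6 - z2)"
    for x1 x2 x3 x4 y1 y2 y3 y4 z1 z2 z3 z4 z5 z6 w1 w2 :: 'k
    by (auto simp: add_eq_0_iff2 add_eq_0_iff algebra_simps)
  show ?thesis
    unfolding perp_dual_prePoisson_data linear V_def by (rule refl)
qed

lemma UNIV_poisson_op: "(UNIV :: poisson_op set) = {Com, Lie}"
  using poisson_op.exhaust by auto

lemma all_cyclic_triples: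
  "(\<forall>a b c. (a, b, c) \<in> cyclic_triples \<longrightarrow> P a b c) \<longleftrightarrow> P 1 2 3 \<and> P 3 1 2 \<and> P 2 3 1"
  by (auto simp: cyclic_triples_def)

text \<open>The conditions describe combinations of associators (sum zero), of the Jacobi relator
  (equal coordinates) and of Leibniz relators. Necessity comes from testing against explicit
  solutions of \<open>perp_poisson_data\<close>; for sufficiency, substituting both solved systems
  makes the pairing cancel.\<close>

lemma perp_perp_poisson_data:
  fixes g :: "poisson_op \<times> poisson_op \<times> nat \<times> nat \<times> nat \<Rightarrow> 'k::field"
  shows "g \<in> arity3_perp (arity3_perp (arity3_coeffs poisson_data)) \<longleftrightarrow>
    (\<forall>a b c. (a, b, c) \<in> cyclic_triples \<longrightarrow>
      g (Com, Com, a, b, c) + g (Com, Com, b, c, a) + g (Com, Com, c, a, b) = 0 \<and>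
      g (Lie, Lie, a, b, c) = g (Lie, Lie, b, c, a) \<and>
      g (Com, Lie, a, b, c) = g (Lie, Com, b, c, a) - g (Lie, Com, c, a, b))" (is "_ \<longleftrightarrow> ?r")
proof
  assume g: "g \<in> arity3_perp (arity3_perp (arity3_coeffs poisson_data))"
  \<comment> \<open>for \<open>\<beta> 1 + \<beta> 2 + \<beta> 3 = 0\<close>, the general solution of the equations of \<open>perp_poisson_data\<close>\<close>
  define w where "w \<alpha> \<beta> \<mu> = (\<lambda>(p, q, x, y, z). case (p, q) of
      (Com, Com) \<Rightarrow> \<alpha> | (Lie, Lie) \<Rightarrow> \<beta> x | (Com, Lie) \<Rightarrow> \<mu> x | (Lie, Com) \<Rightarrow> \<mu> y - \<mu> z)"
    for \<alpha> :: 'k and \<beta> \<mu> :: "nat \<Rightarrow> 'k"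
  have "w \<alpha> \<beta> \<mu> \<in> arity3_perp (arity3_coeffs poisson_data)" if "\<beta> 1 + \<beta> 2 + \<beta> 3 = 0" for \<alpha> \<beta> \<mu>
    unfolding perp_poisson_data all_cyclic_triples using that by (simp add: w_def ac_simps)
  then have pairing_w: "arity3_pairing (w \<alpha> \<beta> \<mu>) g = 0" if "\<beta> 1 + \<beta> 2 + \<beta> 3 = 0" for \<alpha> \<beta> \<mu>
    using g that by (simp add: arity3_perp_def)
  have pairing: "\<alpha> * (g (Com, Com, 1, 2, 3) + g (Com, Com, 3, 1, 2) + g (Com, Com, 2, 3, 1)) +
      (\<beta> 1 * g (Lie, Lie, 1, 2, 3) + \<beta> 3 * g (Lie, Lie, 3, 1, 2) + \<beta> 2 * g (Lie, Lie, 2, 3, 1)) +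
      (\<mu> 1 * g (Com, Lie, 1, 2, 3) + \<mu> 3 * g (Com, Lie, 3, 1, 2) + \<mu> 2 * g (Com, Lie, 2, 3, 1)) +
      ((\<mu> 2 - \<mu> 3) * g (Lie, Com, 1, 2, 3) + (\<mu> 1 - \<mu> 2) * g (Lie, Com, 3, 1, 2) +
        (\<mu> 3 - \<mu> 1) * g (Lie, Com, 2, 3, 1)) = 0" (is "?e \<alpha> \<beta> \<mu> = 0")
    if "\<beta> 1 + \<beta> 2 + \<beta> 3 = 0" for \<alpha> and \<beta> \<mu> :: "nat \<Rightarrow> 'k"
  proof -
    have "arity3_pairing (w \<alpha> \<beta> \<mu>) g = ?e \<alpha> \<beta> \<mu>"
      unfolding arity3_pairing_eq sum_arity3_index UNIV_poisson_op by (simp add: w_def algebra_simps)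
    then show ?thesis using pairing_w that by simp
  qed
  \<comment> \<open>The six instances below form a basis of the parameters: one for \<alpha>, two
    differences of deltas spanning the \<beta> of sum zero, and three deltas for \<mu>.\<close>
  let ?\<delta> = "\<lambda>n m :: nat. if m = n then 1 else 0 :: 'k"
  show ?r
    unfolding all_cyclic_triples
    using pairing[of "\<lambda>_. 0" 1 "\<lambda>_. 0"] pairing[of "\<lambda>m. ?\<delta> 1 m - ?\<delta> 2 m" 0 "\<lambda>_. 0"]
      pairing[of "\<lambda>m. ?\<delta> 2 m - ?\<delta> 3 m" 0 "\<lambda>_. 0"] pairing[of "\<lambda>_. 0" 0 "?\<delta> 1"]
      pairing[of "\<lambda>_. 0" 0 "?\<delta> 2"] pairing[of "\<lambda>_. 0" 0 "?\<delta> 3"]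
    by (simp add: algebra_simps)
next
  assume r: ?r
  have solve: "z = - x - y" if "x + y + z = 0" for x y z :: 'k
  proof -
    have "z = (x + y + z) - x - y" by simp
    then show ?thesis unfolding that by simp
  qed
  have "arity3_pairing v g = 0" if "v \<in> arity3_perp (arity3_coeffs poisson_data)" for v
  proof -
    note v' = that[unfolded perp_poisson_data all_cyclic_triples] and g' = r[unfolded all_cyclic_triples]
    have v: "v (Com, Com, 3, 1, 2) = v (Com, Com, 1, 2, 3)" "v (Com, Com, 2, 3, 1) = v (Com, Com, 1, 2, 3)"
        "v (Lie, Lie, 3, 1, 2) = - v (Lie, Lie, 1, 2, 3) - v (Lie, Lie, 2, 3, 1)"
        "v (Lie, Com, 2, 3, 1) = v (Com, Lie, 3, 1, 2) - v (Com, Lie, 1, 2, 3)"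
        "v (Lie, Com, 1, 2, 3) = v (Com, Lie, 2, 3, 1) - v (Com, Lie, 3, 1, 2)"
        "v (Lie, Com, 3, 1, 2) = v (Com, Lie, 1, 2, 3) - v (Com, Lie, 2, 3, 1)"
      using v' by (blast, metis, blast intro: solve, blast+)
    have g: "g (Com, Com, 3, 1, 2) = - g (Com, Com, 1, 2, 3) - g (Com, Com, 2, 3, 1)"
        "g (Lie, Lie, 3, 1, 2) = g (Lie, Lie, 1, 2, 3)" "g (Lie, Lie, 2, 3, 1) = g (Lie, Lie, 1, 2, 3)"
        "g (Com, Lie, 1, 2, 3) = g (Lie, Com, 2, 3, 1) - g (Lie, Com, 3, 1, 2)"
        "g (Com, Lie, 3, 1, 2) = g (Lie, Com, 1, 2, 3) - g (Lie, Com, 2, 3, 1)"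
        "g (Com, Lie, 2, 3, 1) = g (Lie, Com, 3, 1, 2) - g (Lie, Com, 1, 2, 3)"
      using g' by (blast intro: solve, blast, metis, blast+)
    show ?thesis
    proof -
      have "arity3_pairing v g =
          v (Com, Com, 1, 2, 3) * g (Com, Com, 1, 2, 3) + v (Com, Com, 3, 1, 2) * g (Com, Com, 3, 1, 2) +
          v (Com, Com, 2, 3, 1) * g (Com, Com, 2, 3, 1) +
          (v (Lie, Lie, 1, 2, 3) * g (Lie, Lie, 1, 2, 3) + v (Lie, Lie, 3, 1, 2) * g (Lie, Lie, 3, 1, 2) +
          v (Lie, Lie, 2, 3, 1) * g (Lie, Lie, 2, 3, 1)) +
          (v (Com, Lie, 1, 2, 3) * g (Com, Lie, 1, 2, 3) + v (Com, Lie, 3, 1, 2) * g (Com, Lie, 3, 1, 2) +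
          v (Com, Lie, 2, 3, 1) * g (Com, Lie, 2, 3, 1)) +
          (v (Lie, Com, 1, 2, 3) * g (Lie, Com, 1, 2, 3) + v (Lie, Com, 3, 1, 2) * g (Lie, Com, 3, 1, 2) +
          v (Lie, Com, 2, 3, 1) * g (Lie, Com, 2, 3, 1))"
        unfolding arity3_pairing_eq sum_arity3_index UNIV_poisson_op by simp
      also have "\<dots> = 0" unfolding v g by (simp only: algebra_simps) simp
      finally show ?thesis .
    qed
  qed
  then show "g \<in> arity3_perp (arity3_perp (arity3_coeffs poisson_data))"
    by (simp add: arity3_perp_def)
qed


section \<open>The isomorphism\<close>

text \<open>The formal property of a Galois connection. It removes the double dual from
  \<open>koszul_dual preLie_data\<close>, of which the white product only sees the orthogonal of the
  relations.\<close>

lemma arity3_perp_triple: "arity3_perp (arity3_perp (arity3_perp U)) = arity3_perp U"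
proof (intro subset_antisym subsetI)
  fix x assume x: "x \<in> arity3_perp (arity3_perp (arity3_perp U))"
  have "u \<in> arity3_perp (arity3_perp U)" if "u \<in> U" for u
    using that by (auto simp: arity3_perp_def arity3_pairing_commute[of _ u])
  then show "x \<in> arity3_perp U" using x unfolding arity3_perp_def by blast
next
  fix x assume "x \<in> arity3_perp U"
  then show "x \<in> arity3_perp (arity3_perp (arity3_perp U))"
    unfolding arity3_perp_def[of "arity3_perp (arity3_perp U)"] unfolding arity3_perp_def[of "arity3_perp U"]
    by (auto simp: arity3_pairing_commute[of _ x])
qed

text \<open>
  In the white product of the operad Perm with the Koszul dual of Poiss, the bracket is the product
  with the Lie bracket dual to \<^const>\<open>Com\<close>, and \<open>*\<close> is the product with the commutative product
  dual to \<^const>\<open>Lie\<close>; the sign comes from the antisymmetry of that Lie bracket.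
\<close>

definition white_index :: "dual_prepoisson_op \<times> bool \<Rightarrow> (unit \<times> bool) \<times> poisson_op" where
  "white_index = (\<lambda>(p, \<beta>). (((), \<beta>), case p of Bracket \<Rightarrow> Com | Star \<Rightarrow> Lie))"

definition white_op :: "poisson_op \<Rightarrow> dual_prepoisson_op" where
  "white_op o' = (case o' of Com \<Rightarrow> Bracket | Lie \<Rightarrow> Star)"

definition white_sign :: "dual_prepoisson_op \<times> bool \<Rightarrow> 'k::field" where
  "white_sign = (\<lambda>(p, \<beta>). if p = Bracket \<and> \<beta> then - 1 else 1)"

lemma bij_white_index: "bij white_index"
  and inv_white_index: "inv white_index ((u, \<beta>), o') = (white_op o', \<beta>)"
proof -
  let ?g = "\<lambda>x :: (unit \<times> bool) \<times> poisson_op. (white_op (snd x), snd (fst x))"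
  have *: "white_index (white_op o', \<beta>) = (((), \<beta>), o')" for \<beta> o'
    by (auto simp: white_index_def white_op_def split: poisson_op.split)
  have "?g (white_index i) = i" for i
    by (auto simp: white_index_def white_op_def split: dual_prepoisson_op.split prod.split)
  then show b: "bij white_index"
    by (intro o_bij[of ?g] ext) (auto simp: *)
  show "inv white_index ((u, \<beta>), o') = (white_op o', \<beta>)"
    using inv_f_f[OF bij_is_inj[OF b], of "(white_op o', \<beta>)"] by (simp add: *)
qed

text \<open>On both sides the transposition exchanges the two vectors of each operation. Its
  coefficient is -1 throughout the source, but 1 for \<open>Com\<close> and -1 for
  \<open>Lie\<close> in the target, after the dualisations. Equivariance thus forces opposite signs
  on the two vectors of \<open>Bracket\<close> and equal signs on those of \<open>Star\<close>,
  which is \<open>white_sign\<close>.\<close>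

lemma monomial_isomorphism_white:
  "monomial_isomorphism (dual_module (regular_module :: (dual_prepoisson_op \<times> bool, 'k::field) S2_module))
     (dual_module (tensor_module (dual_module (dual_module regular_module)) (dual_module poisson_module)))
     white_index white_sign"
proof -
  have "dual_module (regular_module :: (dual_prepoisson_op \<times> bool, 'k) S2_module) (p, \<beta>) (q, \<gamma>) * white_sign (q, \<gamma>) =
     white_sign (p, \<beta>) * dual_module (tensor_module (dual_module (dual_module regular_module))
       (dual_module poisson_module)) (white_index (p, \<beta>)) (white_index (q, \<gamma>))" for p \<beta> q \<gamma>
    by (cases p; cases q; cases \<beta>; cases \<gamma>)
       (simp_all add: dual_module_def regular_module_def tensor_module_def poisson_module_def
          white_index_def white_sign_def)
  moreover have "white_sign i \<noteq> (0 :: 'k)" for i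
    by (auto simp: white_sign_def split: prod.split)
  ultimately show ?thesis
    unfolding monomial_isomorphism_def using bij_white_index by auto
qed

section \<open>Comparison of the two orthogonals under the signed bijection\<close>

lemma arity3_pairing_push:
  assumes "bij \<phi>"
  shows "arity3_pairing (arity3_push \<phi> \<epsilon> x) w =
    arity3_pairing x (\<lambda>(i, j, t). \<epsilon> i * \<epsilon> j * w (\<phi> i, \<phi> j, t))"
  unfolding arity3_pairing_eq
  by (subst sum.reindex_bij_betw[OF bij_betw_arity3_index[OF assms], symmetric], rule sum.cong)
     (use assms in \<open>auto simp: arity3_push_def bij_is_inj\<close>)

abbreviation white_perm_poisson :: "((unit \<times> bool) \<times> poisson_op, 'k::field) quadratic_data" where
  "white_perm_poisson \<equiv> white_product (koszul_dual preLie_data) (koszul_dual poisson_data)"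

lemma arity3_coeffs_white_perm_poisson:
  "arity3_coeffs (white_perm_poisson :: (_, 'k::field) quadratic_data) =
    {u. \<forall>h\<in>arity3_perp (arity3_coeffs perm_data).
      \<forall>g\<in>arity3_perp (arity3_perp (arity3_coeffs poisson_data)).
      (\<Sum>p\<in>arity3_index. u p * (h (index_fst p) * g (index_snd p))) = 0}"
proof -
  have T: "involutive_module (gens (perm_data :: (_, 'k) quadratic_data))"
      "involutive_module (gens (preLie_data :: (_, 'k) quadratic_data))"
      "involutive_module (gens (poisson_data :: (_, 'k) quadratic_data))"
      "involutive_module (gens (koszul_dual preLie_data :: (_, 'k) quadratic_data))"
      "involutive_module (gens (koszul_dual poisson_data :: (_, 'k) quadratic_data))"
    by (simp_all add: perm_data_def preLie_data_def poisson_data_def koszul_dual_def Let_def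
        quadratic_data_of_relators_def involutive_dual_module involutive_regular_module involutive_poisson_module)
  have c: "arity3_coeffs (koszul_dual preLie_data) = arity3_perp (arity3_perp (arity3_coeffs (perm_data :: (_, 'k) quadratic_data)))"
      "arity3_coeffs (koszul_dual poisson_data) = arity3_perp (arity3_coeffs (poisson_data :: (_, 'k) quadratic_data))"
    using arity3_coeffs_koszul_dual[OF T(1)] arity3_coeffs_koszul_dual[OF T(2)] arity3_coeffs_koszul_dual[OF T(3)]
    by (simp_all add: preLie_data_def)
  have U: "coord_subspace (arity3_coeffs (koszul_dual preLie_data :: (_, 'k) quadratic_data))"
      "coord_subspace (arity3_coeffs (koszul_dual poisson_data :: (_, 'k) quadratic_data))"
    unfolding c by (rule coord_subspace_perp)+
  have rels: "rels (koszul_dual preLie_data :: (_, 'k) quadratic_data) =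
        arity3_element (gens (koszul_dual preLie_data)) ` arity3_coeffs (koszul_dual preLie_data)"
      "rels (koszul_dual poisson_data :: (_, 'k) quadratic_data) =
        arity3_element (gens (koszul_dual poisson_data)) ` arity3_coeffs (koszul_dual poisson_data)"
    unfolding arity3_coeffs_koszul_dual[OF T(2)] arity3_coeffs_koszul_dual[OF T(3)] by (rule rels_koszul_dual)+
  show ?thesis
    using arity3_coeffs_white_product[OF T(4,5) U rels] unfolding c arity3_perp_triple .
qed

text \<open>The transported \<open>v\<close> is written as the sum of h_k \<otimes> g_k over k = 1,
  2, 3, and each summand is one of the tensors that define the relations of the white product. The
  content is that every g_k is a relation of Poiss: according to the place of k in
  \<open>(a, b, c)\<close>, this follows from the equations for \<open>v\<close> at the rotations of
  the triple.\<close>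

lemma push_perp_dual_prePoisson:
  fixes v :: "(dual_prepoisson_op \<times> bool) \<times> (dual_prepoisson_op \<times> bool) \<times> nat \<times> nat \<times> nat \<Rightarrow> 'k::field"
  assumes v: "v \<in> arity3_perp (arity3_coeffs dual_prePoisson_data)"
  shows "arity3_push white_index white_sign v \<in> arity3_perp (arity3_coeffs white_perm_poisson)"
proof -
  note E = v[unfolded perp_dual_prePoisson_data_solved, rule_format]
  \<comment> \<open>The nested conditional is the last factor of the monomial: \<beta> puts x_c
    first instead of last, and then \<gamma> decides whether the inner product ends in x_a or
    x_b.\<close>
  define h :: "nat \<Rightarrow> (unit \<times> bool) \<times> (unit \<times> bool) \<times> nat \<times> nat \<times> nat \<Rightarrow> 'k" where
    "h k = (\<lambda>((_, \<beta>), (_, \<gamma>), a, b, c). if (if \<beta> then if \<gamma> then a else b else c) = k then 1 else 0)" for k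
  \<comment> \<open>\<open>g k\<close> collects the values of \<open>v\<close> on the monomials whose Perm component has \<open>x\<^sub>k\<close> as last factor\<close>
  define g :: "nat \<Rightarrow> poisson_op \<times> poisson_op \<times> nat \<times> nat \<times> nat \<Rightarrow> 'k" where
    "g k = (\<lambda>(p, q, a, b, c).
       if c = k then v ((white_op p, False), (white_op q, False), a, b, c)
       else if b = k then white_sign (white_op p, True) * v ((white_op p, True), (white_op q, False), a, b, c)
       else white_sign (white_op p, True) * white_sign (white_op q, True) *
         v ((white_op p, True), (white_op q, True), a, b, c))" for k
  have h: "h k \<in> arity3_perp (arity3_coeffs perm_data)" for k
    unfolding perp_perm_data by (simp add: h_def)
  have g: "g k \<in> arity3_perp (arity3_perp (arity3_coeffs poisson_data))" if k: "k \<in> {1, 2, 3}" for k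
    unfolding perp_perp_poisson_data
  proof (intro allI impI)
    fix a b c :: nat assume abc: "(a, b, c) \<in> cyclic_triples"
    have d: "a \<noteq> b" "b \<noteq> c" "a \<noteq> c" "k \<in> {a, b, c}"
      using abc k by (auto simp: cyclic_triples_def)
    then consider "k = a" | "k = b" | "k = c" by blast
    then show "g k (Com, Com, a, b, c) + g k (Com, Com, b, c, a) + g k (Com, Com, c, a, b) = 0 \<and>
        g k (Lie, Lie, a, b, c) = g k (Lie, Lie, b, c, a) \<and>
        g k (Com, Lie, a, b, c) = g k (Lie, Com, b, c, a) - g k (Lie, Com, c, a, b)"
      using d E[OF abc] E[OF cyclic_triples_rotate(1)[OF abc]] E[OF cyclic_triples_rotate(2)[OF abc]]
      by cases (simp_all add: g_def white_op_def white_sign_def)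
  qed
  have push: "arity3_push white_index white_sign v p = (\<Sum>k\<in>{1, 2, 3}. h k (index_fst p) * g k (index_snd p))"
    if "p \<in> arity3_index" for p
  proof -
    obtain \<beta> o1 \<gamma> o2 a b c where p: "p = ((((), \<beta>), o1), (((), \<gamma>), o2), a, b, c)"
      by (metis old.unit.exhaust prod.collapse)
    have abc: "(a, b, c) \<in> cyclic_triples" using that by (simp add: p mem_arity3_index)
    then have d: "a \<noteq> b" "b \<noteq> c" "a \<noteq> c" "a \<in> {1, 2, 3}" "b \<in> {1, 2, 3}" "c \<in> {1, 2, 3}"
      by (auto simp: cyclic_triples_def)
    let ?d = "if \<beta> then if \<gamma> then a else b else c"
    have "(\<Sum>k\<in>{1, 2, 3}. h k (index_fst p) * g k (index_snd p)) =
        (\<Sum>k\<in>{1, 2, 3}. if k = ?d then g ?d (o1, o2, a, b, c) else 0)"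
      by (intro sum.cong) (simp_all add: p index_fst_def index_snd_def h_def)
    also have "\<dots> = g ?d (o1, o2, a, b, c)"
      using d by (subst sum.delta) (auto split: if_split)
    \<comment> \<open>\<open>g\<close> reads \<open>v\<close> off one monomial for each place of
      \<open>k\<close>. For the flags \<open>False\<close>, \<open>True\<close>, which it skips, the
      equations \<open>E\<close> give the value at \<open>False\<close>, \<open>False\<close> up to
      the sign in the transport.\<close>
    also have "\<dots> = arity3_push white_index white_sign v p"
      unfolding p arity3_push_def using d(1-3) E[OF abc]
      by (cases o1; cases o2; cases \<beta>; cases \<gamma>)
         (simp_all add: g_def inv_white_index white_op_def white_sign_def)
    finally show ?thesis ..
  qed
  have "arity3_pairing u (arity3_push white_index white_sign v) = 0"
    if u: "u \<in> arity3_coeffs white_perm_poisson" for u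
  proof -
    have "arity3_pairing u (arity3_push white_index white_sign v) =
        (\<Sum>p\<in>arity3_index. \<Sum>k\<in>{1, 2, 3}. u p * (h k (index_fst p) * g k (index_snd p)))"
      by (simp add: arity3_pairing_eq push sum_distrib_left del: sum.insert)
    also have "\<dots> = (\<Sum>k\<in>{1, 2, 3}. \<Sum>p\<in>arity3_index. u p * (h k (index_fst p) * g k (index_snd p)))"
      by (rule sum.swap)
    also have "\<dots> = 0"
      using u h g unfolding arity3_coeffs_white_perm_poisson by (intro sum.neutral) blast
    finally show ?thesis .
  qed
  then show ?thesis by (simp add: arity3_perp_def)
qed

text \<open>By adjointness it suffices that the pullback \<open>v\<close> of h \<otimes> g is
  orthogonal to the dual-prePoisson relations. In each equation for \<open>(a, b, c)\<close> all
  monomials end in x_c, so \<open>h\<close> contributes a common factor, and what remains is a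
  consequence of the Poisson equations for \<open>g\<close>.\<close>

lemma push_coeffs_dual_prePoisson:
  fixes x :: "(dual_prepoisson_op \<times> bool) \<times> (dual_prepoisson_op \<times> bool) \<times> nat \<times> nat \<times> nat \<Rightarrow> 'k::field"
  assumes x: "x \<in> arity3_coeffs dual_prePoisson_data"
  shows "arity3_push white_index white_sign x \<in> arity3_coeffs white_perm_poisson"
  unfolding arity3_coeffs_white_perm_poisson
proof (intro CollectI ballI)
  fix h :: "(unit \<times> bool) \<times> (unit \<times> bool) \<times> nat \<times> nat \<times> nat \<Rightarrow> 'k"
    and g :: "poisson_op \<times> poisson_op \<times> nat \<times> nat \<times> nat \<Rightarrow> 'k"
  assume h: "h \<in> arity3_perp (arity3_coeffs perm_data)"
    and g: "g \<in> arity3_perp (arity3_perp (arity3_coeffs poisson_data))"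
  note H = h[unfolded perp_perm_data, rule_format]
  note G = g[unfolded perp_perp_poisson_data, rule_format]
  define w where "w p = h (index_fst p) * g (index_snd p)" for p
  define v where "v = (\<lambda>(i, j, t). white_sign i * white_sign j * w (white_index i, white_index j, t))"
  have "v \<in> arity3_perp (arity3_coeffs dual_prePoisson_data)"
    unfolding perp_dual_prePoisson_data_solved
  proof (intro allI impI)
    fix a b c :: nat assume abc: "(a, b, c) \<in> cyclic_triples"
    have H': "h (((), False), ((), True), a, b, c) = h (((), False), ((), False), a, b, c)"
        "h (((), True), ((), False), b, c, a) = h (((), False), ((), False), a, b, c)"
        "h (((), True), ((), True), c, a, b) = h (((), False), ((), False), a, b, c)"
      using H[OF abc] by auto
    have "g (Com, Com, a, b, c) + g (Com, Com, b, c, a) + g (Com, Com, c, a, b) = 0"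
      using G[OF abc] by blast
    then have G1: "g (Com, Com, b, c, a) = - g (Com, Com, a, b, c) - g (Com, Com, c, a, b)"
      by (simp add: algebra_simps eq_neg_iff_add_eq_0)
    have G2: "g (Lie, Lie, b, c, a) = g (Lie, Lie, a, b, c)" "g (Lie, Lie, c, a, b) = g (Lie, Lie, a, b, c)"
        "g (Com, Lie, a, b, c) = g (Lie, Com, b, c, a) - g (Lie, Com, c, a, b)"
        "g (Com, Lie, b, c, a) = g (Lie, Com, c, a, b) - g (Lie, Com, a, b, c)"
        "g (Com, Lie, c, a, b) = g (Lie, Com, a, b, c) - g (Lie, Com, b, c, a)"
      using G[OF abc] G[OF cyclic_triples_rotate(1)[OF abc]] G[OF cyclic_triples_rotate(2)[OF abc]] by auto
    show "v ((Bracket, False), (Bracket, True), a, b, c) = - v ((Bracket, False), (Bracket, False), a, b, c) \<and>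
      v ((Bracket, True), (Bracket, False), b, c, a) =
        v ((Bracket, False), (Bracket, False), a, b, c) + v ((Bracket, True), (Bracket, True), c, a, b) \<and>
      v ((Star, False), (Star, True), a, b, c) = v ((Star, False), (Star, False), a, b, c) \<and>
      v ((Star, True), (Star, False), b, c, a) = v ((Star, False), (Star, False), a, b, c) \<and>
      v ((Star, True), (Star, True), c, a, b) = v ((Star, False), (Star, False), a, b, c) \<and>
      v ((Star, False), (Bracket, True), a, b, c) = - v ((Star, False), (Bracket, False), a, b, c) \<and>
      v ((Bracket, False), (Star, False), a, b, c) =
        v ((Star, True), (Bracket, False), b, c, a) + v ((Star, True), (Bracket, True), c, a, b) \<and>
      v ((Bracket, False), (Star, True), a, b, c) =
        v ((Star, True), (Bracket, False), b, c, a) + v ((Star, True), (Bracket, True), c, a, b) \<and>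
      v ((Bracket, True), (Star, False), b, c, a) =
        v ((Star, False), (Bracket, False), a, b, c) + v ((Star, True), (Bracket, True), c, a, b) \<and>
      v ((Bracket, True), (Star, True), c, a, b) =
        v ((Star, True), (Bracket, False), b, c, a) - v ((Star, False), (Bracket, False), a, b, c)"
      by (simp add: v_def w_def white_index_def white_sign_def index_fst_def index_snd_def H' G1 G2 algebra_simps)
  qed
  then have "arity3_pairing x v = 0" using x by (simp add: arity3_perp_def)
  then have "arity3_pairing (arity3_push white_index white_sign x) w = 0"
    unfolding arity3_pairing_push[OF bij_white_index] v_def .
  then show "(\<Sum>p\<in>arity3_index. arity3_push white_index white_sign x p * (h (index_fst p) * g (index_snd p))) = 0"
    by (simp add: arity3_pairing_eq w_def)
qed

text \<open>The signs are their own inverses, so transport along the inverse bijection is the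
  pullback, which is adjoint to the transport of relations in
  \<open>push_coeffs_dual_prePoisson\<close>.\<close>

lemma push_inverse_perp_white:
  fixes w :: "((unit \<times> bool) \<times> poisson_op) \<times> ((unit \<times> bool) \<times> poisson_op) \<times> nat \<times> nat \<times> nat \<Rightarrow> 'k::field"
  assumes w: "w \<in> arity3_perp (arity3_coeffs white_perm_poisson)"
  shows "arity3_push (inv white_index) (\<lambda>j. inverse (white_sign (inv white_index j))) w \<in>
    arity3_perp (arity3_coeffs dual_prePoisson_data)"
proof -
  have inv_sign: "inverse (white_sign i) = (white_sign i :: 'k)" for i
    by (auto simp: white_sign_def split: prod.split)
  have "arity3_push (inv white_index) (\<lambda>j. inverse (white_sign (inv white_index j))) w =
      (\<lambda>(i, j, t). white_sign i * white_sign j * w (white_index i, white_index j, t))"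
    by (auto simp: arity3_push_def inv_inv_eq bij_white_index bij_is_inj inv_sign)
  then show ?thesis
    using w push_coeffs_dual_prePoisson
    by (auto simp: arity3_perp_def simp flip: arity3_pairing_push[OF bij_white_index])
qed

theorem mainTheorem3:
  "operad_isomorphic
     (quadratic_operad
        (prePoisson_data :: (dual_prepoisson_op \<times> bool, 'k::field_char_0) quadratic_data))
     (quadratic_operad
        (black_product (preLie_data :: (unit \<times> bool, 'k) quadratic_data)
                       (poisson_data :: (poisson_op, 'k) quadratic_data)))"
proof (rule operad_isomorphic_quadratic_operad)
  show "monomial_isomorphism (gens (prePoisson_data :: (_, 'k) quadratic_data))
      (gens (black_product preLie_data poisson_data)) white_index white_sign"
    using monomial_isomorphism_white
    by (simp add: prePoisson_data_def dual_prePoisson_data_def black_product_def white_product_def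
        preLie_data_def perm_data_def poisson_data_def koszul_dual_def quadratic_data_of_relators_def Let_def)
  show "rels prePoisson_data = arity3_element (gens (prePoisson_data :: (_, 'k) quadratic_data)) `
      arity3_perp (arity3_coeffs dual_prePoisson_data)"
    unfolding prePoisson_data_def by (rule rels_koszul_dual)
  show "rels (black_product preLie_data poisson_data) =
      arity3_element (gens (black_product preLie_data (poisson_data :: (_, 'k) quadratic_data))) `
      arity3_perp (arity3_coeffs white_perm_poisson)"
    unfolding black_product_def by (rule rels_koszul_dual)
qed (fact push_perp_dual_prePoisson push_inverse_perp_white)+

end
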